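(* For each $n\ge 1$, there are group isomorphisms $$\mathrm{Aut}_{\mathrm{algebra}}\big(\mathbb{Z}[FQ_n]\big)\cong\mathrm{Aut}_{\mathrm{quandle}}(FQ_n)\cong WB_n.$$
   Context: A quandle is a non-empty set $X$ with a binary operation $*$ such that, for each $y\in X$, the map $x\mapsto x*y$ is an automorphism of $(X,* )$ fixing $y$. $FQ_n$ is the free quandle of rank $n$, and $\mathrm{Aut}_{\mathrm{quandle}}(FQ_n)$ is its group of quandle automorphisms. The quandle ring $\mathbb{Z}[X]$ is the free $\mathbb{Z}$-module with basis $\{e_x\mid x\in X\}$ with the (in general non-associative) bilinear product determined by $e_xe_y=e_{x*y}$. $\mathrm{Aut}_{\mathrm{algebra}}(\mathbb{Z}[X])$ is the group of $\mathbb{Z}$-linear ring automorphisms of $\mathbb{Z}[X]$. $WB_n$ is the welded braid group on $n$ strands: the group generated by $\sigma_1,\dots,\sigma_{n-1},\rho_1,\dots,\rho_{n-1}$ with relations $\sigma_i\sigma_j=\sigma_j\sigma_i$, $\rho_i\rho_j=\rho_j\rho_i$, $\sigma_i\rho_j=\rho_j\sigma_i$ for $|i-j|\ge 2$; $\sigma_i\sigma_{i+1}\sigma_i=\sigma_{i+1}\sigma_i\sigma_{i+1}$; $\rho_i\rho_{i+1}\rho_i=\rho_{i+1}\rho_i\rho_{i+1}$; $\rho_i^2=1$; $\rho_i\rho_{i+1}\sigma_i=\sigma_{i+1}\rho_i\rho_{i+1}$; and $\sigma_i\sigma_{i+1}\rho_i=\rho_{i+1}\sigma_i\sigma_{i+1}$.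 *)

theory Defs
  imports "HOL-Algebra.Bij" "HOL-Algebra.Free_Abelian_Groups"
begin

section \<open>Quandles\<close>

record 'a qstruct = "'a partial_object" +
  qop :: "['a, 'a] \<Rightarrow> 'a" (infixl "\<triangleright>\<index>" 70)

definition qhom :: "('a, 'c) qstruct_scheme \<Rightarrow> ('b, 'd) qstruct_scheme \<Rightarrow> ('a \<Rightarrow> 'b) set" where
  "qhom Q R = {h \<in> carrier Q \<rightarrow> carrier R.
     \<forall>x\<in>carrier Q. \<forall>y\<in>carrier Q. h (x \<triangleright>\<^bsub>Q\<^esub> y) = h x \<triangleright>\<^bsub>R\<^esub> h y}"

definition qauto :: "('a, 'c) qstruct_scheme \<Rightarrow> ('a \<Rightarrow> 'a) set" where
  "qauto Q = qhom Q Q \<inter> Bij (carrier Q)"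

locale quandle =
  fixes Q (structure)
  assumes nonempty: "carrier Q \<noteq> {}"
    and op_closed: "\<lbrakk>x \<in> carrier Q; y \<in> carrier Q\<rbrakk> \<Longrightarrow> x \<triangleright> y \<in> carrier Q"
    and right_mult_auto: "y \<in> carrier Q \<Longrightarrow> (\<lambda>x\<in>carrier Q. x \<triangleright> y) \<in> qauto Q"
    and idem: "y \<in> carrier Q \<Longrightarrow> y \<triangleright> y = y"

definition AutQuandle :: "('a, 'c) qstruct_scheme \<Rightarrow> ('a \<Rightarrow> 'a) monoid" where
  "AutQuandle Q = BijGroup (carrier Q) \<lparr>carrier := qauto Q\<rparr>"


section \<open>Free quandles\<close>

text \<open>The free quandle on \<open>S\<close> is the algebra of terms over \<open>S\<close> modulo the congruence generated by
  the quandle identities. \<open>QInv x y\<close> denotes the preimage of \<open>x\<close> under right multiplication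
  by \<open>y\<close>; it is what makes the bijectivity of right multiplications equational.\<close>

datatype 'g qterm = QGen 'g | QOp "'g qterm" "'g qterm" | QInv "'g qterm" "'g qterm"

definition qterms :: "'g set \<Rightarrow> 'g qterm set" where
  "qterms S = {t. set_qterm t \<subseteq> S}"

inductive_set free_quandle_rel :: "'g set \<Rightarrow> ('g qterm \<times> 'g qterm) set" for S where
  refl: "t \<in> qterms S \<Longrightarrow> (t, t) \<in> free_quandle_rel S"
| sym: "(t, u) \<in> free_quandle_rel S \<Longrightarrow> (u, t) \<in> free_quandle_rel S"
| trans: "\<lbrakk>(t, u) \<in> free_quandle_rel S; (u, v) \<in> free_quandle_rel S\<rbrakk> \<Longrightarrow> (t, v) \<in> free_quandle_rel S"
| cong_op: "\<lbrakk>(t, t') \<in> free_quandle_rel S; (u, u') \<in> free_quandle_rel S\<rbrakk>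
    \<Longrightarrow> (QOp t u, QOp t' u') \<in> free_quandle_rel S"
| cong_inv: "\<lbrakk>(t, t') \<in> free_quandle_rel S; (u, u') \<in> free_quandle_rel S\<rbrakk>
    \<Longrightarrow> (QInv t u, QInv t' u') \<in> free_quandle_rel S"
| idem: "t \<in> qterms S \<Longrightarrow> (QOp t t, t) \<in> free_quandle_rel S"
| inv_op: "\<lbrakk>t \<in> qterms S; u \<in> qterms S\<rbrakk> \<Longrightarrow> (QInv (QOp t u) u, t) \<in> free_quandle_rel S"
| op_inv: "\<lbrakk>t \<in> qterms S; u \<in> qterms S\<rbrakk> \<Longrightarrow> (QOp (QInv t u) u, t) \<in> free_quandle_rel S"
| distrib: "\<lbrakk>t \<in> qterms S; u \<in> qterms S; v \<in> qterms S\<rbrakk>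
    \<Longrightarrow> (QOp (QOp t u) v, QOp (QOp t v) (QOp u v)) \<in> free_quandle_rel S"

definition free_quandle :: "'g set \<Rightarrow> 'g qterm set qstruct" where
  "free_quandle S = \<lparr>carrier = qterms S // free_quandle_rel S,
     qop = (\<lambda>A B. \<Union>t\<in>A. \<Union>u\<in>B. free_quandle_rel S `` {QOp t u})\<rparr>"

abbreviation FQ :: "nat \<Rightarrow> nat qterm set qstruct" where
  "FQ n \<equiv> free_quandle {1..n}"


section \<open>Integral quandle rings\<close>

text \<open>The underlying abelian group of \<open>\<int>[Q]\<close> is \<^term>\<open>free_Abelian_group (carrier Q)\<close>, the finitely
  supported integer-valued functions, with basis \<^term>\<open>frag_of x\<close> for \<open>x\<close> in \<open>Q\<close>.
  The product is the bilinear extension of the quandle operation on the basis.\<close>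

definition qring_mult ::
  "('a, 'c) qstruct_scheme \<Rightarrow> ('a \<Rightarrow>\<^sub>0 int) \<Rightarrow> ('a \<Rightarrow>\<^sub>0 int) \<Rightarrow> ('a \<Rightarrow>\<^sub>0 int)" where
  "qring_mult Q a b = frag_extend (\<lambda>x. frag_extend (\<lambda>y. frag_of (x \<triangleright>\<^bsub>Q\<^esub> y)) b) a"

definition qring_auto :: "('a, 'c) qstruct_scheme \<Rightarrow> (('a \<Rightarrow>\<^sub>0 int) \<Rightarrow> ('a \<Rightarrow>\<^sub>0 int)) set" where
  "qring_auto Q = {f \<in> Bij (carrier (free_Abelian_group (carrier Q))).
     (\<forall>a\<in>carrier (free_Abelian_group (carrier Q)). \<forall>b\<in>carrier (free_Abelian_group (carrier Q)).
        f (a + b) = f a + f b) \<and>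
     (\<forall>k. \<forall>a\<in>carrier (free_Abelian_group (carrier Q)). f (frag_cmul k a) = frag_cmul k (f a)) \<and>
     (\<forall>a\<in>carrier (free_Abelian_group (carrier Q)). \<forall>b\<in>carrier (free_Abelian_group (carrier Q)).
        f (qring_mult Q a b) = qring_mult Q (f a) (f b))}"

definition AutQuandleRing ::
  "('a, 'c) qstruct_scheme \<Rightarrow> (('a \<Rightarrow>\<^sub>0 int) \<Rightarrow> ('a \<Rightarrow>\<^sub>0 int)) monoid" where
  "AutQuandleRing Q =
     BijGroup (carrier (free_Abelian_group (carrier Q))) \<lparr>carrier := qring_auto Q\<rparr>"


section \<open>Group presentations\<close>

text \<open>A letter \<open>(g, True)\<close> stands for the generator \<open>g\<close>, and \<open>(g, False)\<close> for its inverse.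
  A pair \<open>(l, r)\<close> in \<open>R\<close> stands for the relation \<open>l = r\<close>.\<close>

type_synonym 'g gword = "('g \<times> bool) list"

definition gwords :: "'g set \<Rightarrow> 'g gword set" where
  "gwords S = lists (S \<times> UNIV)"

inductive_set presentation_rel ::
  "'g set \<Rightarrow> ('g gword \<times> 'g gword) set \<Rightarrow> ('g gword \<times> 'g gword) set" for S R where
  refl: "w \<in> gwords S \<Longrightarrow> (w, w) \<in> presentation_rel S R"
| sym: "(v, w) \<in> presentation_rel S R \<Longrightarrow> (w, v) \<in> presentation_rel S R"
| trans: "\<lbrakk>(u, v) \<in> presentation_rel S R; (v, w) \<in> presentation_rel S R\<rbrakk>
    \<Longrightarrow> (u, w) \<in> presentation_rel S R"
| cong: "\<lbrakk>(v, v') \<in> presentation_rel S R; (w, w') \<in> presentation_rel S R\<rbrakk>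
    \<Longrightarrow> (v @ w, v' @ w') \<in> presentation_rel S R"
| cancel: "g \<in> S \<Longrightarrow> ([(g, b), (g, \<not> b)], []) \<in> presentation_rel S R"
| relation: "\<lbrakk>(l, r) \<in> R; l \<in> gwords S; r \<in> gwords S\<rbrakk> \<Longrightarrow> (l, r) \<in> presentation_rel S R"

definition presented_group :: "'g set \<Rightarrow> ('g gword \<times> 'g gword) set \<Rightarrow> 'g gword set monoid" where
  "presented_group S R = \<lparr>carrier = gwords S // presentation_rel S R,
     mult = (\<lambda>A B. \<Union>v\<in>A. \<Union>w\<in>B. presentation_rel S R `` {v @ w}),
     one = presentation_rel S R `` {[]}\<rparr>"


section \<open>Welded braid groups\<close>

datatype welded_gen = Sig nat | Rho nat

abbreviation sig :: "nat \<Rightarrow> welded_gen \<times> bool" where "sig i \<equiv> (Sig i, True)"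
abbreviation rho :: "nat \<Rightarrow> welded_gen \<times> bool" where "rho i \<equiv> (Rho i, True)"

definition welded_gens :: "nat \<Rightarrow> welded_gen set" where
  "welded_gens n = Sig ` {1..<n} \<union> Rho ` {1..<n}"

text \<open>Far commutativity is imposed for both orders of \<open>i\<close> and \<open>j\<close>; this matters
  for \<open>\<sigma>\<^sub>i \<rho>\<^sub>j = \<rho>\<^sub>j \<sigma>\<^sub>i\<close>.\<close>

definition welded_rels :: "nat \<Rightarrow> (welded_gen gword \<times> welded_gen gword) set" where
  "welded_rels n =
     (\<Union>i\<in>{1..<n}. \<Union>j\<in>{j\<in>{1..<n}. i + 2 \<le> j \<or> j + 2 \<le> i}.
        {([sig i, sig j], [sig j, sig i]),
         ([rho i, rho j], [rho j, rho i]),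
         ([sig i, rho j], [rho j, sig i])})
   \<union> (\<Union>i\<in>{i. 1 \<le> i \<and> i + 1 < n}.
        {([sig i, sig (i+1), sig i], [sig (i+1), sig i, sig (i+1)]),
         ([rho i, rho (i+1), rho i], [rho (i+1), rho i, rho (i+1)]),
         ([rho i, rho (i+1), sig i], [sig (i+1), rho i, rho (i+1)]),
         ([sig i, sig (i+1), rho i], [rho (i+1), sig i, sig (i+1)])})
   \<union> (\<Union>i\<in>{1..<n}. {([rho i, rho i], [])})"

definition WB :: "nat \<Rightarrow> welded_gen gword set monoid" where
  "WB n = presented_group (welded_gens n) (welded_rels n)"


section \<open>Adequacy of the definitions\<close>

lemma AutQuandle_group:
  assumes "quandle Q"
  shows "group (AutQuandle Q)"
proof -
  interpret quandle Q by fact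
  have "subgroup (qauto Q) (BijGroup (carrier Q))"
  proof (rule group.subgroupI[OF group_BijGroup])
    show "qauto Q \<subseteq> carrier (BijGroup (carrier Q))"
      by (auto simp: qauto_def BijGroup_def)
    have "(\<lambda>x\<in>carrier Q. x) \<in> qauto Q"
      by (auto simp: qauto_def qhom_def id_Bij op_closed)
    then show "qauto Q \<noteq> {}" by blast
  next
    fix f assume f: "f \<in> qauto Q"
    have "inv_into (carrier Q) f (qop Q x y) = qop Q (inv_into (carrier Q) f x) (inv_into (carrier Q) f y)"
      if "x \<in> carrier Q" "y \<in> carrier Q" for x y
      by (rule Bij_inv_into_lemma) (use f that op_closed in \<open>auto simp: qauto_def qhom_def\<close>)
    then show "inv\<^bsub>BijGroup (carrier Q)\<^esub> f \<in> qauto Q"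
      using f by (auto simp: qauto_def qhom_def inv_BijGroup restrict_inv_into_Bij Bij_inv_into_mem op_closed)
  next
    fix f g assume "f \<in> qauto Q" "g \<in> qauto Q"
    then show "f \<otimes>\<^bsub>BijGroup (carrier Q)\<^esub> g \<in> qauto Q"
      by (auto simp: qauto_def qhom_def BijGroup_def compose_Bij compose_eq op_closed Pi_iff)
  qed
  then show ?thesis
    unfolding AutQuandle_def by (rule subgroup.subgroup_is_group[OF _ group_BijGroup])
qed

lemma qring_mult_closed:
  assumes "quandle Q" "a \<in> carrier (free_Abelian_group (carrier Q))"
    "b \<in> carrier (free_Abelian_group (carrier Q))"
  shows "qring_mult Q a b \<in> carrier (free_Abelian_group (carrier Q))"
proof -
  have "Poly_Mapping.keys (qring_mult Q a b) \<subseteq> carrier Q"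
    unfolding qring_mult_def
    using assms quandle.op_closed[OF assms(1)]
    by (fastforce dest!: subsetD[OF keys_frag_extend])
  then show ?thesis by simp
qed

lemma AutQuandleRing_group:
  assumes "quandle Q"
  shows "group (AutQuandleRing Q)"
proof -
  let ?C = "carrier (free_Abelian_group (carrier Q))"
  have add: "a + b \<in> ?C" if "a \<in> ?C" "b \<in> ?C" for a b
    using that Poly_Mapping.keys_add[of a b] by auto
  have cmul: "frag_cmul k a \<in> ?C" if "a \<in> ?C" for k a
    using that by auto
  note mult = qring_mult_closed[OF assms]
  have "subgroup (qring_auto Q) (BijGroup ?C)"
  proof (rule group.subgroupI[OF group_BijGroup])
    show "qring_auto Q \<subseteq> carrier (BijGroup ?C)"
      by (auto simp: qring_auto_def BijGroup_def)
    have "(\<lambda>x\<in>?C. x) \<in> qring_auto Q"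
      using id_Bij[of ?C] add cmul mult by (simp add: qring_auto_def)
    then show "qring_auto Q \<noteq> {}" by blast
  next
    fix f assume f: "f \<in> qring_auto Q"
    then have B: "f \<in> Bij ?C" by (simp add: qring_auto_def)
    define g where "g = inv_into ?C f"
    have gC: "g x \<in> ?C" if "x \<in> ?C" for x
      using Bij_inv_into_mem[OF B that] by (simp add: g_def)
    have fg: "f (g x) = x" if "x \<in> ?C" for x
      using B that unfolding g_def Bij_def bij_betw_def by (auto intro: f_inv_into_f)
    have gf: "g (f x) = x" if "x \<in> ?C" for x
      using B that unfolding g_def Bij_def bij_betw_def by (auto intro: inv_into_f_f)
    have "g (x + y) = g x + g y" if "x \<in> ?C" "y \<in> ?C" for x y
    proof -
      have "f (g x + g y) = x + y"
        using f gC[OF that(1)] gC[OF that(2)] fg that unfolding qring_auto_def by auto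
      then show ?thesis using gf[OF add[OF gC[OF that(1)] gC[OF that(2)]]] by simp
    qed
    moreover have "g (frag_cmul k x) = frag_cmul k (g x)" if "x \<in> ?C" for k x
    proof -
      have "f (frag_cmul k (g x)) = frag_cmul k x"
        using f gC[OF that] fg that unfolding qring_auto_def by auto
      then show ?thesis using gf[OF cmul[OF gC[OF that], of k]] by simp
    qed
    moreover have "g (qring_mult Q x y) = qring_mult Q (g x) (g y)" if "x \<in> ?C" "y \<in> ?C" for x y
    proof -
      have "f (qring_mult Q (g x) (g y)) = qring_mult Q x y"
        using f gC[OF that(1)] gC[OF that(2)] fg that unfolding qring_auto_def by auto
      then show ?thesis using gf[OF mult[OF gC[OF that(1)] gC[OF that(2)]]] by simp
    qed
    moreover have "inv\<^bsub>BijGroup ?C\<^esub> f = restrict g ?C"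
      using inv_BijGroup[OF B] by (simp add: g_def)
    moreover have "restrict g ?C \<in> Bij ?C"
      using restrict_inv_into_Bij[OF B] by (simp add: g_def)
    ultimately show "inv\<^bsub>BijGroup ?C\<^esub> f \<in> qring_auto Q"
      using add cmul mult unfolding qring_auto_def by simp
  next
    fix f g assume fg: "f \<in> qring_auto Q" "g \<in> qring_auto Q"
    then have B: "f \<in> Bij ?C" "g \<in> Bij ?C" by (auto simp: qring_auto_def)
    have gC: "g x \<in> ?C" if "x \<in> ?C" for x
      using Bij_imp_funcset[OF B(2)] that by blast
    have "compose ?C f g \<in> qring_auto Q"
      using fg compose_Bij[OF B] gC add cmul mult
      unfolding qring_auto_def by (simp add: compose_eq)
    then show "f \<otimes>\<^bsub>BijGroup ?C\<^esub> g \<in> qring_auto Q"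
      using B by (simp add: BijGroup_def)
  qed
  then show ?thesis
    unfolding AutQuandleRing_def by (rule subgroup.subgroup_is_group[OF _ group_BijGroup])
qed

lemma qring_mult_frag_of: "qring_mult Q (frag_of x) (frag_of y) = frag_of (x \<triangleright>\<^bsub>Q\<^esub> y)"
  by (simp add: qring_mult_def)

lemma qring_mult_add_left: "qring_mult Q (a + b) c = qring_mult Q a c + qring_mult Q b c"
  by (simp add: qring_mult_def frag_extend_add)

lemma qring_mult_add_right: "qring_mult Q a (b + c) = qring_mult Q a b + qring_mult Q a c"
  unfolding qring_mult_def frag_extend_add
  by (simp add: frag_extend_def frag_cmul_distrib2 sum.distrib)

lemma qterms_simps [simp]:
  "QGen g \<in> qterms S \<longleftrightarrow> g \<in> S"
  "QOp t u \<in> qterms S \<longleftrightarrow> t \<in> qterms S \<and> u \<in> qterms S"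
  "QInv t u \<in> qterms S \<longleftrightarrow> t \<in> qterms S \<and> u \<in> qterms S"
  by (auto simp: qterms_def)

lemma free_quandle_rel_qterms:
  "(t, u) \<in> free_quandle_rel S \<Longrightarrow> t \<in> qterms S \<and> u \<in> qterms S"
  by (induction rule: free_quandle_rel.induct) auto

lemma equiv_free_quandle_rel: "equiv (qterms S) (free_quandle_rel S)"
  by (rule equivI)
    (auto intro!: refl_onI symI transI dest: free_quandle_rel_qterms
      intro: free_quandle_rel.intros)

definition fq_class :: "'g set \<Rightarrow> 'g qterm \<Rightarrow> 'g qterm set" where
  "fq_class S t = free_quandle_rel S `` {t}"

lemma fq_class_eq_iff:
  "\<lbrakk>t \<in> qterms S; u \<in> qterms S\<rbrakk> \<Longrightarrow> fq_class S t = fq_class S u \<longleftrightarrow> (t, u) \<in> free_quandle_rel S"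
  unfolding fq_class_def by (rule eq_equiv_class_iff[OF equiv_free_quandle_rel])

lemma carrier_free_quandle: "carrier (free_quandle S) = fq_class S ` qterms S"
  by (auto simp: free_quandle_def quotient_def fq_class_def)

lemma qop_free_quandle:
  assumes "t \<in> qterms S" "u \<in> qterms S"
  shows "fq_class S t \<triangleright>\<^bsub>free_quandle S\<^esub> fq_class S u = fq_class S (QOp t u)"
proof -
  have "congruent2 (free_quandle_rel S) (free_quandle_rel S) (\<lambda>t u. free_quandle_rel S `` {QOp t u})"
    unfolding congruent2_def
    by (auto intro!: equiv_class_eq[OF equiv_free_quandle_rel] intro: free_quandle_rel.cong_op)
  from UN_equiv_class2[OF equiv_free_quandle_rel equiv_free_quandle_rel this assms]
  show ?thesis by (simp add: free_quandle_def fq_class_def)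
qed

theorem quandle_free_quandle:
  assumes "S \<noteq> {}"
  shows "quandle (free_quandle S)"
proof
  let ?F = "free_quandle S"
  obtain s where "s \<in> S" using assms by blast
  then show "carrier ?F \<noteq> {}"
    using qterms_simps(1)[of s S] by (auto simp: carrier_free_quandle simp del: qterms_simps)
  show closed: "x \<triangleright>\<^bsub>?F\<^esub> y \<in> carrier ?F" if "x \<in> carrier ?F" "y \<in> carrier ?F" for x y
    using that by (auto simp: carrier_free_quandle qop_free_quandle)
  show "y \<triangleright>\<^bsub>?F\<^esub> y = y" if y: "y \<in> carrier ?F" for y
  proof -
    obtain t where t: "t \<in> qterms S" "y = fq_class S t"
      using y by (auto simp: carrier_free_quandle)
    then have "fq_class S (QOp t t) = fq_class S t"
      by (simp add: fq_class_eq_iff free_quandle_rel.idem)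
    then show ?thesis using t by (simp add: qop_free_quandle)
  qed
  show "(\<lambda>x\<in>carrier ?F. x \<triangleright>\<^bsub>?F\<^esub> y) \<in> qauto ?F" if y: "y \<in> carrier ?F" for y
  proof -
    obtain u where u: "u \<in> qterms S" "y = fq_class S u"
      using y by (auto simp: carrier_free_quandle)
    have inj: "fq_class S t = fq_class S t'"
      if "t \<in> qterms S" "t' \<in> qterms S" "fq_class S (QOp t u) = fq_class S (QOp t' u)" for t t'
    proof -
      have "(QOp t u, QOp t' u) \<in> free_quandle_rel S"
        using that u by (simp add: fq_class_eq_iff)
      then have "(QInv (QOp t u) u, QInv (QOp t' u) u) \<in> free_quandle_rel S"
        using u by (intro free_quandle_rel.cong_inv free_quandle_rel.refl)
      then have "(t, t') \<in> free_quandle_rel S"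
        using that u by (meson free_quandle_rel.inv_op free_quandle_rel.sym free_quandle_rel.trans)
      then show ?thesis using that by (simp add: fq_class_eq_iff)
    qed
    have "inj_on (\<lambda>x. x \<triangleright>\<^bsub>?F\<^esub> y) (carrier ?F)"
      unfolding carrier_free_quandle using inj u
      by (intro inj_onI, elim imageE) (metis qop_free_quandle)
    moreover have "x \<in> (\<lambda>x. x \<triangleright>\<^bsub>?F\<^esub> y) ` carrier ?F" if x: "x \<in> carrier ?F" for x
    proof -
      obtain t where t: "t \<in> qterms S" "x = fq_class S t"
        using x by (auto simp: carrier_free_quandle)
      then have "x = fq_class S (QInv t u) \<triangleright>\<^bsub>?F\<^esub> y"
        using u by (auto simp: qop_free_quandle fq_class_eq_iff
            intro: free_quandle_rel.op_inv free_quandle_rel.sym)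
      then show ?thesis using t u by (auto simp: carrier_free_quandle)
    qed
    ultimately have "bij_betw (\<lambda>x. x \<triangleright>\<^bsub>?F\<^esub> y) (carrier ?F) (carrier ?F)"
      using closed y by (auto simp: bij_betw_def)
    moreover have "(x \<triangleright>\<^bsub>?F\<^esub> z) \<triangleright>\<^bsub>?F\<^esub> y = (x \<triangleright>\<^bsub>?F\<^esub> y) \<triangleright>\<^bsub>?F\<^esub> (z \<triangleright>\<^bsub>?F\<^esub> y)"
      if "x \<in> carrier ?F" "z \<in> carrier ?F" for x z
    proof -
      obtain t t' where t: "t \<in> qterms S" "x = fq_class S t" "t' \<in> qterms S" "z = fq_class S t'"
        using \<open>x \<in> carrier ?F\<close> \<open>z \<in> carrier ?F\<close> by (auto simp: carrier_free_quandle)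
      then have "fq_class S (QOp (QOp t t') u) = fq_class S (QOp (QOp t u) (QOp t' u))"
        using u by (simp add: fq_class_eq_iff free_quandle_rel.distrib)
      then show ?thesis using t u by (simp add: qop_free_quandle)
    qed
    ultimately show ?thesis
      using closed y by (auto simp: qauto_def qhom_def Bij_def)
  qed
qed

primrec qeval :: "('b, 'd) qstruct_scheme \<Rightarrow> ('g \<Rightarrow> 'b) \<Rightarrow> 'g qterm \<Rightarrow> 'b" where
  "qeval Y f (QGen g) = f g"
| "qeval Y f (QOp t u) = qeval Y f t \<triangleright>\<^bsub>Y\<^esub> qeval Y f u"
| "qeval Y f (QInv t u) = inv_into (carrier Y) (\<lambda>x. x \<triangleright>\<^bsub>Y\<^esub> qeval Y f u) (qeval Y f t)"

theorem free_quandle_universal: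
  assumes "quandle Y" and f: "f \<in> S \<rightarrow> carrier Y"
  shows "\<exists>!h. h \<in> qhom (free_quandle S) Y \<inter> extensional (carrier (free_quandle S)) \<and>
     (\<forall>s\<in>S. h (fq_class S (QGen s)) = f s)"
proof -
  interpret Y: quandle Y by fact
  let ?F = "free_quandle S" and ?e = "qeval Y f"
  have bij: "bij_betw (\<lambda>x. x \<triangleright>\<^bsub>Y\<^esub> y) (carrier Y) (carrier Y)" if "y \<in> carrier Y" for y
    using Y.right_mult_auto[OF that] by (simp add: qauto_def Bij_def)
  have inv_closed: "inv_into (carrier Y) (\<lambda>x. x \<triangleright>\<^bsub>Y\<^esub> y) x \<in> carrier Y"
    if "x \<in> carrier Y" "y \<in> carrier Y" for x y
    using bij_betw_inv_into[OF bij[OF that(2)]] that(1) by (auto dest: bij_betwE)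
  have inv1: "inv_into (carrier Y) (\<lambda>x. x \<triangleright>\<^bsub>Y\<^esub> y) (x \<triangleright>\<^bsub>Y\<^esub> y) = x"
    if "x \<in> carrier Y" "y \<in> carrier Y" for x y
    using bij_betw_inv_into_left[OF bij[OF that(2)] that(1)] .
  have inv2: "inv_into (carrier Y) (\<lambda>x. x \<triangleright>\<^bsub>Y\<^esub> y) x \<triangleright>\<^bsub>Y\<^esub> y = x"
    if "x \<in> carrier Y" "y \<in> carrier Y" for x y
    using bij_betw_inv_into_right[OF bij[OF that(2)] that(1)] .
  have dist: "(x \<triangleright>\<^bsub>Y\<^esub> z) \<triangleright>\<^bsub>Y\<^esub> y = (x \<triangleright>\<^bsub>Y\<^esub> y) \<triangleright>\<^bsub>Y\<^esub> (z \<triangleright>\<^bsub>Y\<^esub> y)"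
    if "x \<in> carrier Y" "z \<in> carrier Y" "y \<in> carrier Y" for x y z
    using Y.right_mult_auto[OF that(3)] that by (auto simp: qauto_def qhom_def Y.op_closed)
  have eC: "?e t \<in> carrier Y" if "t \<in> qterms S" for t
    using that by (induction t) (use f in \<open>auto simp: Y.op_closed inv_closed\<close>)
  have resp: "?e t = ?e u" if "(t, u) \<in> free_quandle_rel S" for t u
    using that by (induction rule: free_quandle_rel.induct)
      (auto simp: eC Y.idem inv1 inv2 dist)
  define h where "h = (\<lambda>A\<in>carrier ?F. ?e (SOME t. t \<in> qterms S \<and> A = fq_class S t))"
  have h: "h (fq_class S t) = ?e t" if t: "t \<in> qterms S" for t
  proof -
    let ?u = "SOME u. u \<in> qterms S \<and> fq_class S t = fq_class S u"
    have "?u \<in> qterms S \<and> fq_class S t = fq_class S ?u"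
      by (rule someI[of _ t]) (use t in simp)
    then have "?e t = ?e ?u" using t resp[of t ?u] fq_class_eq_iff[of t S ?u] by blast
    then show ?thesis using t by (simp add: h_def carrier_free_quandle)
  qed
  have h_hom: "h \<in> qhom ?F Y \<inter> extensional (carrier ?F)"
    using eC by (auto simp: qhom_def carrier_free_quandle qop_free_quandle h) (simp add: h_def carrier_free_quandle)
  show ?thesis
  proof (rule ex1I[of _ h])
    show "h \<in> qhom ?F Y \<inter> extensional (carrier ?F) \<and> (\<forall>s\<in>S. h (fq_class S (QGen s)) = f s)"
      using h_hom by (simp add: h)
  next
    fix k assume k: "k \<in> qhom ?F Y \<inter> extensional (carrier ?F) \<and> (\<forall>s\<in>S. k (fq_class S (QGen s)) = f s)"
    have kC: "k (fq_class S t) \<in> carrier Y" if "t \<in> qterms S" for t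
      using k that by (auto simp: qhom_def carrier_free_quandle)
    have kop: "k (fq_class S (QOp t u)) = k (fq_class S t) \<triangleright>\<^bsub>Y\<^esub> k (fq_class S u)"
      if "t \<in> qterms S" "u \<in> qterms S" for t u
      using k that by (auto simp: qhom_def carrier_free_quandle qop_free_quandle[symmetric])
    have "k (fq_class S t) = ?e t" if "t \<in> qterms S" for t
      using that
    proof (induction t)
      case (QInv t u)
      then have "k (fq_class S (QInv t u)) \<triangleright>\<^bsub>Y\<^esub> ?e u = k (fq_class S (QOp (QInv t u) u))"
        by (simp add: kop)
      also have "fq_class S (QOp (QInv t u) u) = fq_class S t"
        using QInv.prems by (simp add: fq_class_eq_iff free_quandle_rel.op_inv)
      finally have "k (fq_class S (QInv t u)) \<triangleright>\<^bsub>Y\<^esub> ?e u = ?e t" using QInv by simp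
      then show ?case
        using inv1[OF kC[OF QInv.prems], of "?e u"] QInv.prems eC by simp
    qed (use k kop in auto)
    then have "k A = h A" if "A \<in> carrier ?F" for A
      using that by (auto simp: carrier_free_quandle h)
    then show "k = h"
      using k h_hom by (intro extensionalityI[of _ "carrier ?F"]) auto
  qed
qed

lemma gwords_append [simp]: "v @ w \<in> gwords S \<longleftrightarrow> v \<in> gwords S \<and> w \<in> gwords S"
  by (auto simp: gwords_def)

lemma presentation_rel_gwords:
  "(v, w) \<in> presentation_rel S R \<Longrightarrow> v \<in> gwords S \<and> w \<in> gwords S"
  by (induction rule: presentation_rel.induct) (auto simp: gwords_def)

lemma equiv_presentation_rel: "equiv (gwords S) (presentation_rel S R)"
  by (rule equivI)
    (auto intro!: refl_onI symI transI dest: presentation_rel_gwords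
      intro: presentation_rel.intros)

lemma presented_group_mult:
  assumes "v \<in> gwords S" "w \<in> gwords S"
  shows "presentation_rel S R `` {v} \<otimes>\<^bsub>presented_group S R\<^esub> presentation_rel S R `` {w}
    = presentation_rel S R `` {v @ w}"
proof -
  have "congruent2 (presentation_rel S R) (presentation_rel S R) (\<lambda>v w. presentation_rel S R `` {v @ w})"
    unfolding congruent2_def
    by (auto intro!: equiv_class_eq[OF equiv_presentation_rel] intro: presentation_rel.cong)
  from UN_equiv_class2[OF equiv_presentation_rel equiv_presentation_rel this assms]
  show ?thesis by (simp add: presented_group_def)
qed

theorem group_presented_group: "group (presented_group S R)"
proof (rule groupI)
  let ?G = "presented_group S R" and ?c = "\<lambda>w. presentation_rel S R `` {w}"
  have car: "carrier ?G = ?c ` gwords S"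
    by (auto simp: presented_group_def quotient_def)
  have one: "\<one>\<^bsub>?G\<^esub> = ?c []" by (simp add: presented_group_def)
  have nil: "[] \<in> gwords S" by (simp add: gwords_def)
  note mult = presented_group_mult[of _ S _ R]
  show "\<one>\<^bsub>?G\<^esub> \<in> carrier ?G" using nil by (auto simp: car one)
  show "x \<otimes>\<^bsub>?G\<^esub> y \<in> carrier ?G" if "x \<in> carrier ?G" "y \<in> carrier ?G" for x y
    using that by (auto simp: car mult)
  show "x \<otimes>\<^bsub>?G\<^esub> y \<otimes>\<^bsub>?G\<^esub> z = x \<otimes>\<^bsub>?G\<^esub> (y \<otimes>\<^bsub>?G\<^esub> z)"
    if "x \<in> carrier ?G" "y \<in> carrier ?G" "z \<in> carrier ?G" for x y z
    using that by (auto simp: car mult)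
  show "\<one>\<^bsub>?G\<^esub> \<otimes>\<^bsub>?G\<^esub> x = x" if "x \<in> carrier ?G" for x
    using that nil by (auto simp: car one mult)
  show "\<exists>y\<in>carrier ?G. y \<otimes>\<^bsub>?G\<^esub> x = \<one>\<^bsub>?G\<^esub>" if x: "x \<in> carrier ?G" for x
  proof -
    have "\<exists>v\<in>gwords S. (v @ w, []) \<in> presentation_rel S R" if "w \<in> gwords S" for w
      using that
    proof (induction w)
      case Nil
      then show ?case using presentation_rel.refl[OF nil] nil by force
    next
      case (Cons a w)
      obtain g b where a: "a = (g, b)" "g \<in> S" and w: "w \<in> gwords S"
        using Cons.prems by (cases a) (auto simp: gwords_def)
      obtain v where v: "v \<in> gwords S" "(v @ w, []) \<in> presentation_rel S R"
        using Cons.IH[OF w] by blast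
      have "([(g, \<not> b), (g, b)], []) \<in> presentation_rel S R"
        using presentation_rel.cancel[OF a(2), of "\<not> b" R] by simp
      from presentation_rel.cong[OF presentation_rel.refl[OF v(1)]
          presentation_rel.cong[OF this presentation_rel.refl[OF w]]]
      have "(v @ [(g, \<not> b)] @ a # w, v @ w) \<in> presentation_rel S R"
        by (simp add: a)
      from presentation_rel.trans[OF this v(2)]
      have "((v @ [(g, \<not> b)]) @ a # w, []) \<in> presentation_rel S R" by simp
      moreover have "v @ [(g, \<not> b)] \<in> gwords S" using v a by (simp add: gwords_def)
      ultimately show ?case by blast
    qed
    moreover obtain w where w: "w \<in> gwords S" "x = ?c w" using x by (auto simp: car)
    ultimately obtain v where v: "v \<in> gwords S" "(v @ w, []) \<in> presentation_rel S R" by blast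
    then have "?c v \<otimes>\<^bsub>?G\<^esub> x = \<one>\<^bsub>?G\<^esub>"
      using w by (simp add: mult one equiv_class_eq[OF equiv_presentation_rel])
    then show ?thesis using v by (auto simp: car)
  qed
qed

lemma group_WB: "group (WB n)"
  unfolding WB_def by (rule group_presented_group)

end

theory Submission
  imports Defs "HOL-Library.Sublist" "HOL-Library.Product_Plus" "HOL-Combinatorics.Permutations"
begin

text \<open>
  The free quandle on \<open>S\<close> is the set of conjugates of the generators in the free group on \<open>S\<close>, with
  conjugation as operation. Each conjugate has a normal form, a core \<open>i\<close> with a reduced tail, and the whole
  proof takes place in the quandle of these normal forms, called lines; it is identified with the free
  quandle through its universal property (\<open>free_quandle_line_iso\<close>). One estimate of cancellation,
  \<open>snd_lconj\<close>, carries both isomorphisms: unless the core letter of \<open>y\<close> meets its inverse in \<open>x\<close> behind a full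
  copy of the tail of \<open>y\<close>, the conjugate of \<open>x\<close> by \<open>y\<close> shows all of \<open>y\<close>.

  For the first isomorphism it suffices that the basis elements are the only nonzero idempotents of the
  quandle ring. Given a finite set of at least two lines, let \<open>y\<close> be a longest one and \<open>x\<close> one that is
  farthest from \<open>y\<close> in the Cayley tree. Their product is longer than all lines of the set and is not a
  product of two members in any other way (\<open>line_unique_product\<close>). Hence the square of an element supported on
  the set has a nonzero coefficient outside the set, and the element is not idempotent. A ring
  automorphism therefore permutes the basis, and the permutation is a quandle automorphism.

  For the second isomorphism, \<open>\<rho>\<^sub>i\<close> acts by exchanging two generators and \<open>\<sigma>\<^sub>i\<close> by exchanging them and
  conjugating one by the other. An automorphism is the same as a basis, that is, the tuple of images of the
  generators, and composition with \<open>x\<^sub>i \<mapsto> x\<^sub>i * x\<^sub>j\<close> or its inverse is a move on bases. By the estimate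
  of cancellation a move never preserves the total length. A basis that admits no shortening move is a
  permutation of the generators (\<open>irreducible_basis\<close>, by Nielsen's argument), which gives surjectivity.

  Injectivity is a peak reduction. In \<open>WB n\<close> the elements that correspond to the moves satisfy McCool's
  relations (\<open>twist_commute_target\<close>, \<open>twist_commute_disjoint\<close>), and the \<open>\<rho>\<^sub>i\<close> generate a copy of the
  symmetric group by the Coxeter presentation. Whenever two moves shorten the same basis, they either commute or
  are two of three nested moves that fit into a hexagon given by a McCool relation, and all other vertices of
  the square or hexagon are shorter (\<open>square\<close>, \<open>hexagon\<close>). So the element of \<open>WB n\<close> collected while a
  basis descends to a permutation of the generators does not depend on the descent, and a word that returns
  to the standard basis is trivial (\<open>word_val_trivial\<close>).
\<close>

section \<open>Signed right multiplications in a quandle\<close>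

text \<open>The sign \<open>e\<close> selects right multiplication by \<open>y\<close> or its inverse, so that one set of laws covers both.\<close>

definition qpow :: "('a, 'c) qstruct_scheme \<Rightarrow> bool \<Rightarrow> 'a \<Rightarrow> 'a \<Rightarrow> 'a" where
  "qpow Q e x y =
     (if e then x \<triangleright>\<^bsub>Q\<^esub> y else inv_into (carrier Q) (\<lambda>x. x \<triangleright>\<^bsub>Q\<^esub> y) x)"

context quandle
begin

lemma right_mult_bij: "y \<in> carrier Q \<Longrightarrow> bij_betw (\<lambda>x. x \<triangleright> y) (carrier Q) (carrier Q)"
  using right_mult_auto[of y] by (simp add: qauto_def Bij_def)

lemma qpow_closed: "\<lbrakk>x \<in> carrier Q; y \<in> carrier Q\<rbrakk> \<Longrightarrow> qpow Q e x y \<in> carrier Q"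
  using bij_betw_inv_into[OF right_mult_bij[of y]]
  by (auto simp: qpow_def op_closed dest: bij_betwE)

lemma qpow_cancel: "\<lbrakk>x \<in> carrier Q; y \<in> carrier Q\<rbrakk> \<Longrightarrow> qpow Q (\<not> e) (qpow Q e x y) y = x"
  using bij_betw_inv_into_left[OF right_mult_bij[of y]]
    bij_betw_inv_into_right[OF right_mult_bij[of y]]
  by (simp add: qpow_def)

lemma qpow_cancel': "\<lbrakk>x \<in> carrier Q; y \<in> carrier Q\<rbrakk> \<Longrightarrow> qpow Q e (qpow Q (\<not> e) x y) y = x"
  using qpow_cancel[of x y "\<not> e"] by simp

lemma qpow_idem: "x \<in> carrier Q \<Longrightarrow> qpow Q e x x = x"
  using qpow_cancel'[of x x True] qpow_cancel[of x x True] idem[of x]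
  by (cases e) (auto simp: qpow_def)

lemma op_distrib:
  assumes "x \<in> carrier Q" "y \<in> carrier Q" "z \<in> carrier Q"
  shows "(x \<triangleright> y) \<triangleright> z = (x \<triangleright> z) \<triangleright> (y \<triangleright> z)"
  using right_mult_auto[OF assms(3)] assms by (auto simp: qauto_def qhom_def op_closed)

end

lemma qhom_closed: "\<lbrakk>h \<in> qhom Q R; x \<in> carrier Q\<rbrakk> \<Longrightarrow> h x \<in> carrier R"
  by (auto simp: qhom_def)

text \<open>The inverses of right multiplications are determined by the operation, so a map that preserves
  the operation preserves them as well.\<close>

lemma qhom_qpow:
  assumes "quandle Q" "quandle R" "h \<in> qhom Q R" "x \<in> carrier Q" "y \<in> carrier Q"
  shows "h (qpow Q e x y) = qpow R e (h x) (h y)"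
proof -
  interpret Q: quandle Q by fact
  interpret R: quandle R by fact
  note h = qhom_closed[OF assms(3)]
  show ?thesis
  proof (cases e)
    case True
    then show ?thesis using assms(3-5) by (simp add: qpow_def qhom_def)
  next
    case False
    have x': "qpow Q e x y \<in> carrier Q" using Q.qpow_closed assms by blast
    have "h (qpow Q e x y) \<triangleright>\<^bsub>R\<^esub> h y = h (qpow Q e x y \<triangleright>\<^bsub>Q\<^esub> y)"
      using assms x' by (simp add: qhom_def)
    also have "qpow Q e x y \<triangleright>\<^bsub>Q\<^esub> y = x"
      using Q.qpow_cancel[of x y e] assms False by (simp add: qpow_def)
    finally have "qpow R True (h (qpow Q e x y)) (h y) = h x" by (simp add: qpow_def)
    then show ?thesis
      using R.qpow_cancel[of "h (qpow Q e x y)" "h y" True] h[OF x'] h[OF assms(5)] False by simp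
  qed
qed

lemma (in quandle) right_mult_signed_qhom:
  assumes "z \<in> carrier Q"
  shows "(\<lambda>x. qpow Q d x z) \<in> qhom Q Q"
proof (cases d)
  case True
  then show ?thesis using assms by (auto simp: qhom_def qpow_def op_closed intro: op_distrib)
next
  case False
  have "qpow Q False (x \<triangleright> y) z = qpow Q False x z \<triangleright> qpow Q False y z"
    if "x \<in> carrier Q" "y \<in> carrier Q" for x y
  proof -
    note c = qpow_closed[OF _ assms, of _ False]
    have "qpow Q True (qpow Q False x z \<triangleright> qpow Q False y z) z = x \<triangleright> y"
      using qpow_cancel'[OF that(1) assms, of True] qpow_cancel'[OF that(2) assms, of True]
        op_distrib[OF c[OF that(1)] c[OF that(2)] assms] by (simp add: qpow_def)
    then show ?thesis
      using qpow_cancel[OF op_closed[OF c[OF that(1)] c[OF that(2)]] assms, of True] by simp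
  qed
  then show ?thesis using False assms by (auto simp: qhom_def qpow_closed)
qed

lemma (in quandle) qpow_distrib:
  assumes "x \<in> carrier Q" "y \<in> carrier Q" "z \<in> carrier Q"
  shows "qpow Q d (qpow Q e x y) z = qpow Q e (qpow Q d x z) (qpow Q d y z)"
  using qhom_qpow[OF quandle_axioms quandle_axioms right_mult_signed_qhom[OF assms(3)] assms(1,2)] .

section \<open>Normal forms in the free quandle\<close>

text \<open>A line \<open>(i, w)\<close> with core \<open>i\<close> and tail \<open>w\<close> stands for the conjugate of the free generator \<open>x\<^sub>i\<close> by the
  letters of \<open>w\<close>, where the head of \<open>w\<close> is the letter by which one conjugates last. In the Cayley
  tree of the free group this conjugate acts as a translation along an axis, and \<open>w\<close> spells the
  shortest path from the root to that axis; hence the name.\<close>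

type_synonym 'g line = "'g \<times> 'g gword"

definition flip :: "'g \<times> bool \<Rightarrow> 'g \<times> bool" where
  "flip a = (fst a, \<not> snd a)"

lemma flip_simps [simp]: "flip (flip a) = a" "fst (flip a) = fst a" "snd (flip a) = (\<not> snd a)"
  "flip a \<noteq> a" "a \<noteq> flip a" "flip (i, e) = (i, \<not> e)"
  by (auto simp: flip_def prod_eq_iff)

lemma flip_eq_iff: "flip a = b \<longleftrightarrow> a = flip b" by auto

text \<open>Conjugation by one letter. With an empty tail, a power of the core is absorbed because it commutes
  with the core.\<close>

fun push :: "'g \<times> bool \<Rightarrow> 'g line \<Rightarrow> 'g line" where
  "push a (i, []) = (if fst a = i then (i, []) else (i, [a]))"
| "push a (i, b # w) = (if b = flip a then (i, w) else (i, a # b # w))"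

text \<open>Besides free reduction, the letter next to the core must not be a power of the core: this makes the
  representation of a conjugate by a core and a tail unique.\<close>

fun reduced :: "'g \<Rightarrow> 'g gword \<Rightarrow> bool" where
  "reduced i [] = True"
| "reduced i [a] = (fst a \<noteq> i)"
| "reduced i (a # b # w) = (b \<noteq> flip a \<and> reduced i (b # w))"

lemma reduced_tl: "reduced i (a # w) \<Longrightarrow> reduced i w"
  by (cases w) auto

lemma reduced_append: "reduced i (v @ w) \<Longrightarrow> reduced i w"
  by (induction v) (auto dest: reduced_tl)

lemma reduced_last: "reduced i w \<Longrightarrow> w \<noteq> [] \<Longrightarrow> fst (last w) \<noteq> i"
  by (induction i w rule: reduced.induct) auto

lemma reduced_appendI:
  assumes "reduced j v" "reduced i (a # w)" "v \<noteq> [] \<Longrightarrow> a \<noteq> flip (last v)"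
  shows "reduced i (v @ a # w)"
  using assms by (induction j v rule: reduced.induct) auto

abbreviation freely_reduced :: "'g gword \<Rightarrow> bool" where
  "freely_reduced \<equiv> successively (\<lambda>a b. b \<noteq> flip a)"

lemma reduced_iff: "reduced i w \<longleftrightarrow> freely_reduced w \<and> (w \<noteq> [] \<longrightarrow> fst (last w) \<noteq> i)"
  by (induction i w rule: reduced.induct) auto

definition is_line :: "'g line \<Rightarrow> bool" where
  "is_line x \<longleftrightarrow> reduced (fst x) (snd x)"

lemma is_line_Pair [simp]: "is_line (i, w) \<longleftrightarrow> reduced i w"
  by (simp add: is_line_def)

lemma fst_push [simp]: "fst (push a x) = fst x"
  by (cases "(a, x)" rule: push.cases) auto

lemma push_Cons: "reduced i (a # w) \<Longrightarrow> push a (i, w) = (i, a # w)"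
  by (cases w) auto

lemma push_is_line [simp]: "is_line x \<Longrightarrow> is_line (push a x)"
  by (cases "(a, x)" rule: push.cases) (auto dest: reduced_tl)

lemma push_flip [simp]:
  assumes "is_line x"
  shows "push a (push (flip a) x) = x"
proof (cases "(a, x)" rule: push.cases)
  case (2 a' i b w)
  then show ?thesis using assms by (cases w) (auto simp: flip_eq_iff)
qed auto

lemma push_flip' [simp]: "is_line x \<Longrightarrow> push (flip a) (push a x) = x"
  using push_flip[of x "flip a"] by simp

lemma push_cases:
  "w = [] \<and> fst a = i \<or> (\<exists>u. w = flip a # u) \<or> push a (i, w) = (i, a # w)"
  by (cases w) auto

lemma set_push: "set (snd (push a x)) \<subseteq> insert a (set (snd x))"
  by (cases "(a, x)" rule: push.cases) auto

lemma length_push_le: "length (snd (push a x)) \<le> Suc (length (snd x))"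
  by (cases "(a, x)" rule: push.cases) auto

lemma length_push_ge: "length (snd x) \<le> Suc (length (snd (push a x)))"
  by (cases "(a, x)" rule: push.cases) auto

definition pushes :: "'g gword \<Rightarrow> 'g line \<Rightarrow> 'g line" where
  "pushes v x = foldr push v x"

definition unpush :: "'g gword \<Rightarrow> 'g line \<Rightarrow> 'g line" where
  "unpush v x = fold (\<lambda>a. push (flip a)) v x"

lemma pushes_simps [simp]: "pushes [] x = x" "pushes (a # v) x = push a (pushes v x)"
  "pushes (v @ w) x = pushes v (pushes w x)"
  by (auto simp: pushes_def)

lemma unpush_simps [simp]: "unpush [] x = x" "unpush (a # v) x = unpush v (push (flip a) x)"
  "unpush (v @ w) x = unpush w (unpush v x)"
  by (auto simp: unpush_def)

text \<open>Conjugation by \<open>y\<close> or its inverse, factored through the tail of \<open>y\<close>: strip the tail, apply the core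
  letter, and put the tail back.\<close>

definition lconj :: "bool \<Rightarrow> 'g line \<Rightarrow> 'g line \<Rightarrow> 'g line" where
  "lconj e x y = pushes (snd y) (push (fst y, e) (unpush (snd y) x))"

definition line_quandle :: "'g set \<Rightarrow> 'g line qstruct" where
  "line_quandle S = \<lparr>carrier = {x. fst x \<in> S \<and> snd x \<in> gwords S \<and> is_line x},
     qop = lconj True\<rparr>"

lemma fst_pushes [simp]: "fst (pushes v x) = fst x"
  by (induction v) auto

lemma fst_unpush [simp]: "fst (unpush v x) = fst x"
  by (induction v arbitrary: x) auto

lemma fst_lconj [simp]: "fst (lconj e x y) = fst x"
  by (simp add: lconj_def)

lemma pushes_is_line [simp]: "is_line x \<Longrightarrow> is_line (pushes v x)"
  by (induction v) auto

lemma unpush_is_line [simp]: "is_line x \<Longrightarrow> is_line (unpush v x)"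
  by (induction v arbitrary: x) auto

lemma lconj_is_line [simp]: "is_line x \<Longrightarrow> is_line (lconj e x y)"
  by (simp add: lconj_def)

lemma pushes_unpush [simp]: "is_line x \<Longrightarrow> pushes v (unpush v x) = x"
  by (induction v arbitrary: x) auto

lemma unpush_pushes [simp]: "is_line x \<Longrightarrow> unpush v (pushes v x) = x"
  by (induction v) auto

lemma pushes_core: "reduced i (v @ w) \<Longrightarrow> pushes v (i, w) = (i, v @ w)"
proof (induction v)
  case (Cons a v)
  then have "reduced i (a # (v @ w))" by simp
  then show ?case using Cons.IH push_Cons reduced_tl by fastforce
qed simp

lemma pushes_self: "is_line x \<Longrightarrow> pushes (snd x) (fst x, []) = x"
  by (simp add: pushes_core is_line_def)

lemma unpush_self: "is_line x \<Longrightarrow> unpush (snd x) x = (fst x, [])"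
  using unpush_pushes[of "(fst x, [])" "snd x"] by (simp add: pushes_self)

lemma unpush_append: "reduced i (v @ w) \<Longrightarrow> unpush v (i, v @ w) = (i, w)"
  using unpush_pushes[of "(i, w)" v] by (simp add: pushes_core reduced_append)

lemma length_pushes_le: "length (snd (pushes v x)) \<le> length v + length (snd x)"
  by (induction v) (auto intro: order_trans[OF length_push_le])

lemma length_unpush_ge: "length (snd x) \<le> length v + length (snd (unpush v x))"
proof (induction v arbitrary: x)
  case (Cons a v)
  show ?case using Cons[of "push (flip a) x"] length_push_ge[of x "flip a"] by simp
qed simp

lemma set_pushes: "set (snd (pushes v x)) \<subseteq> set v \<union> set (snd x)"
proof (induction v)
  case (Cons a v)
  then show ?case using set_push[of a "pushes v x"] by auto
qed simp

lemma set_unpush: "set (snd (unpush v x)) \<subseteq> flip ` set v \<union> set (snd x)"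
proof (induction v arbitrary: x)
  case (Cons a v)
  show ?case using Cons[of "push (flip a) x"] set_push[of "flip a" x] by auto
qed simp

lemma carrier_line_quandle:
  "x \<in> carrier (line_quandle S) \<longleftrightarrow> fst x \<in> S \<and> snd x \<in> gwords S \<and> is_line x"
  by (simp add: line_quandle_def)

lemma lines_are_lines: "x \<in> carrier (line_quandle S) \<Longrightarrow> is_line x"
  by (simp add: carrier_line_quandle)

lemma gwords_iff: "w \<in> gwords S \<longleftrightarrow> fst ` set w \<subseteq> S"
  by (auto simp: gwords_def lists_eq_set)

lemma push_carrier:
  "\<lbrakk>x \<in> carrier (line_quandle S); fst a \<in> S\<rbrakk> \<Longrightarrow> push a x \<in> carrier (line_quandle S)"
  using set_push[of a x] by (auto simp: carrier_line_quandle gwords_iff)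

lemma lconj_carrier:
  assumes "x \<in> carrier (line_quandle S)" "y \<in> carrier (line_quandle S)"
  shows "lconj e x y \<in> carrier (line_quandle S)"
proof -
  have "set (snd (lconj e x y)) \<subseteq>
      set (snd y) \<union> insert (fst y, e) (flip ` set (snd y) \<union> set (snd x))"
    unfolding lconj_def
    using set_pushes[of "snd y" "push (fst y, e) (unpush (snd y) x)"]
      set_push[of "(fst y, e)" "unpush (snd y) x"] set_unpush[of "snd y" x] by auto
  then have "fst ` set (snd (lconj e x y)) \<subseteq>
      fst ` (set (snd y) \<union> insert (fst y, e) (flip ` set (snd y) \<union> set (snd x)))"
    by (rule image_mono)
  then have "fst ` set (snd (lconj e x y)) \<subseteq> S"
    using assms by (force simp: carrier_line_quandle gwords_iff image_Un image_image)
  then show ?thesis using assms by (auto simp: carrier_line_quandle gwords_iff)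
qed

text \<open>Conjugating by the translate of \<open>y\<close> under \<open>a\<close> means translating back, conjugating by \<open>y\<close>, and
  translating again. This is built into the definition except when \<open>a\<close> cancels the tail of \<open>y\<close> or is
  absorbed by its core. All laws of the quandle of lines come from this one.\<close>

lemma lconj_push_right:
  assumes "is_line x" "is_line y"
  shows "lconj e x (push a y) = push a (lconj e (push (flip a) x) y)"
proof -
  obtain j v where y: "y = (j, v)" by (cases y)
  have nx: "is_line (push (flip a) x)" using assms by simp
  consider "v = []" "fst a = j" | v' where "v = flip a # v'" | "push a y = (j, a # v)"
    using y push_cases[of v a j] by metis
  then show ?thesis
  proof cases
    case 1
    have "push a (push (j, e) (push (flip a) x)) = push (j, e) x"
    proof (cases "a = (j, e)")
      case True
      then show ?thesis using push_flip[OF assms(1), of a] by simp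
    next
      case False
      then have "flip a = (j, e)" using 1 by (auto simp: flip_def prod_eq_iff)
      then show ?thesis using push_flip[of "push (j, e) x" a] assms(1) by simp
    qed
    then show ?thesis using 1 y by (simp add: lconj_def)
  next
    case 2
    then show ?thesis using y assms
      by (simp add: lconj_def)
  next
    case 3
    then show ?thesis using y by (simp add: lconj_def)
  qed
qed

lemma lconj_push:
  "\<lbrakk>is_line x; is_line y\<rbrakk> \<Longrightarrow> lconj e (push a x) (push a y) = push a (lconj e x y)"
  by (simp add: lconj_push_right)

lemma lconj_self: "is_line x \<Longrightarrow> lconj e x x = x"
  by (simp add: lconj_def unpush_self pushes_self)

lemma lconj_cancel:
  assumes "is_line x"
  shows "lconj (\<not> e) (lconj e x y) y = x"
  using assms push_flip'[of "unpush (snd y) x" "(fst y, e)"] by (simp add: lconj_def)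

lemma lconj_pushes:
  "\<lbrakk>is_line x; is_line y\<rbrakk> \<Longrightarrow> lconj e (pushes v x) (pushes v y) = pushes v (lconj e x y)"
  by (induction v) (auto simp: lconj_push)

lemma lconj_unpush:
  "\<lbrakk>is_line x; is_line y\<rbrakk> \<Longrightarrow> lconj e (unpush v x) (unpush v y) = unpush v (lconj e x y)"
  by (induction v arbitrary: x y) (auto simp: lconj_push)

lemma lconj_distrib:
  assumes "is_line x" "is_line y"
  shows "lconj d (lconj e x y) z = lconj e (lconj d x z) (lconj d y z)"
  using assms
  by (simp add: lconj_def[of d] lconj_unpush lconj_push lconj_pushes)

lemma qop_line_quandle [simp]: "x \<triangleright>\<^bsub>line_quandle S\<^esub> y = lconj True x y"
  by (simp add: line_quandle_def)

lemma core_carrier: "i \<in> S \<Longrightarrow> (i, []) \<in> carrier (line_quandle S)"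
  by (simp add: carrier_line_quandle gwords_def)

lemma lconj_bij:
  assumes "y \<in> carrier (line_quandle S)"
  shows "bij_betw (\<lambda>x. lconj e x y) (carrier (line_quandle S)) (carrier (line_quandle S))"
proof (rule bij_betwI[where g = "\<lambda>x. lconj (\<not> e) x y"])
  show "lconj (\<not> e) (lconj e x y) y = x" if "x \<in> carrier (line_quandle S)" for x
    using that lconj_cancel lines_are_lines by blast
  show "lconj e (lconj (\<not> e) x y) y = x" if "x \<in> carrier (line_quandle S)" for x
    using lconj_cancel[OF lines_are_lines[OF that], of "\<not> e"] by simp
qed (auto intro: lconj_carrier assms)

theorem quandle_line_quandle:
  assumes "S \<noteq> {}"
  shows "quandle (line_quandle S)"
proof
  let ?L = "line_quandle S"
  show "carrier ?L \<noteq> {}" using assms core_carrier by fastforce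
  show "x \<triangleright>\<^bsub>?L\<^esub> y \<in> carrier ?L" if "x \<in> carrier ?L" "y \<in> carrier ?L" for x y
    using that by (simp add: lconj_carrier)
  show "y \<triangleright>\<^bsub>?L\<^esub> y = y" if "y \<in> carrier ?L" for y
    using that by (simp add: lconj_self lines_are_lines)
  show "(\<lambda>x\<in>carrier ?L. x \<triangleright>\<^bsub>?L\<^esub> y) \<in> qauto ?L" if y: "y \<in> carrier ?L" for y
  proof -
    have "(\<lambda>x\<in>carrier ?L. lconj True x y) \<in> Bij (carrier ?L)"
      using lconj_bij[OF y, of True] by (simp add: Bij_def)
    moreover have "lconj True (lconj True x z) y = lconj True (lconj True x y) (lconj True z y)"
      if "x \<in> carrier ?L" "z \<in> carrier ?L" for x z
      using that lines_are_lines lconj_distrib by metis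
    ultimately show ?thesis using y by (simp add: qauto_def qhom_def lconj_carrier)
  qed
qed

lemma qpow_line_quandle:
  assumes "x \<in> carrier (line_quandle S)" "y \<in> carrier (line_quandle S)"
  shows "qpow (line_quandle S) e x y = lconj e x y"
proof (cases e)
  case False
  have "inv_into (carrier (line_quandle S)) (\<lambda>x. lconj True x y) (lconj True (lconj False x y) y)
      = lconj False x y"
    using assms lconj_bij[OF assms(2), of True]
    by (intro inv_into_f_f) (auto simp: bij_betw_def lconj_carrier)
  then show ?thesis
    using False lconj_cancel[of x False y] assms by (simp add: qpow_def lines_are_lines)
qed (simp add: qpow_def)

section \<open>The normal forms are the free quandle\<close>

text \<open>Evaluates a line as an iterated right multiplication, starting from the core.\<close>

definition lift :: "('a, 'c) qstruct_scheme \<Rightarrow> ('g \<Rightarrow> 'a) \<Rightarrow> 'g line \<Rightarrow> 'a" where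
  "lift Q f x = foldr (\<lambda>a u. qpow Q (snd a) u (f (fst a))) (snd x) (f (fst x))"

lemma lift_core [simp]: "lift Q f (i, []) = f i"
  and lift_Cons: "lift Q f (i, a # w) = qpow Q (snd a) (lift Q f (i, w)) (f (fst a))"
  by (simp_all add: lift_def)

lemma line_ConsD:
  assumes "(i, a # w) \<in> carrier (line_quandle S)"
  shows "(i, w) \<in> carrier (line_quandle S)" "fst a \<in> S" "push a (i, w) = (i, a # w)"
    "(fst a, []) \<in> carrier (line_quandle S)"
  using assms by (auto simp: carrier_line_quandle gwords_iff push_Cons dest: reduced_tl)

lemma line_induct [consumes 1, case_names core push]:
  assumes "x \<in> carrier (line_quandle S)"
    and "\<And>i. i \<in> S \<Longrightarrow> P (i, [])"
    and "\<And>a x. \<lbrakk>x \<in> carrier (line_quandle S); fst a \<in> S; P x; push a x = (fst x, a # snd x)\<rbrakk>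
      \<Longrightarrow> P (push a x)"
  shows "P x"
proof -
  have "(i, w) \<in> carrier (line_quandle S) \<Longrightarrow> P (i, w)" for i w
  proof (induction w)
    case Nil
    then show ?case using assms(2) by (simp add: carrier_line_quandle)
  next
    case (Cons a w)
    then show ?case using line_ConsD[OF Cons.prems] assms(3)[of "(i, w)" a] by simp
  qed
  then show ?thesis using assms(1) by (cases x) simp
qed

context quandle
begin

context
  fixes f :: "'g \<Rightarrow> 'a" and S :: "'g set"
  assumes f: "f \<in> S \<rightarrow> carrier Q"
begin

lemma lift_closed: "x \<in> carrier (line_quandle S) \<Longrightarrow> lift Q f x \<in> carrier Q"
proof (induction x rule: line_induct)
  case (core i)
  then show ?case using f by auto
next
  case (push a x)
  then show ?case using f by (cases x) (auto simp: lift_Cons intro: qpow_closed)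
qed

lemma lift_push:
  assumes "x \<in> carrier (line_quandle S)" "fst a \<in> S"
  shows "lift Q f (push a x) = qpow Q (snd a) (lift Q f x) (f (fst a))"
proof -
  obtain i w where x: "x = (i, w)" by (cases x)
  have fa: "f (fst a) \<in> carrier Q" using f assms by auto
  have "w = [] \<and> fst a = i \<or> (\<exists>u. w = flip a # u) \<or> push a (i, w) = (i, a # w)"
    by (rule push_cases)
  then show ?thesis
  proof (elim disjE exE conjE)
    assume "w = []" "fst a = i"
    then show ?thesis using x fa by (simp add: qpow_idem)
  next
    fix u assume w: "w = flip a # u"
    then have "lift Q f (i, u) \<in> carrier Q"
      using lift_closed[OF line_ConsD(1)] assms(1) x by simp
    from qpow_cancel'[OF this fa, of "snd a"]
    show ?thesis by (simp add: x w lift_Cons)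
  next
    assume "push a (i, w) = (i, a # w)"
    then show ?thesis by (simp add: x lift_Cons)
  qed
qed

text \<open>The induction strips letters from \<open>y\<close>; each step is an instance of self-distributivity in \<open>Q\<close>.\<close>

lemma lift_lconj:
  assumes "y \<in> carrier (line_quandle S)" "x \<in> carrier (line_quandle S)"
  shows "lift Q f (lconj e x y) = qpow Q e (lift Q f x) (lift Q f y)"
  using assms
proof (induction y arbitrary: x rule: line_induct)
  case (core i)
  then show ?case using lift_push[of x "(i, e)"] by (simp add: lconj_def)
next
  case (push a y)
  let ?x = "push (flip a) x"
  have x': "?x \<in> carrier (line_quandle S)" using push by (auto intro: push_carrier)
  have fa: "f (fst a) \<in> carrier Q" using f push by auto
  note c = lift_closed[OF \<open>x \<in> _\<close>] lift_closed[OF x'] lift_closed[OF \<open>y \<in> _\<close>]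
  have x: "lift Q f x = qpow Q (snd a) (lift Q f ?x) (f (fst a))"
    using lift_push[of x "flip a"] push qpow_cancel'[OF c(1) fa, of "snd a"] by simp
  have "lconj e x (push a y) = push a (lconj e ?x y)"
    using lconj_push_right push.hyps(1) push.prems lines_are_lines by blast
  then have "lift Q f (lconj e x (push a y))
      = qpow Q (snd a) (qpow Q e (lift Q f ?x) (lift Q f y)) (f (fst a))"
    using push.IH[OF x'] lift_push[OF lconj_carrier[OF x' \<open>y \<in> _\<close>], of a] push by simp
  also have "\<dots> = qpow Q e (lift Q f x) (lift Q f (push a y))"
    using qpow_distrib[OF c(2,3) fa] x lift_push[of y a] push by simp
  finally show ?case .
qed

text \<open>Existence in the universal property; uniqueness holds because every line arises from a core by
  multiplying with cores.\<close>

lemma lift_qhom: "lift Q f \<in> qhom (line_quandle S) Q"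
  using lift_lconj[of _ _ True] lift_closed by (auto simp: qhom_def qpow_def)

end

end

lemma line_hom_eq:
  assumes "quandle Q" "g \<in> qhom (line_quandle S) Q" "h \<in> qhom (line_quandle S) Q"
    and "\<And>i. i \<in> S \<Longrightarrow> g (i, []) = h (i, [])" "x \<in> carrier (line_quandle S)"
  shows "g x = h x"
  using assms(5)
proof (induction rule: line_induct)
  case (core i)
  then show ?case using assms by simp
next
  case (push a x)
  then have "S \<noteq> {}" by auto
  note L = quandle_line_quandle[OF this]
  have a: "(fst a, []) \<in> carrier (line_quandle S)" using push by (auto intro: core_carrier)
  have "push a x = qpow (line_quandle S) (snd a) x (fst a, [])"
    using qpow_line_quandle[OF _ a] push by (simp add: lconj_def)
  then show ?case
    using qhom_qpow[OF L assms(1) assms(2) push(1) a] qhom_qpow[OF L assms(1) assms(3) push(1) a]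
      assms(4) push by simp
qed

lemma qhom_compose: "\<lbrakk>g \<in> qhom R T; h \<in> qhom Q R\<rbrakk> \<Longrightarrow> g \<circ> h \<in> qhom Q T"
  by (fastforce simp: qhom_def)

text \<open>The uniqueness part of the universal property of the free quandle, for maps that need not be
  extensional.\<close>

lemma free_quandle_hom_eq:
  assumes "quandle Y" "g \<in> qhom (free_quandle S) Y" "h \<in> qhom (free_quandle S) Y"
    and "\<And>i. i \<in> S \<Longrightarrow> g (fq_class S (QGen i)) = h (fq_class S (QGen i))"
    and "S \<noteq> {}" "x \<in> carrier (free_quandle S)"
  shows "g x = h x"
proof -
  let ?F = "free_quandle S"
  interpret F: quandle ?F using quandle_free_quandle[OF assms(5)] .
  have gen: "fq_class S (QGen s) \<in> carrier ?F" if "s \<in> S" for s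
    unfolding carrier_free_quandle using that by (intro imageI) simp
  have r: "restrict k (carrier ?F) \<in> qhom ?F Y \<inter> extensional (carrier ?F)"
    if "k \<in> qhom ?F Y" for k
    using that F.op_closed by (auto simp: qhom_def)
  have "(\<lambda>s. g (fq_class S (QGen s))) \<in> S \<rightarrow> carrier Y"
    using gen qhom_closed[OF assms(2)] by auto
  from free_quandle_universal[OF assms(1) this]
  have "restrict g (carrier ?F) = restrict h (carrier ?F)"
    using r[OF assms(2)] r[OF assms(3)] assms(4) gen by (auto dest: ex1E)
  then show ?thesis using assms(6) by (metis restrict_apply')
qed

text \<open>Both quandles have the same universal property with respect to \<open>S\<close>, so the two induced maps are
  mutually inverse.\<close>

theorem free_quandle_line_iso:
  assumes "S \<noteq> {}"
  obtains h where "h \<in> qhom (free_quandle S) (line_quandle S)"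
    "bij_betw h (carrier (free_quandle S)) (carrier (line_quandle S))"
proof -
  let ?F = "free_quandle S" and ?L = "line_quandle S" and ?\<iota> = "\<lambda>s. fq_class S (QGen s)"
  note L = quandle_line_quandle[OF assms] and F = quandle_free_quandle[OF assms]
  have "(\<lambda>s. (s, [])) \<in> S \<rightarrow> carrier ?L" using core_carrier by fastforce
  from free_quandle_universal[OF L this]
  obtain h where h: "h \<in> qhom ?F ?L" "\<And>s. s \<in> S \<Longrightarrow> h (?\<iota> s) = (s, [])" by auto
  have gen: "?\<iota> s \<in> carrier ?F" if "s \<in> S" for s
    unfolding carrier_free_quandle using that by (intro imageI) simp
  then have "?\<iota> \<in> S \<rightarrow> carrier ?F" by simp
  note k = quandle.lift_qhom[OF F this]
  have id: "(\<lambda>x. x) \<in> qhom Q Q" for Q :: "('b, 'd) qstruct_scheme" by (simp add: qhom_def)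
  have "(h \<circ> lift ?F ?\<iota>) x = x" if "x \<in> carrier ?L" for x
    using line_hom_eq[OF L qhom_compose[OF h(1) k] id] h(2) that by simp
  moreover have "(lift ?F ?\<iota> \<circ> h) x = x" if "x \<in> carrier ?F" for x
    using free_quandle_hom_eq[OF F qhom_compose[OF k h(1)] id] h(2) that assms by simp
  ultimately have "bij_betw h (carrier ?F) (carrier ?L)"
    using qhom_closed[OF h(1)] qhom_closed[OF k] by (intro bij_betwI[where g = "lift ?F ?\<iota>"]) auto
  then show ?thesis using that h(1) by blast
qed

text \<open>Conjugation by \<open>h\<close> carries one automorphism group to the other.\<close>

lemma AutQuandle_cong:
  assumes "quandle Q" "quandle R" "h \<in> qhom Q R" "bij_betw h (carrier Q) (carrier R)"
  shows "AutQuandle Q \<cong> AutQuandle R"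
proof -
  interpret Q: quandle Q by fact
  interpret R: quandle R by fact
  let ?A = "carrier Q" and ?B = "carrier R"
  define k where "k = inv_into ?A h"
  have kh: "k (h x) = x" if "x \<in> ?A" for x
    using assms(4) that unfolding k_def by (rule bij_betw_inv_into_left)
  have hk: "h (k y) = y" if "y \<in> ?B" for y
    using assms(4) that unfolding k_def by (rule bij_betw_inv_into_right)
  have kb: "bij_betw k ?B ?A" unfolding k_def using assms(4) by (rule bij_betw_inv_into)
  have hA: "h x \<in> ?B" if "x \<in> ?A" for x using assms(4) that by (auto dest: bij_betwE)
  have kB: "k y \<in> ?A" if "y \<in> ?B" for y using kb that by (auto dest: bij_betwE)
  have hop: "h (x \<triangleright>\<^bsub>Q\<^esub> y) = h x \<triangleright>\<^bsub>R\<^esub> h y" if "x \<in> ?A" "y \<in> ?A" for x y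
    using assms(3) that by (simp add: qhom_def)
  have kop: "k (x \<triangleright>\<^bsub>R\<^esub> y) = k x \<triangleright>\<^bsub>Q\<^esub> k y" if "x \<in> ?B" "y \<in> ?B" for x y
    using hop[OF kB kB] kh[OF Q.op_closed[OF kB kB]] hk that by metis
  define c where "c \<phi> = restrict (h \<circ> \<phi> \<circ> k) ?B" for \<phi>
  define d where "d \<psi> = restrict (k \<circ> \<psi> \<circ> h) ?A" for \<psi>
  have q: "\<phi> x \<in> ?A" if "\<phi> \<in> qauto Q" "x \<in> ?A" for \<phi> x
    using that by (auto simp: qauto_def intro: qhom_closed)
  have q': "\<psi> x \<in> ?B" if "\<psi> \<in> qauto R" "x \<in> ?B" for \<psi> x
    using that by (auto simp: qauto_def intro: qhom_closed)
  have c: "c \<phi> \<in> qauto R" if p: "\<phi> \<in> qauto Q" for \<phi>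
  proof -
    have "bij_betw (h \<circ> \<phi> \<circ> k) ?B ?B"
      using p kb assms(4) by (auto simp: qauto_def Bij_def intro!: bij_betw_trans)
    moreover have "h (\<phi> (k (x \<triangleright>\<^bsub>R\<^esub> y))) = h (\<phi> (k x)) \<triangleright>\<^bsub>R\<^esub> h (\<phi> (k y))"
      if "x \<in> ?B" "y \<in> ?B" for x y
      using p that kop hop q[OF p] kB by (simp add: qauto_def qhom_def)
    ultimately show ?thesis
      using hA q[OF p] kB by (auto simp: c_def qauto_def Bij_def qhom_def R.op_closed)
  qed
  have d: "d \<psi> \<in> qauto Q" if p: "\<psi> \<in> qauto R" for \<psi>
  proof -
    have "bij_betw (k \<circ> \<psi> \<circ> h) ?A ?A"
      using p kb assms(4) by (auto simp: qauto_def Bij_def intro!: bij_betw_trans)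
    moreover have "k (\<psi> (h (x \<triangleright>\<^bsub>Q\<^esub> y))) = k (\<psi> (h x)) \<triangleright>\<^bsub>Q\<^esub> k (\<psi> (h y))"
      if "x \<in> ?A" "y \<in> ?A" for x y
      using p that kop hop q'[OF p] hA by (simp add: qauto_def qhom_def)
    ultimately show ?thesis
      using kB q'[OF p] hA by (auto simp: d_def qauto_def Bij_def qhom_def Q.op_closed)
  qed
  have ext: "\<phi> \<in> extensional ?A" if "\<phi> \<in> qauto Q" for \<phi>
    using that by (simp add: qauto_def Bij_def)
  have ext': "\<psi> \<in> extensional ?B" if "\<psi> \<in> qauto R" for \<psi>
    using that by (simp add: qauto_def Bij_def)
  have dc: "d (c \<phi>) = \<phi>" if "\<phi> \<in> qauto Q" for \<phi>
    by (rule extensionalityI[of _ ?A]) (use that ext q kh hA in \<open>auto simp: c_def d_def\<close>)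
  have cd: "c (d \<psi>) = \<psi>" if "\<psi> \<in> qauto R" for \<psi>
    by (rule extensionalityI[of _ ?B]) (use that ext' q' hk kB in \<open>auto simp: c_def d_def\<close>)
  have "bij_betw c (qauto Q) (qauto R)"
    by (rule bij_betwI[where g = d]) (use c d cd dc in auto)
  moreover have "c (compose ?A \<phi> \<psi>) = compose ?B (c \<phi>) (c \<psi>)"
    if "\<phi> \<in> qauto Q" "\<psi> \<in> qauto Q" for \<phi> \<psi>
    using that kB hA kh q by (auto simp: c_def compose_def fun_eq_iff)
  moreover have "\<phi> \<in> Bij ?A" if "\<phi> \<in> qauto Q" for \<phi> using that by (simp add: qauto_def)
  moreover have "\<phi> \<in> Bij ?B" if "\<phi> \<in> qauto R" for \<phi> using that by (simp add: qauto_def)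
  ultimately have "c \<in> iso (AutQuandle Q) (AutQuandle R)"
    using c by (auto simp: iso_def hom_def AutQuandle_def BijGroup_def)
  then show ?thesis by (rule is_isoI)
qed

section \<open>Cancellation between lines\<close>

lemma unpush_no_cancel:
  "\<lbrakk>freely_reduced m; k \<noteq> []; m \<noteq> [] \<Longrightarrow> hd m \<noteq> hd k\<rbrakk> \<Longrightarrow> unpush m (i, k) = (i, rev (map flip m) @ k)"
proof (induction m arbitrary: k)
  case (Cons a m)
  have "push (flip a) (i, k) = (i, flip a # k)"
    using Cons.prems by (cases k) auto
  moreover have "m \<noteq> [] \<Longrightarrow> hd m \<noteq> flip a" "freely_reduced m"
    using Cons.prems(1) by (auto simp: successively_Cons)
  ultimately show ?case using Cons.IH[of "flip a # k"] by simp
qed simp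

text \<open>Stripping \<open>m\<close> from a line that does not begin with the first letter of \<open>m\<close> cancels nothing; at most, if
  the line is bare, an initial run of \<open>m\<close> is absorbed by the core. So either all of \<open>m\<close> was absorbed or its
  last letter was put on top.\<close>

lemma unpush_diverge:
  assumes "m \<noteq> []" "freely_reduced m" "k \<noteq> [] \<Longrightarrow> hd m \<noteq> hd k" "unpush m (i, k) = (i, u)"
  shows "if u = [] then fst (last m) = i else hd u = flip (last m)"
  using assms
proof (induction m arbitrary: u rule: rev_nonempty_induct)
  case (single a)
  then show ?case by (cases k) (auto split: if_splits)
next
  case (snoc a m)
  obtain u' where u': "unpush m (i, k) = (i, u')" by (metis fst_conv fst_unpush surj_pair)
  have red: "freely_reduced m" "a \<noteq> flip (last m)"
    using snoc.prems(1) snoc.hyps by (auto simp: successively_append_iff)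
  have "if u' = [] then fst (last m) = i else hd u' = flip (last m)"
    using snoc.IH[OF red(1) _ u'] snoc.prems(2) snoc.hyps by simp
  then show ?case using snoc.prems(3) u' red(2) by (cases u') (auto split: if_splits)
qed

lemma unpush_split:
  assumes "reduced i w"
  obtains m k where "unpush v (i, w) = unpush m (i, k)" "\<lbrakk>m \<noteq> []; k \<noteq> []\<rbrakk> \<Longrightarrow> hd m \<noteq> hd k"
    "\<exists>t. v = t @ m \<and> w = t @ k"
proof -
  obtain t m k where t: "v = t @ m" "w = t @ k" "m = [] \<or> k = [] \<or> hd m \<noteq> hd k"
    using longest_common_prefix[of v w] by auto
  then show ?thesis using that unpush_append[of i t k] assms by (metis unpush_simps(3))
qed

text \<open>The basic cancellation estimate. In \<open>y\<^sup>-\<^sup>1 x y\<close> the core letter of \<open>y\<close> on the outer side can only be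
  cancelled by an equal and opposite letter of \<open>x\<close> following a copy of the whole tail of \<open>y\<close>. Otherwise it
  survives, and the tail of the result shows \<open>y\<close> completely. Both the unique products in the quandle ring
  and the reduction theory of bases rest on this.\<close>

lemma snd_lconj:
  assumes "is_line x" "is_line y" "x \<noteq> y" "\<not> prefix (snd y @ [(fst y, \<not> e)]) (snd x)"
  shows "snd (lconj e x y) = snd y @ (fst y, e) # snd (unpush (snd y) x)"
proof -
  obtain i w j v where x: "x = (i, w)" and y: "y = (j, v)" by (cases x; cases y)
  obtain u where u: "unpush v x = (i, u)" using x by (metis fst_conv fst_unpush surj_pair)
  have red: "reduced i w" "reduced j v" "reduced i u"
    using assms x y u unpush_is_line[of x v] by (auto simp del: unpush_is_line)
  obtain m k where mk: "unpush v (i, w) = unpush m (i, k)" "\<lbrakk>m \<noteq> []; k \<noteq> []\<rbrakk> \<Longrightarrow> hd m \<noteq> hd k"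
    "\<exists>t. v = t @ m \<and> w = t @ k" using unpush_split[OF red(1)] by blast
  then obtain t where t: "v = t @ m" "w = t @ k" by blast
  have last: "m \<noteq> [] \<Longrightarrow> fst (last m) \<noteq> j"
    using reduced_last[OF red(2)] t(1) by auto
  have "if u = [] then i \<noteq> j else hd u \<noteq> (j, \<not> e)"
  proof (cases "m = []")
    case True
    then have "u = k" using mk(1) u x by simp
    then show ?thesis using True assms(3,4) t x y by (cases k) (auto simp: prefix_def)
  next
    case False
    have "freely_reduced m" using red(2) t(1) by (simp add: reduced_iff successively_append_iff)
    from unpush_diverge[OF False this mk(2)[OF False]]
    show ?thesis using mk(1) u x last[OF False] by (auto split: if_splits simp: flip_def)
  qed
  then have "reduced i ((j, e) # u)" using red(3) by (cases u) auto
  moreover have "v \<noteq> [] \<Longrightarrow> (j, e) \<noteq> flip (last v)"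
    using reduced_last[OF red(2)] by (metis flip_simps(2) fst_conv)
  ultimately have "reduced i (v @ (j, e) # u)" by (rule reduced_appendI[OF red(2)])
  then show ?thesis
    using u x y pushes_core[of i v "(j, e) # u"] push_Cons[of i "(j, e)" u] reduced_append[of i v "(j, e) # u"]
    by (simp add: lconj_def)
qed

text \<open>In the case excluded above the core letter of \<open>y\<close> does cancel, so conjugation by a different line never
  preserves the length of \<open>x\<close>.\<close>

lemma length_lconj_less:
  assumes "is_line x" "prefix (snd y @ [(fst y, \<not> e)]) (snd x)"
  shows "length (snd (lconj e x y)) < length (snd x)"
proof -
  obtain i w j v where x: "x = (i, w)" and y: "y = (j, v)" by (cases x; cases y)
  obtain k where w: "w = v @ (j, \<not> e) # k" using assms(2) x y by (auto simp: prefix_def)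
  have "lconj e x y = pushes v (i, k)"
    using unpush_append[of i v "(j, \<not> e) # k"] assms(1) x y w by (simp add: lconj_def)
  then show ?thesis using length_pushes_le[of v "(i, k)"] x w by simp
qed

lemma length_lconj_greater:
  assumes "is_line x" "is_line y" "x \<noteq> y" "\<not> prefix (snd y @ [(fst y, \<not> e)]) (snd x)"
  shows "length (snd x) < length (snd (lconj e x y))"
  using snd_lconj[OF assms] length_unpush_ge[of x "snd y"] by simp

lemma length_lconj_le:
  "length (snd (lconj e x y)) \<le> Suc (length (snd y) + length (snd (unpush (snd y) x)))"
  unfolding lconj_def
  using length_pushes_le[of "snd y" "push (fst y, e) (unpush (snd y) x)"]
    length_push_le[of "(fst y, e)" "unpush (snd y) x"] by simp

section \<open>Unique products\<close>

lemma length_unpush_le: "length (snd (unpush v x)) \<le> length v + length (snd x)"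
proof (induction v arbitrary: x)
  case (Cons a v)
  show ?case using Cons[of "push (flip a) x"] length_push_le[of "flip a" x] by simp
qed simp

lemma unpush_full_cancel:
  "length (snd x) = length v + length (snd (unpush v x)) \<Longrightarrow> snd x = v @ snd (unpush v x)"
proof (induction v arbitrary: x)
  case (Cons a v)
  let ?y = "push (flip a) x"
  have "length (snd x) \<le> Suc (length (snd ?y))" "length (snd ?y) \<le> length v + length (snd (unpush v ?y))"
    by (rule length_push_ge length_unpush_ge)+
  then have 1: "length (snd ?y) = length v + length (snd (unpush v ?y))"
    and 2: "length (snd x) = Suc (length (snd ?y))" using Cons.prems by auto
  have "snd x = a # snd ?y"
    using 2 by (cases "(flip a, x)" rule: push.cases) (auto split: if_splits)
  then show ?case using Cons.IH[OF 1] by simp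
qed simp

text \<open>If the tail does not begin with \<open>s\<close> and the core does not absorb everything, stripping \<open>s\<close> leaves the last
  letter of \<open>s\<close>, inverted, on top of the line, and a reduced continuation \<open>m\<close> of
  \<open>s\<close> cannot begin with the inverse of that letter.\<close>

lemma unpush_not_prefix:
  assumes "is_line x" "freely_reduced (s @ m)" "\<not> prefix s (snd x)" "snd (unpush s x) \<noteq> []"
  shows "snd (unpush m (unpush s x)) = rev (map flip m) @ snd (unpush s x)"
proof -
  obtain i w where x: "x = (i, w)" by (cases x)
  obtain u where u: "unpush s x = (i, u)" using x by (metis fst_conv fst_unpush surj_pair)
  obtain p q where pq: "unpush s (i, w) = unpush p (i, q)" "\<lbrakk>p \<noteq> []; q \<noteq> []\<rbrakk> \<Longrightarrow> hd p \<noteq> hd q"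
    "\<exists>t. s = t @ p \<and> w = t @ q" using unpush_split assms(1) x by (metis is_line_Pair)
  then obtain t where t: "s = t @ p" "w = t @ q" by blast
  have p: "p \<noteq> []" using assms(3) t x by auto
  have red: "freely_reduced p" "freely_reduced m" "m \<noteq> [] \<Longrightarrow> hd m \<noteq> flip (last p)"
    using assms(2) t p by (auto simp: successively_append_iff)
  have "hd u = flip (last p)"
    using unpush_diverge[OF p red(1) pq(2)[OF p], of i u] pq(1) u x assms(4) by simp
  then show ?thesis using unpush_no_cancel[of m u i] red assms(4) u by simp
qed

text \<open>The number \<open>length (snd (unpush v x))\<close> is the distance in the tree from the vertex \<open>v\<close> to the axis \<open>x\<close>. The
  way from the root to the end of the tail of \<open>y\<close> and on to \<open>x\<close> is no longer than the way to \<open>v\<close> and on to the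
  farther of \<open>x\<close> and \<open>y\<close>. If the tail of \<open>y\<close> branches off \<open>v\<close>, comparing lengths at the branching point gives a
  strict inequality. If it is an initial part of \<open>v\<close>, this is the triangle inequality, and equality
  leaves only the stated tie, in which both axes pass through \<open>v\<close>.\<close>

lemma farther_than_shorter:
  assumes "is_line x" "is_line y" "freely_reduced v" "length (snd y) < length v"
    and "length (snd x) \<le> length v"
    and D: "length (snd (unpush v x)) \<le> D" "length (snd (unpush v y)) \<le> D"
    and le: "length v + D \<le> length (snd y) + length (snd (unpush (snd y) x))"
  obtains m where "D = 0" "snd x = v" "m \<noteq> []" "v = snd y @ m" "snd (unpush (snd y) x) = m"
proof -
  obtain s m m' where s: "v = s @ m" "snd y = s @ m'" "m = [] \<or> m' = [] \<or> hd m \<noteq> hd m'"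
    using longest_common_prefix[of v "snd y"] by auto
  have m: "m \<noteq> []" "length m' < length m" using assms(4) s by auto
  define z where "z = unpush s x"
  have zv: "unpush v x = unpush m z" and zy: "unpush (snd y) x = unpush m' z"
    using s by (simp_all add: z_def)
  have far: "snd (unpush m z) = rev (map flip m) @ snd z" if "\<not> prefix s (snd x)" "snd z \<noteq> []"
    using unpush_not_prefix[of x s m] assms(1,3) s(1) that by (simp add: z_def)
  have near: "snd x = s @ snd z" if pre: "prefix s (snd x)"
  proof -
    obtain k where k: "snd x = s @ k" using pre by (auto simp: prefix_def)
    then show ?thesis using unpush_append[of "fst x" s k] assms(1) by (cases x) (simp add: z_def)
  qed
  have tri: "length (snd (unpush m' z)) \<le> length m' + length (snd z)" by (rule length_unpush_le)
  \<comment> \<open>For nonempty \<open>m'\<close> the tail of \<open>y\<close> branches off \<open>v\<close> behind \<open>s\<close>; otherwise it is an initial part of \<open>v\<close>.\<close>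
  show ?thesis
  proof (cases "m' = []")
    case False
    have "reduced (fst y) m'" using assms(2) s(2) reduced_append is_line_def by metis
    moreover have "unpush v y = unpush m (fst y, m')"
      using unpush_append[of "fst y" s m'] assms(2) s by (cases y) simp
    moreover have "freely_reduced m" using assms(3) s(1) by (simp add: successively_append_iff)
    ultimately have "length (snd (unpush v y)) = length m + length m'"
      using unpush_no_cancel[of m m' "fst y"] s(3) m False by simp
    then have z: "length m < length (snd z)"
      using le D(2) tri m zy s by simp
    then have "\<not> prefix s (snd x)" using near assms(5) s(1) by force
    then have "length (snd (unpush m z)) = length m + length (snd z)"
      using far z by force
    then show ?thesis using D(1) le tri zv zy m s by simp
  next
    case True
    have z: "unpush (snd y) x = z" "snd y = s" using zy s True by simp_all
    have "length (snd z) \<le> length m + length (snd (unpush m z))" by (rule length_unpush_ge)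
    then have D0: "length (snd z) = length m + length (snd (unpush m z))" "D = length (snd (unpush m z))"
      using le D(1) zv z s(1) by auto
    then have zm: "snd z = m @ snd (unpush m z)" using unpush_full_cancel by blast
    then have "prefix s (snd x)" using far m D0 by fastforce
    then have "snd x = v @ snd (unpush m z)" using near zm s(1) by simp
    moreover from this have "snd (unpush m z) = []" using assms(5) by simp
    ultimately show ?thesis using that[of m] D0 zm z m s by simp
  qed
qed

lemma not_prefix_shorter: "length w \<le> length v \<Longrightarrow> \<not> prefix (v @ [a]) w"
  by (auto simp: prefix_def)

text \<open>Take \<open>y\<close> of maximal length and then \<open>x\<close> at maximal distance from the end of the tail of \<open>y\<close>. By the
  cancellation estimate the product is longer than every member of \<open>A\<close> and shows \<open>y\<close>, so another
  factorisation has a shorter right factor; by the preceding lemma its product is too short, up to a tie in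
  which the last letters of the two products differ.\<close>

lemma line_unique_product:
  assumes "finite A" and lines: "\<And>x. x \<in> A \<Longrightarrow> is_line x" and "a \<in> A" "b \<in> A" "a \<noteq> b"
  shows "\<exists>x\<in>A. \<exists>y\<in>A. lconj True x y \<notin> A \<and>
    (\<forall>x'\<in>A. \<forall>y'\<in>A. lconj True x' y' = lconj True x y \<longrightarrow> x' = x \<and> y' = y)"
proof -
  have max: "\<exists>y\<in>B. \<forall>z\<in>B. f z \<le> f y" if "B \<subseteq> A" "B \<noteq> {}" for B and f :: "'a line \<Rightarrow> nat"
  proof -
    have "finite (f ` B)" using assms(1) that(1) finite_subset by blast
    then show ?thesis
      using Max_in[of "f ` B"] Max_ge[of "f ` B"] that(2) by (metis (no_types, lifting) imageE image_eqI image_is_empty)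
  qed
  obtain y where y: "y \<in> A" and ymax: "\<And>z. z \<in> A \<Longrightarrow> length (snd z) \<le> length (snd y)"
    using max[of A "\<lambda>y. length (snd y)"] assms(3) by blast
  let ?d = "\<lambda>x. length (snd (unpush (snd y) x))"
  have "A - {y} \<noteq> {}" using assms(3-5) by blast
  then obtain x where x: "x \<in> A" "x \<noteq> y" and xmax: "\<And>z. z \<in> A - {y} \<Longrightarrow> ?d z \<le> ?d x"
    using max[of "A - {y}" ?d] by blast
  have dmax: "?d z \<le> ?d x" if "z \<in> A" for z
    using xmax[of z] that unpush_self[OF lines[OF y]] by (cases "z = y") auto
  have p: "snd (lconj True x y) = snd y @ (fst y, True) # snd (unpush (snd y) x)"
    using snd_lconj[OF lines[OF x(1)] lines[OF y] x(2)] not_prefix_shorter[OF ymax[OF x(1)]] by blast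
  then have notin: "lconj True x y \<notin> A" using ymax by fastforce
  have "x' = x \<and> y' = y" if A': "x' \<in> A" "y' \<in> A" and eq: "lconj True x' y' = lconj True x y" for x' y'
  proof -
    have ne: "x' \<noteq> y'" using notin A' eq lconj_self[OF lines[OF A'(1)], of True] by metis
    have "y' = y"
    proof (cases "length (snd y') = length (snd y)")
      case True
      then have "snd (lconj True x' y') = snd y' @ (fst y', True) # snd (unpush (snd y') x')"
        using snd_lconj[OF lines[OF A'(1)] lines[OF A'(2)] ne] not_prefix_shorter ymax[OF A'(1)] by metis
      then show ?thesis using p eq True by (simp add: prod_eq_iff)
    next
      case False
      then have less: "length (snd y') < length (snd y)" using ymax[OF A'(2)] by simp
      have red: "freely_reduced (snd y)" using lines[OF y] by (simp add: is_line_def reduced_iff)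
      have "length (snd y) + ?d x \<le> length (snd y') + length (snd (unpush (snd y') x'))"
        using length_lconj_le[of True x' y'] p eq by simp
      from farther_than_shorter[OF lines[OF A'(1)] lines[OF A'(2)] red less ymax[OF A'(1)]
          dmax[OF A'(1)] dmax[OF A'(2)] this]
      obtain m where m: "?d x = 0" "snd x' = snd y" "m \<noteq> []" "snd y = snd y' @ m"
        "snd (unpush (snd y') x') = m" .
      \<comment> \<open>Both products now have the same length, but the last letter of the first is the last letter of
        \<open>snd y\<close>, whereas the second ends with the core of \<open>y\<close>, which is excluded in a reduced tail.\<close>
      have "\<not> length (snd (lconj True x' y')) < length (snd x')" using p eq m by simp
      then have "snd (lconj True x' y') = snd y' @ (fst y', True) # m"
        using snd_lconj[OF lines[OF A'(1)] lines[OF A'(2)] ne] length_lconj_less[OF lines[OF A'(1)]] m(5)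
        by blast
      then have "snd y' @ (fst y', True) # m = snd y @ [(fst y, True)]" using p eq m(1) by simp
      then have "last (snd y) = (fst y, True)" using m(3,4) by (metis last.simps last_appendR last_snoc list.distinct(1))
      then show ?thesis using lines[OF y] m(3,4) by (simp add: is_line_def reduced_iff)
    qed
    moreover have "x' = x"
      using lconj_cancel[OF lines[OF x(1)], of True y] lconj_cancel[OF lines[OF A'(1)], of True y]
        eq calculation by metis
    ultimately show ?thesis by blast
  qed
  then show ?thesis using x y notin by blast
qed

section \<open>Idempotents and automorphisms of quandle rings\<close>

text \<open>The product must lie outside \<open>A\<close>: then its coefficient in the square of an element with support \<open>A\<close> is a
  product of two nonzero integers, although an idempotent would require it to vanish.\<close>

definition unique_products :: "('a, 'c) qstruct_scheme \<Rightarrow> bool" where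
  "unique_products Q \<longleftrightarrow> (\<forall>A. finite A \<longrightarrow> A \<subseteq> carrier Q \<longrightarrow> (\<exists>a\<in>A. \<exists>b\<in>A. a \<noteq> b) \<longrightarrow>
     (\<exists>x\<in>A. \<exists>y\<in>A. x \<triangleright>\<^bsub>Q\<^esub> y \<notin> A \<and>
        (\<forall>x'\<in>A. \<forall>y'\<in>A. x' \<triangleright>\<^bsub>Q\<^esub> y' = x \<triangleright>\<^bsub>Q\<^esub> y \<longrightarrow> x' = x \<and> y' = y)))"

lemma unique_productsD:
  assumes "unique_products Q" "finite A" "A \<subseteq> carrier Q" "\<exists>a\<in>A. \<exists>b\<in>A. a \<noteq> b"
  shows "\<exists>x\<in>A. \<exists>y\<in>A. x \<triangleright>\<^bsub>Q\<^esub> y \<notin> A \<and>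
        (\<forall>x'\<in>A. \<forall>y'\<in>A. x' \<triangleright>\<^bsub>Q\<^esub> y' = x \<triangleright>\<^bsub>Q\<^esub> y \<longrightarrow> x' = x \<and> y' = y)"
  using assms unfolding unique_products_def by (elim allE[of _ A]) (simp only: simp_thms)

lemma unique_products_line_quandle: "unique_products (line_quandle S)"
  unfolding unique_products_def
proof (intro allI impI)
  fix A assume A: "finite A" "A \<subseteq> carrier (line_quandle S)" "\<exists>a\<in>A. \<exists>b\<in>A. a \<noteq> b"
  then have "\<And>x. x \<in> A \<Longrightarrow> is_line x" using lines_are_lines by blast
  moreover obtain a b where "a \<in> A" "b \<in> A" "a \<noteq> b" using A(3) by blast
  ultimately show "\<exists>x\<in>A. \<exists>y\<in>A. x \<triangleright>\<^bsub>line_quandle S\<^esub> y \<notin> A \<and> (\<forall>x'\<in>A. \<forall>y'\<in>A.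
      x' \<triangleright>\<^bsub>line_quandle S\<^esub> y' = x \<triangleright>\<^bsub>line_quandle S\<^esub> y \<longrightarrow> x' = x \<and> y' = y)"
    using line_unique_product[OF A(1)] by simp
qed

lemma unique_products_transfer:
  assumes R: "unique_products R" and h: "h \<in> qhom Q R" "inj_on h (carrier Q)"
    and closed: "\<And>x y. x \<in> carrier Q \<Longrightarrow> y \<in> carrier Q \<Longrightarrow> x \<triangleright>\<^bsub>Q\<^esub> y \<in> carrier Q"
  shows "unique_products Q"
  unfolding unique_products_def
proof (intro allI impI)
  fix A assume A: "finite A" "A \<subseteq> carrier Q" "\<exists>a\<in>A. \<exists>b\<in>A. a \<noteq> b"
  have hop: "h (x \<triangleright>\<^bsub>Q\<^esub> y) = h x \<triangleright>\<^bsub>R\<^esub> h y" if "x \<in> A" "y \<in> A" for x y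
    using h(1) that A(2) by (auto simp: qhom_def)
  have inj: "h x = h y \<longleftrightarrow> x = y" if "x \<in> A" "y \<in> A" for x y
    using h(2) A(2) that by (auto dest: inj_onD)
  have "finite (h ` A)" "h ` A \<subseteq> carrier R" "\<exists>a\<in>h ` A. \<exists>b\<in>h ` A. a \<noteq> b"
    using A inj qhom_closed[OF h(1)] by auto
  from unique_productsD[OF R this]
  obtain u v where uv: "u \<in> h ` A" "v \<in> h ` A" "u \<triangleright>\<^bsub>R\<^esub> v \<notin> h ` A"
    "\<forall>x'\<in>h ` A. \<forall>y'\<in>h ` A. x' \<triangleright>\<^bsub>R\<^esub> y' = u \<triangleright>\<^bsub>R\<^esub> v \<longrightarrow> x' = u \<and> y' = v"
    by blast
  obtain x y where "x \<in> A" "u = h x" "y \<in> A" "v = h y" using uv(1,2) by blast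
  then have xy: "x \<in> A" "y \<in> A" "h x \<triangleright>\<^bsub>R\<^esub> h y \<notin> h ` A"
    "\<And>x' y'. \<lbrakk>x' \<in> A; y' \<in> A; h x' \<triangleright>\<^bsub>R\<^esub> h y' = h x \<triangleright>\<^bsub>R\<^esub> h y\<rbrakk> \<Longrightarrow> h x' = h x \<and> h y' = h y"
    using uv(3,4) by simp_all
  have "x' = x \<and> y' = y" if "x' \<in> A" "y' \<in> A" "x' \<triangleright>\<^bsub>Q\<^esub> y' = x \<triangleright>\<^bsub>Q\<^esub> y" for x' y'
    using xy(4)[OF that(1,2)] that xy(1,2) hop inj by metis
  moreover have "x \<triangleright>\<^bsub>Q\<^esub> y \<notin> A" using xy hop by (metis imageI)
  ultimately show "\<exists>x\<in>A. \<exists>y\<in>A. x \<triangleright>\<^bsub>Q\<^esub> y \<notin> A \<and>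
        (\<forall>x'\<in>A. \<forall>y'\<in>A. x' \<triangleright>\<^bsub>Q\<^esub> y' = x \<triangleright>\<^bsub>Q\<^esub> y \<longrightarrow> x' = x \<and> y' = y)"
    using xy(1,2) by blast
qed

lemma lookup_qring_mult:
  "Poly_Mapping.lookup (qring_mult Q a b) z =
    (\<Sum>x\<in>Poly_Mapping.keys a. \<Sum>y\<in>Poly_Mapping.keys b.
      if x \<triangleright>\<^bsub>Q\<^esub> y = z then Poly_Mapping.lookup a x * Poly_Mapping.lookup b y else 0)"
  by (auto simp: qring_mult_def frag_extend_def lookup_sum sum_distrib_left intro!: sum.cong)

text \<open>A support with two elements is impossible by comparing coefficients at a unique product, and
  \<open>c e\<^sub>x\<close> is idempotent only for \<open>c = 0\<close> and \<open>c = 1\<close>.\<close>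

theorem idempotent_trivial:
  assumes Q: "quandle Q" "unique_products Q"
    and a: "Poly_Mapping.keys a \<subseteq> carrier Q" "qring_mult Q a a = a" "a \<noteq> 0"
  obtains x where "x \<in> carrier Q" "a = frag_of x"
proof -
  let ?A = "Poly_Mapping.keys a"
  have "\<not> (\<exists>x\<in>?A. \<exists>y\<in>?A. x \<noteq> y)"
  proof
    assume "\<exists>x\<in>?A. \<exists>y\<in>?A. x \<noteq> y"
    from unique_productsD[OF Q(2) finite_keys a(1) this]
    obtain x y where xy: "x \<in> ?A" "y \<in> ?A" "x \<triangleright>\<^bsub>Q\<^esub> y \<notin> ?A"
      "\<forall>x'\<in>?A. \<forall>y'\<in>?A. x' \<triangleright>\<^bsub>Q\<^esub> y' = x \<triangleright>\<^bsub>Q\<^esub> y \<longrightarrow> x' = x \<and> y' = y"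
      by blast
    have "Poly_Mapping.lookup a (x \<triangleright>\<^bsub>Q\<^esub> y) = (\<Sum>x'\<in>?A. \<Sum>y'\<in>?A.
        if x' \<triangleright>\<^bsub>Q\<^esub> y' = x \<triangleright>\<^bsub>Q\<^esub> y then Poly_Mapping.lookup a x' * Poly_Mapping.lookup a y' else 0)"
      using lookup_qring_mult[of Q a a] a(2) by simp
    also have "\<dots> = (\<Sum>x'\<in>?A. \<Sum>y'\<in>?A. if x' = x \<and> y' = y
        then Poly_Mapping.lookup a x * Poly_Mapping.lookup a y else 0)"
      using xy(4) by (intro sum.cong refl) auto
    also have "\<dots> = (\<Sum>x'\<in>?A. if x' = x then Poly_Mapping.lookup a x * Poly_Mapping.lookup a y else 0)"
      using xy(2) by (intro sum.cong refl) (auto simp: sum.delta)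
    also have "\<dots> = Poly_Mapping.lookup a x * Poly_Mapping.lookup a y"
      using xy(1) by (simp add: sum.delta)
    finally show False using xy(1-3) by (simp add: in_keys_iff)
  qed
  moreover have "?A \<noteq> {}" using a(3) by simp
  ultimately obtain x where A: "?A = {x}" by fast
  have "x \<triangleright>\<^bsub>Q\<^esub> x = x" using quandle.idem[OF Q(1)] A a(1) by simp
  then have "Poly_Mapping.lookup a x = Poly_Mapping.lookup a x * Poly_Mapping.lookup a x"
    using lookup_qring_mult[of Q a a x] a(2) A by simp
  moreover have "Poly_Mapping.lookup a x \<noteq> 0" using A by (simp flip: in_keys_iff)
  ultimately have "Poly_Mapping.lookup a x = 1" by simp
  have "Poly_Mapping.lookup a y = Poly_Mapping.lookup (frag_of x) y" for y
    using \<open>Poly_Mapping.lookup a x = 1\<close> A in_keys_iff[of y a]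
    by (cases "y = x") (auto simp: lookup_single_not_eq)
  then have "a = frag_of x" by (rule poly_mapping_eqI)
  then show ?thesis using that A a(1) by simp
qed

lemma qring_mult_diff_left: "qring_mult Q (a - b) c = qring_mult Q a c - qring_mult Q b c"
  by (simp add: qring_mult_def frag_extend_diff)

lemma qring_mult_diff_right: "qring_mult Q a (b - c) = qring_mult Q a b - qring_mult Q a c"
  using qring_mult_add_right[of Q a "b - c" c] by (simp add: algebra_simps)

definition linear_ext :: "('a, 'c) qstruct_scheme \<Rightarrow> ('a \<Rightarrow> 'a) \<Rightarrow> ('a \<Rightarrow>\<^sub>0 int) \<Rightarrow> ('a \<Rightarrow>\<^sub>0 int)" where
  "linear_ext Q h = restrict (frag_extend (frag_of \<circ> h)) (carrier (free_Abelian_group (carrier Q)))"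

context
  fixes Q :: "('a, 'c) qstruct_scheme"
  assumes Q: "quandle Q"
begin

interpretation quandle Q by (rule Q)

abbreviation "ZQ \<equiv> carrier (free_Abelian_group (carrier Q))"

lemma keys_linear_ext:
  assumes "h \<in> carrier Q \<rightarrow> carrier Q" "a \<in> ZQ"
  shows "frag_extend (frag_of \<circ> h) a \<in> ZQ"
  using keys_frag_extend[of "frag_of \<circ> h" a] assms by fastforce

lemma linear_ext_compose:
  assumes "h \<in> carrier Q \<rightarrow> carrier Q" "k \<in> carrier Q \<rightarrow> carrier Q" "a \<in> ZQ"
    and "\<And>x. x \<in> carrier Q \<Longrightarrow> l x = h (k x)"
  shows "linear_ext Q h (linear_ext Q k a) = linear_ext Q l a"
proof -
  have "frag_extend (frag_of \<circ> h) (frag_extend (frag_of \<circ> k) a) = frag_extend (frag_of \<circ> h \<circ> k) a"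
    by (rule frag_extend_compose)
  also have "\<dots> = frag_extend (frag_of \<circ> l) a"
    using assms by (intro frag_extend_eq) auto
  finally show ?thesis using keys_linear_ext[OF assms(2,3)] assms(3) by (simp add: linear_ext_def)
qed

lemma linear_ext_id:
  assumes "a \<in> ZQ" "\<And>x. x \<in> carrier Q \<Longrightarrow> l x = x"
  shows "linear_ext Q l a = a"
proof -
  have "frag_extend (frag_of \<circ> l) a = frag_extend frag_of a"
    using assms by (intro frag_extend_eq) auto
  then show ?thesis using assms(1) frag_expansion[of a] by (simp add: linear_ext_def)
qed

lemma linear_ext_mult:
  assumes h: "h \<in> qhom Q Q" and "a \<in> ZQ" "b \<in> ZQ"
  shows "frag_extend (frag_of \<circ> h) (qring_mult Q a b)
    = qring_mult Q (frag_extend (frag_of \<circ> h) a) (frag_extend (frag_of \<circ> h) b)"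
proof -
  have 1: "frag_extend (frag_of \<circ> h) (qring_mult Q (frag_of x) b)
    = qring_mult Q (frag_of (h x)) (frag_extend (frag_of \<circ> h) b)" if "x \<in> carrier Q" for x
    using \<open>b \<in> ZQ\<close> unfolding carrier_free_Abelian_group_iff
  proof (induction b rule: frag_induction)
    case zero
    then show ?case by (simp add: qring_mult_def)
  next
    case (one y)
    then show ?case using h that by (simp add: qring_mult_frag_of qhom_def)
  next
    case (diff a b)
    then show ?case by (simp add: qring_mult_diff_right frag_extend_diff)
  qed
  show ?thesis
    using \<open>a \<in> ZQ\<close> unfolding carrier_free_Abelian_group_iff
  proof (induction a rule: frag_induction)
    case zero
    then show ?case by (simp add: qring_mult_def)
  next
    case (one y)
    then show ?case using 1 by (simp add: o_def)
  next
    case (diff a b)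
    then show ?case by (simp add: qring_mult_diff_left frag_extend_diff)
  qed
qed

lemma linear_ext_auto:
  assumes h: "h \<in> qauto Q"
  shows "linear_ext Q h \<in> qring_auto Q"
proof -
  have hom: "h \<in> qhom Q Q" and hb: "bij_betw h (carrier Q) (carrier Q)"
    using h by (auto simp: qauto_def Bij_def)
  let ?k = "inv_into (carrier Q) h"
  have kb: "bij_betw ?k (carrier Q) (carrier Q)" using hb by (rule bij_betw_inv_into)
  note hf = bij_betw_imp_funcset[OF hb] and kf = bij_betw_imp_funcset[OF kb]
  have in_ZQ: "linear_ext Q l a \<in> ZQ" if "l \<in> carrier Q \<rightarrow> carrier Q" "a \<in> ZQ" for l a
    using keys_linear_ext[OF that] that(2) by (simp add: linear_ext_def)
  have "bij_betw (linear_ext Q h) ZQ ZQ"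
  proof (rule bij_betwI[where g = "linear_ext Q ?k"])
    show "linear_ext Q ?k (linear_ext Q h a) = a" if "a \<in> ZQ" for a
      using linear_ext_compose[OF kf hf that, of "\<lambda>x. x"] linear_ext_id[OF that, of "\<lambda>x. x"]
        bij_betw_inv_into_left[OF hb] by simp
    show "linear_ext Q h (linear_ext Q ?k a) = a" if "a \<in> ZQ" for a
      using linear_ext_compose[OF hf kf that, of "\<lambda>x. x"] linear_ext_id[OF that, of "\<lambda>x. x"]
        bij_betw_inv_into_right[OF hb] by simp
  qed (use in_ZQ hf kf in auto)
  then have "linear_ext Q h \<in> Bij ZQ" by (simp add: Bij_def linear_ext_def)
  moreover have "a + b \<in> ZQ" if "a \<in> ZQ" "b \<in> ZQ" for a b
    using that Poly_Mapping.keys_add[of a b] by auto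
  moreover have "frag_cmul k a \<in> ZQ" if "a \<in> ZQ" for k a
    using that by auto
  ultimately show ?thesis
    using linear_ext_mult[OF hom] qring_mult_closed[OF Q]
    by (simp add: qring_auto_def linear_ext_def frag_extend_add frag_extend_cmul)
qed

lemma qring_auto_diff:
  assumes f: "f \<in> qring_auto Q" and "a \<in> ZQ" "b \<in> ZQ"
  shows "f (a - b) = f a - f b"
proof -
  have b: "frag_cmul (-1) b \<in> ZQ" using assms(3) by auto
  have "f (x + y) = f x + f y" if "x \<in> ZQ" "y \<in> ZQ" for x y
    using f that unfolding qring_auto_def by blast
  moreover have "f (frag_cmul k x) = frag_cmul k (f x)" if "x \<in> ZQ" for k x
    using f that unfolding qring_auto_def by blast
  ultimately have "f (a + frag_cmul (-1) b) = f a + frag_cmul (-1) (f b)"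
    using assms(2,3) b by (simp only:)
  then show ?thesis by simp
qed

text \<open>A ring automorphism permutes the nonzero idempotents, and these are the basis elements.\<close>

lemma qring_auto_permutes_basis:
  assumes up: "unique_products Q" and f: "f \<in> qring_auto Q"
  obtains h where "h \<in> qauto Q" "f = linear_ext Q h"
proof -
  have fB: "f \<in> Bij ZQ" using f by (simp add: qring_auto_def)
  then have fb: "bij_betw f ZQ ZQ" and fe: "f \<in> extensional ZQ" by (auto simp: Bij_def)
  have fZ: "f a \<in> ZQ" if "a \<in> ZQ" for a using fb that by (rule bij_betwE[THEN bspec])
  have f0: "f 0 = 0" using qring_auto_diff[OF f, of 0 0] by simp
  have f_mult: "f (qring_mult Q a b) = qring_mult Q (f a) (f b)" if "a \<in> ZQ" "b \<in> ZQ" for a b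
    using f that by (simp add: qring_auto_def)
  have f_inj: "a = b" if "f a = f b" "a \<in> ZQ" "b \<in> ZQ" for a b
    using fb that by (auto simp: bij_betw_def dest: inj_onD)
  have basis: "frag_of x \<in> ZQ \<and> qring_mult Q (frag_of x) (frag_of x) = frag_of x"
    if "x \<in> carrier Q" for x
    using that idem by (simp add: keys_frag_of qring_mult_frag_of)
  have "\<exists>y\<in>carrier Q. f (frag_of x) = frag_of y" if x: "x \<in> carrier Q" for x
  proof -
    have "f (frag_of x) \<in> ZQ" using fZ basis[OF x] by blast
    moreover have "qring_mult Q (f (frag_of x)) (f (frag_of x)) = f (frag_of x)"
      using f_mult basis[OF x] by metis
    moreover have "f (frag_of x) \<noteq> 0"
      using f_inj[of "frag_of x" 0] basis[OF x] f0 by force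
    ultimately show ?thesis using idempotent_trivial[OF Q up] by (metis carrier_free_Abelian_group_iff)
  qed
  then obtain h0 where h0: "\<And>x. x \<in> carrier Q \<Longrightarrow> h0 x \<in> carrier Q \<and> f (frag_of x) = frag_of (h0 x)"
    by metis
  define h where "h = restrict h0 (carrier Q)"
  have h: "h x \<in> carrier Q" "f (frag_of x) = frag_of (h x)" if "x \<in> carrier Q" for x
    using h0 that by (auto simp: h_def)
  have "inj_on h (carrier Q)"
    using h f_inj basis by (intro inj_onI) (metis frag_of_eq)
  moreover have "y \<in> h ` carrier Q" if y: "y \<in> carrier Q" for y
  proof -
    obtain a where a: "a \<in> ZQ" "f a = frag_of y"
      using fb basis[OF y] unfolding bij_betw_def by (metis imageE)
    have "f (qring_mult Q a a) = f a" using f_mult[OF a(1) a(1)] a(2) basis[OF y] by simp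
    then have "qring_mult Q a a = a" using f_inj qring_mult_closed[OF Q a(1) a(1)] a(1) by blast
    moreover have "a \<noteq> 0" using a(2) f0 by auto
    ultimately obtain x where "x \<in> carrier Q" "a = frag_of x"
      using idempotent_trivial[OF Q up] a(1) by (metis carrier_free_Abelian_group_iff)
    then have "frag_of (h x) = frag_of y" using h(2) a(2) by metis
    then have "h x = y" by (simp add: frag_of_eq)
    then show ?thesis using \<open>x \<in> carrier Q\<close> by blast
  qed
  ultimately have "bij_betw h (carrier Q) (carrier Q)" using h(1) by (auto simp: bij_betw_def)
  moreover have "h (x \<triangleright>\<^bsub>Q\<^esub> y) = h x \<triangleright>\<^bsub>Q\<^esub> h y" if "x \<in> carrier Q" "y \<in> carrier Q" for x y
  proof -
    have "f (frag_of (x \<triangleright>\<^bsub>Q\<^esub> y)) = frag_of (h x \<triangleright>\<^bsub>Q\<^esub> h y)"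
      using f_mult[of "frag_of x" "frag_of y"] basis that h by (simp add: qring_mult_frag_of)
    then show ?thesis using h(2)[OF op_closed[OF that]] frag_of_eq by metis
  qed
  ultimately have "h \<in> qauto Q"
    using h(1) by (auto simp: qauto_def qhom_def Bij_def h_def)
  moreover have "f = linear_ext Q h"
  proof (rule extensionalityI[OF fe])
    show "linear_ext Q h \<in> extensional ZQ" by (simp add: linear_ext_def)
    fix a assume "a \<in> ZQ"
    then have "Poly_Mapping.keys a \<subseteq> carrier Q" by simp
    then have "f a = frag_extend (frag_of \<circ> h) a"
    proof (induction a rule: free_Abelian_group_induct[consumes 1, case_names zero diff one])
      case (diff a b)
      then show ?case using qring_auto_diff[OF f, of a b] by (simp add: frag_extend_diff)
    qed (use f0 h in auto)
    then show "f a = linear_ext Q h a" using \<open>a \<in> ZQ\<close> by (simp add: linear_ext_def)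
  qed
  ultimately show ?thesis using that by blast
qed

theorem AutQuandleRing_iso:
  assumes up: "unique_products Q"
  shows "AutQuandleRing Q \<cong> AutQuandle Q"
proof -
  have c: "h \<in> Bij (carrier Q) \<and> h \<in> carrier Q \<rightarrow> carrier Q \<and> h \<in> extensional (carrier Q)"
    if "h \<in> qauto Q" for h
    using that by (auto simp: qauto_def qhom_def Bij_def)
  have "inj_on (linear_ext Q) (qauto Q)"
  proof (rule inj_onI)
    fix h k assume hk: "h \<in> qauto Q" "k \<in> qauto Q" "linear_ext Q h = linear_ext Q k"
    have "h x = k x" if "x \<in> carrier Q" for x
      using fun_cong[OF hk(3), of "frag_of x"] that by (simp add: linear_ext_def keys_frag_of frag_of_eq)
    then show "h = k" using c[OF hk(1)] c[OF hk(2)] extensionalityI by blast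
  qed
  moreover have "linear_ext Q ` qauto Q = qring_auto Q"
    using linear_ext_auto qring_auto_permutes_basis[OF up] by blast
  moreover have "linear_ext Q (compose (carrier Q) h k) = compose ZQ (linear_ext Q h) (linear_ext Q k)"
    if "h \<in> qauto Q" "k \<in> qauto Q" for h k
  proof (rule extensionalityI[of _ ZQ])
    show "linear_ext Q (compose (carrier Q) h k) \<in> extensional ZQ" by (simp add: linear_ext_def)
    fix a assume a: "a \<in> ZQ"
    then show "linear_ext Q (compose (carrier Q) h k) a = compose ZQ (linear_ext Q h) (linear_ext Q k) a"
      using linear_ext_compose[of h k a "compose (carrier Q) h k"] c that by (simp add: compose_eq)
  qed simp
  moreover have "f \<in> Bij ZQ" if "f \<in> qring_auto Q" for f using that by (simp add: qring_auto_def)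
  ultimately have "linear_ext Q \<in> iso (AutQuandle Q) (AutQuandleRing Q)"
    using linear_ext_auto c
    by (auto simp: iso_def hom_def bij_betw_def AutQuandle_def AutQuandleRing_def BijGroup_def)
  then have "AutQuandle Q \<cong> AutQuandleRing Q" by (rule is_isoI)
  then show ?thesis by (rule group.iso_sym[OF AutQuandle_group[OF Q]])
qed

end

section \<open>Permutations as a group in additive notation\<close>

text \<open>Self-bijections of a type form a group in the sense of the type class \<^class>\<open>group_add\<close>, whose addition
  need not commute. Computing in a type class removes the membership conditions from the calculations with
  relations below; a group given by a carrier enters through its left multiplications.\<close>

typedef 'a bijection = "{f :: 'a \<Rightarrow> 'a. bij f}" morphisms app Abs_bijection
  by (rule exI[of _ id]) simp

setup_lifting type_definition_bijection

instantiation bijection :: (type) group_add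
begin

lift_definition zero_bijection :: "'a bijection" is "id" by simp
lift_definition plus_bijection :: "'a bijection \<Rightarrow> 'a bijection \<Rightarrow> 'a bijection" is "\<lambda>f g. f \<circ> g"
  by (rule bij_comp)
lift_definition uminus_bijection :: "'a bijection \<Rightarrow> 'a bijection" is "\<lambda>f. inv_into UNIV f"
  by (rule bij_imp_bij_inv)
definition "minus_bijection (f :: 'a bijection) g = f + - g"

instance
  by standard (transfer; auto simp: o_assoc bij_is_inj minus_bijection_def)+

end

lemma bij_app: "bij (app f)"
  using app[of f] by simp

lemma app_zero [simp]: "app 0 = id" and app_plus [simp]: "app (f + g) = app f \<circ> app g"
  and app_uminus [simp]: "app (- f) = inv_into UNIV (app f)"
  by (transfer; simp)+

lemma bijection_eqI: "app f = app g \<Longrightarrow> f = g"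
  by (simp add: app_inject)

definition swap :: "nat \<Rightarrow> nat bijection" where
  "swap i = Abs_bijection (transpose i (Suc i))"

lemma app_swap [simp]: "app (swap i) = transpose i (Suc i)"
  by (simp add: swap_def Abs_bijection_inverse)

section \<open>The Coxeter presentation of the symmetric group\<close>

locale coxeter_relations =
  fixes n :: nat and r :: "nat \<Rightarrow> 'g::group_add"
  assumes r_involution: "\<lbrakk>1 \<le> i; i < n\<rbrakk> \<Longrightarrow> r i + r i = 0"
    and r_commute: "\<lbrakk>1 \<le> i; i + 2 \<le> j; j < n\<rbrakk> \<Longrightarrow> r i + r j = r j + r i"
    and r_braid: "\<lbrakk>1 \<le> i; Suc i < n\<rbrakk> \<Longrightarrow> r i + r (Suc i) + r i = r (Suc i) + r i + r (Suc i)"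
begin

text \<open>The subgroup generated by \<open>r l, \<dots>, r (m - 1)\<close>: as the generators are involutions, closure under
  adding them includes closure under negation.\<close>

inductive_set gen :: "nat \<Rightarrow> nat \<Rightarrow> 'g set" for l m where
  zero: "0 \<in> gen l m"
| step: "\<lbrakk>g \<in> gen l m; l \<le> i; i < m\<rbrakk> \<Longrightarrow> g + r i \<in> gen l m"

text \<open>The sum \<open>r (m - 1) + \<dots> + r k\<close>. For transpositions it is a cycle that takes \<open>k\<close> to \<open>m\<close>, so these elements
  represent the cosets of the stabiliser of \<open>m\<close>.\<close>

definition cyc :: "nat \<Rightarrow> nat \<Rightarrow> 'g" where
  "cyc k m = sum_list (map r (rev [k..<m]))"

lemma r_left_cancel [simp]: "\<lbrakk>1 \<le> i; i < n\<rbrakk> \<Longrightarrow> r i + (r i + x) = x"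
  by (metis add.assoc r_involution add_0_left)

lemma uminus_r: "\<lbrakk>1 \<le> i; i < n\<rbrakk> \<Longrightarrow> - r i = r i"
  using r_involution minus_unique by blast

lemma gen_add: "h \<in> gen l m \<Longrightarrow> g \<in> gen l m \<Longrightarrow> g + h \<in> gen l m"
  by (induction rule: gen.induct) (auto simp: add.assoc[symmetric] intro: gen.step)

lemma gen_gen: "\<lbrakk>l \<le> i; i < m\<rbrakk> \<Longrightarrow> r i \<in> gen l m"
  using gen.step[OF gen.zero] by simp

lemma gen_uminus: "\<lbrakk>g \<in> gen l m; 1 \<le> l; m \<le> n\<rbrakk> \<Longrightarrow> - g \<in> gen l m"
proof (induction rule: gen.induct)
  case (step g i)
  then show ?case using gen_add[OF step.IH, of "r i"] gen_gen[of l i m] by (simp add: minus_add uminus_r)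
qed (simp add: gen.zero)

lemma gen_mono: "g \<in> gen l m \<Longrightarrow> l' \<le> l \<Longrightarrow> m \<le> m' \<Longrightarrow> g \<in> gen l' m'"
  by (induction rule: gen.induct) (auto intro: gen.intros)

lemma cyc_self [simp]: "cyc m m = 0"
  by (simp add: cyc_def)

lemma cyc_step: "k < m \<Longrightarrow> cyc k m = cyc (Suc k) m + r k"
  by (simp add: cyc_def upt_conv_Cons)

lemma cyc_Suc: "k \<le> m \<Longrightarrow> cyc k (Suc m) = r m + cyc k m"
  by (simp add: cyc_def)

lemma cyc_split: "\<lbrakk>k \<le> i; i \<le> m\<rbrakk> \<Longrightarrow> cyc k m = cyc i m + cyc k i"
proof (induction "m - i" arbitrary: i)
  case (Suc d)
  then have "cyc k m = cyc (Suc i) m + cyc k (Suc i)" by simp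
  then show ?case using Suc.prems Suc.hyps(2) cyc_Suc[of k i] cyc_step[of i m] by (simp add: add.assoc)
qed simp

lemma cyc_gen: "l \<le> k \<Longrightarrow> k \<le> m \<Longrightarrow> cyc k m \<in> gen l m"
proof (induction "m - k" arbitrary: k)
  case 0
  then show ?case by (simp add: gen.zero)
next
  case (Suc d)
  then have "cyc (Suc k) m \<in> gen l m" by simp
  then show ?case using Suc cyc_step[of k m] gen.step[of _ l m k] by simp
qed

lemma cyc_commute:
  assumes "1 \<le> k" "k \<le> m" "m \<le> n" "1 \<le> i" "i < n" "Suc i < k \<or> m < i"
  shows "cyc k m + r i = r i + cyc k m"
  using assms
proof (induction "m - k" arbitrary: k)
  case (Suc d)
  have c: "r k + r i = r i + r k"
    using r_commute[of i k] r_commute[of k i] Suc.prems Suc.hyps(2) by auto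
  have "cyc (Suc k) m + r i = r i + cyc (Suc k) m"
    using Suc.hyps(1)[of "Suc k"] Suc.hyps(2) Suc.prems by auto
  then show ?case using c cyc_step[of k m] Suc.hyps(2) by (metis add.assoc zero_less_Suc zero_less_diff)
qed simp

text \<open>The set of elements on the right is closed under adding a generator: the generator lengthens or shortens
  the cycle, or it moves past the cycle, with its index lowered by one if it lies inside.\<close>

lemma gen_decompose:
  assumes "g \<in> gen l (Suc m)" "1 \<le> l" "l \<le> m" "m < n"
  shows "\<exists>h\<in>gen l m. \<exists>k. l \<le> k \<and> k \<le> Suc m \<and> g = h + cyc k (Suc m)"
  using assms
proof (induction rule: gen.induct)
  case zero
  then show ?case by (intro bexI[of _ 0] exI[of _ "Suc m"]) (auto intro: gen.zero)
next
  case (step g i)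
  then obtain h k where hk: "h \<in> gen l m" "l \<le> k" "k \<le> Suc m" "g = h + cyc k (Suc m)" by auto
  have i: "1 \<le> i" "i < n" "i \<le> m" using step by auto
  consider "i = k" | "Suc i = k" | "Suc i < k" | "k < i" by linarith
  then show ?case
  proof cases
    case 1
    then have "g + r i = h + cyc (Suc k) (Suc m)"
      using hk cyc_step[of k "Suc m"] i r_involution[OF i(1,2)] by (simp add: add.assoc)
    then show ?thesis using hk 1 i by (intro bexI[of _ h] exI[of _ "Suc k"]) auto
  next
    case 2
    then have "g + r i = h + cyc i (Suc m)"
      using hk cyc_step[of i "Suc m"] by (simp add: add.assoc)
    then show ?thesis using hk 2 step i by (intro bexI[of _ h] exI[of _ i]) auto
  next
    case 3
    then have "g + r i = (h + r i) + cyc k (Suc m)"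
      using hk cyc_commute[of k "Suc m" i] i assms by (simp add: add.assoc)
    moreover have "h + r i \<in> gen l m" using 3 hk step by (intro gen.step) auto
    ultimately show ?thesis using hk by blast
  next
    case 4
    \<comment> \<open>The cycle contains \<open>r i + r j\<close> with \<open>j = i - 1\<close>, where the braid relation turns the \<open>r i\<close> that
      comes from the right into an \<open>r j\<close> that leaves to the left.\<close>
    define j where "j = i - 1"
    have j: "i = Suc j" "k \<le> j" "1 \<le> j" using 4 hk step by (auto simp: j_def)
    have ij: "r (Suc j) + (r j + r (Suc j)) = r j + (r (Suc j) + r j)"
      using r_braid[of j] j i by (simp add: add.assoc)
    have D: "cyc k (Suc m) = cyc (Suc i) (Suc m) + (r i + (r j + cyc k j))"
      using cyc_split[of k "Suc i" "Suc m"] cyc_Suc[of k i] cyc_Suc[of k j] j i by (simp add: add.assoc)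
    have c1: "cyc k j + r i = r i + cyc k j"
      using cyc_commute[of k j i] j i hk step by simp
    have c2: "cyc (Suc i) (Suc m) + r j = r j + cyc (Suc i) (Suc m)"
      using cyc_commute[of "Suc i" "Suc m" j] j i step by simp
    have "cyc k (Suc m) + r i = cyc (Suc i) (Suc m) + (r i + (r j + (r i + cyc k j)))"
      using D c1 by (simp add: add.assoc)
    also have "\<dots> = cyc (Suc i) (Suc m) + (r j + (r i + (r j + cyc k j)))"
      using arg_cong[OF ij, of "\<lambda>y. y + cyc k j"] j(1) by (simp add: add.assoc)
    also have "\<dots> = r j + cyc k (Suc m)"
      using arg_cong[OF c2, of "\<lambda>y. y + (r i + (r j + cyc k j))"] D by (simp add: add.assoc)
    finally have "g + r i = (h + r j) + cyc k (Suc m)" using hk by (simp add: add.assoc)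
    moreover have "h + r j \<in> gen l m" using j i hk step by (intro gen.step) auto
    ultimately show ?thesis using hk by blast
  qed
qed

end

lemma swap_relations: "coxeter_relations n swap"
  by standard (auto intro!: bijection_eqI simp: fun_eq_iff transpose_def)

context coxeter_relations
begin

text \<open>The subgroup generated by the pairs of a generator and its transposition. That the symmetric group is
  presented by the Coxeter relations means that this is the graph of a homomorphism from permutations to \<open>'g\<close>,
  which the lemmas below establish. Using a graph avoids choosing a word for each permutation.\<close>

definition graph :: "nat \<Rightarrow> nat \<Rightarrow> ('g \<times> nat bijection) set" where
  "graph = coxeter_relations.gen (\<lambda>i. (r i, swap i))"

interpretation g: coxeter_relations n "\<lambda>i. (r i, swap i)"
proof -
  interpret s: coxeter_relations n swap by (rule swap_relations)
  show "coxeter_relations n (\<lambda>i. (r i, swap i))"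
  proof
    fix i j assume "1 \<le> i" "i + 2 \<le> j" "j < n"
    then show "(r i, swap i) + (r j, swap j) = (r j, swap j) + (r i, swap i)"
      using r_commute[of i j] s.r_commute[of i j] by simp
  qed (simp_all only: add_Pair zero_prod_def r_involution s.r_involution r_braid s.r_braid)
qed

lemma graph_zero: "0 \<in> graph l m"
  unfolding graph_def by (rule g.gen.zero)

lemma graph_add: "\<lbrakk>(g, p) \<in> graph l m; (h, q) \<in> graph l m\<rbrakk> \<Longrightarrow> (g + h, p + q) \<in> graph l m"
  unfolding graph_def using g.gen_add[of "(h, q)" l m "(g, p)"] by simp

lemma graph_uminus: "\<lbrakk>(g, p) \<in> graph l m; 1 \<le> l; m \<le> n\<rbrakk> \<Longrightarrow> (- g, - p) \<in> graph l m"
  unfolding graph_def using g.gen_uminus[of "(g, p)" l m] by simp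

lemma graph_swap: "\<lbrakk>l \<le> i; i < m\<rbrakk> \<Longrightarrow> (r i, swap i) \<in> graph l m"
  unfolding graph_def by (rule g.gen_gen)

lemma graph_mono: "x \<in> graph l m \<Longrightarrow> l' \<le> l \<Longrightarrow> m \<le> m' \<Longrightarrow> x \<in> graph l' m'"
  unfolding graph_def by (rule g.gen_mono)

lemma graph_induct [consumes 1, case_names zero step]:
  assumes "x \<in> graph l m" "P 0 0"
    "\<And>g p i. \<lbrakk>(g, p) \<in> graph l m; P g p; l \<le> i; i < m\<rbrakk> \<Longrightarrow> P (g + r i) (p + swap i)"
  shows "P (fst x) (snd x)"
  using assms(1) unfolding graph_def
proof (induction rule: g.gen.induct)
  case zero
  then show ?case using assms(2) by simp
next
  case (step x i)
  then show ?case using assms(3)[of "fst x" "snd x" i] by (simp add: graph_def)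
qed

lemma graph_permutes: "(g, p) \<in> graph l m \<Longrightarrow> app p permutes {l..m}"
proof -
  have "app (snd x) permutes {l..m}" if "x \<in> graph l m" for x
    using that
    by (induction rule: graph_induct[where P = "\<lambda>_ p. app p permutes {l..m}"])
      (auto simp: permutes_id id_def[symmetric] intro!: permutes_compose permutes_swap_id)
  then show "(g, p) \<in> graph l m \<Longrightarrow> app p permutes {l..m}" by force
qed

lemma app_cyc: "k \<le> m \<Longrightarrow> app (snd (g.cyc k m)) k = m"
proof (induction "m - k" arbitrary: k)
  case (Suc d)
  then have "app (snd (g.cyc (Suc k) m)) (Suc k) = m" by simp
  moreover have "g.cyc k m = g.cyc (Suc k) m + (r k, swap k)"
    using Suc.hyps(2) by (intro g.cyc_step) simp
  ultimately show ?case by simp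
qed simp

text \<open>Apply the coset decomposition to the pair. A trivial permutation fixes \<open>m\<close>, so the coset
  representative is trivial and the induction hypothesis applies to the remaining factor.\<close>

theorem graph_unique_zero:
  assumes "(g, 0) \<in> graph l m" "1 \<le> l" "m \<le> n"
  shows "g = 0"
  using assms
proof (induction m arbitrary: g)
  case 0
  have "x = 0" if "x \<in> graph l m" "m \<le> l" for x m
    using that unfolding graph_def by (induction rule: g.gen.induct) auto
  from this[OF 0(1)] 0 show ?case by (simp add: zero_prod_def)
next
  case (Suc m)
  show ?case
  proof (cases "l \<le> m")
    case False
    have "x = 0" if "x \<in> graph l (Suc m)" for x
      using that False unfolding graph_def by (induction rule: g.gen.induct) auto
    then show ?thesis using Suc.prems(1) by (force simp: zero_prod_def)
  next
    case True
    from g.gen_decompose[of "(g, 0)" l m] Suc.prems True obtain x k where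
      x: "x \<in> g.gen l m" "l \<le> k" "k \<le> Suc m" "(g, 0) = x + g.cyc k (Suc m)"
      unfolding graph_def by auto
    have p: "app (snd x) permutes {l..m}"
      using graph_permutes[of "fst x" "snd x" l m] x(1) by (simp add: graph_def)
    have "0 = snd x + snd (g.cyc k (Suc m))" using x(4) by (metis snd_add snd_conv)
    then have "id = app (snd x) \<circ> app (snd (g.cyc k (Suc m)))" by (metis app_plus app_zero)
    from fun_cong[OF this, of k] have "k = app (snd x) (Suc m)" using app_cyc[OF x(3)] by simp
    then have "k = Suc m" using permutes_not_in[OF p] by simp
    then have "(g, 0) \<in> graph l m" using x by (simp add: graph_def)
    then show ?thesis using Suc.IH Suc.prems by simp
  qed
qed

lemma graph_unique:
  assumes "(g, p) \<in> graph l m" "(h, p) \<in> graph l m" "1 \<le> l" "m \<le> n"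
  shows "g = h"
proof -
  have "(- g + h, - p + p) \<in> graph l m" using graph_add graph_uminus assms by blast
  then have "- g + h = 0" using graph_unique_zero[of "- g + h" l m] assms by simp
  then show ?thesis by (metis add.inverse_inverse minus_unique)
qed

text \<open>The cycle that takes the preimage of the largest point to that point reduces the permutation to a
  shorter interval.\<close>

lemma graph_exists:
  assumes "\<pi> permutes {l..m}" "1 \<le> l"
  shows "\<exists>g p. (g, p) \<in> graph l m \<and> app p = \<pi>"
  using assms
proof (induction m arbitrary: \<pi>)
  case 0
  then have "\<pi> = id" by (simp add: permutes_empty)
  then show ?case using graph_zero[of l 0] app_zero by (metis prod.collapse snd_zero)
next
  case (Suc m)
  show ?case
  proof (cases "l \<le> Suc m")
    case False
    then have "\<pi> = id" using Suc.prems by (simp add: permutes_empty)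
    then show ?thesis using graph_zero[of l "Suc m"] app_zero by (metis prod.collapse snd_zero)
  next
    case True
    define k where "k = inv_into UNIV \<pi> (Suc m)"
    have k: "\<pi> k = Suc m" "l \<le> k" "k \<le> Suc m"
      using permutes_inverses(1)[OF Suc.prems(1)] permutes_in_image[OF permutes_inv[OF Suc.prems(1)], of "Suc m"] True
      by (auto simp: k_def)
    obtain c q where cq: "g.cyc k (Suc m) = (c, q)" by (cases "g.cyc k (Suc m)")
    have cg: "(c, q) \<in> graph l (Suc m)" using g.cyc_gen[OF k(2,3)] cq by (simp add: graph_def)
    have qk: "app q k = Suc m" using app_cyc[OF k(3)] cq by simp
    note qp = graph_permutes[OF cg]
    have super: "\<pi> \<circ> inv_into UNIV (app q) permutes {l..Suc m}"
      using Suc.prems qp by (intro permutes_compose permutes_inv)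
    have fixed: "(\<pi> \<circ> inv_into UNIV (app q)) (Suc m) = Suc m"
      using qk k(1) qp by (metis comp_apply permutes_inverses(2))
    have "\<pi> \<circ> inv_into UNIV (app q) permutes {l..m}"
    proof (rule permutes_superset[OF super])
      fix i assume "i \<in> {l..Suc m} - {l..m}"
      then have "i = Suc m" by auto
      then show "(\<pi> \<circ> inv_into UNIV (app q)) i = i" using fixed by simp
    qed
    then obtain g p where gp: "(g, p) \<in> graph l m" "app p = \<pi> \<circ> inv_into UNIV (app q)"
      using Suc.IH Suc.prems by blast
    have "app (p + q) = \<pi>"
      using gp(2) permutes_inv_o(2)[OF qp] by (simp add: comp_assoc)
    moreover have "(g + c, p + q) \<in> graph l (Suc m)"
      using graph_add[OF graph_mono[OF gp(1)] cg] by simp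
    ultimately show ?thesis by blast
  qed
qed

end

section \<open>Elementary twists in a group with welded braid relations\<close>

lemma permutes_prescribed:
  assumes "distinct xs" "set xs \<subseteq> {1..n}"
  shows "\<exists>\<pi>. \<pi> permutes {1..n} \<and> (\<forall>k<length xs. \<pi> (Suc k) = xs ! k)"
  using assms
proof (induction xs rule: rev_induct)
  case Nil
  show ?case using permutes_id[of "{1..n}"] by (metis list.size(3) not_less_zero)
next
  case (snoc x xs)
  then obtain \<pi> where \<pi>: "\<pi> permutes {1..n}" "\<And>k. k < length xs \<Longrightarrow> \<pi> (Suc k) = xs ! k" by auto
  let ?m = "Suc (length xs)"
  have "?m \<le> n" using card_mono[OF _ snoc.prems(2)] distinct_card[OF snoc.prems(1)] by simp
  then have m: "\<pi> ?m \<in> {1..n}" using permutes_in_image[OF \<pi>(1)] by simp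
  let ?\<rho> = "transpose (\<pi> ?m) x \<circ> \<pi>"
  have "?\<rho> permutes {1..n}"
    using \<pi>(1) m snoc.prems(2) by (intro permutes_compose permutes_swap_id) auto
  moreover have "?\<rho> (Suc k) = (xs @ [x]) ! k" if "k < length (xs @ [x])" for k
  proof (cases "k = length xs")
    case False
    then have k: "k < length xs" using that by simp
    have "\<pi> (Suc k) \<noteq> \<pi> ?m" using inj_eq[OF permutes_inj[OF \<pi>(1)]] k by simp
    moreover have "xs ! k \<noteq> x" using snoc.prems(1) k by auto
    ultimately show ?thesis using \<pi>(2)[OF k] k by (simp add: nth_append)
  qed simp
  ultimately show ?case by blast
qed

lemma commute_add:
  fixes a :: "'g::group_add"
  shows "\<lbrakk>a + c = c + a; b + c = c + b\<rbrakk> \<Longrightarrow> (a + b) + c = c + (a + b)"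
  by (metis add.assoc)

text \<open>An arbitrary group with elements that satisfy the defining relations of the welded braid group.\<close>

locale welded_relations = coxeter_relations n r for n and r :: "nat \<Rightarrow> 'g::group_add" +
  fixes s :: "nat \<Rightarrow> 'g"
  assumes s_commute: "\<lbrakk>1 \<le> i; i + 2 \<le> j; j < n\<rbrakk> \<Longrightarrow> s i + s j = s j + s i"
    and sr_commute: "\<lbrakk>1 \<le> i; 1 \<le> j; i < n; j < n; i + 2 \<le> j \<or> j + 2 \<le> i\<rbrakk> \<Longrightarrow> s i + r j = r j + s i"
    and s_braid: "\<lbrakk>1 \<le> i; Suc i < n\<rbrakk> \<Longrightarrow> s i + s (Suc i) + s i = s (Suc i) + s i + s (Suc i)"
    and rrs: "\<lbrakk>1 \<le> i; Suc i < n\<rbrakk> \<Longrightarrow> r i + r (Suc i) + s i = s (Suc i) + r i + r (Suc i)"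
    and ssr: "\<lbrakk>1 \<le> i; Suc i < n\<rbrakk> \<Longrightarrow> s i + s (Suc i) + r i = r (Suc i) + s i + s (Suc i)"
begin

text \<open>The element that corresponds to the automorphism \<open>x\<^sub>i \<mapsto> x\<^sub>i * x\<^sub>j\<close> fixing the other generators. For
  \<open>i = 2\<close> and \<open>j = 1\<close> this automorphism is \<open>\<sigma>\<^sub>1 \<rho>\<^sub>1\<close>, and the others are its conjugates by permutations.\<close>

definition twist :: "nat \<Rightarrow> nat \<Rightarrow> 'g" where
  "twist i j = (THE x. \<exists>g p. (g, p) \<in> graph 1 n \<and> app p 2 = i \<and> app p 1 = j \<and>
     x = g + (s 1 + r 1) - g)"

lemma graph_commute:
  assumes "(h, q) \<in> graph 3 n"
  shows "h + (s 1 + r 1) = (s 1 + r 1) + h"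
proof -
  have "fst x + (s 1 + r 1) = (s 1 + r 1) + fst x" if "x \<in> graph 3 n" for x
    using that
  proof (induction rule: graph_induct[where P = "\<lambda>g _. g + (s 1 + r 1) = (s 1 + r 1) + g"])
    case (step g p i)
    have "r i + s 1 = s 1 + r i" "r i + r 1 = r 1 + r i"
      using step sr_commute[of 1 i] r_commute[of 1 i] by auto
    then have "r i + (s 1 + r 1) = (s 1 + r 1) + r i"
      using commute_add[of "s 1" "r i" "r 1"] by simp
    with step(2) show ?case by (intro commute_add)
  qed simp
  from this[OF assms] show ?thesis by simp
qed

text \<open>Two permutations with the same values at 1 and 2 differ by one that fixes both, hence by a word in
  \<open>r 3, r 4, \<dots>\<close>, and these generators commute with \<open>s 1\<close> and \<open>r 1\<close>.\<close>

lemma twist_eq: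
  assumes gp: "(g, p) \<in> graph 1 n" "app p 2 = i" "app p 1 = j"
  shows "twist i j = g + (s 1 + r 1) - g"
proof -
  have "h + (s 1 + r 1) - h = g + (s 1 + r 1) - g"
    if hq: "(h, q) \<in> graph 1 n" "app q 2 = i" "app q 1 = j" for h q
  proof -
    have d: "(- g + h, - p + q) \<in> graph 1 n" using graph_add graph_uminus gp hq by blast
    have inj: "inj (app p)" using bij_app bij_is_inj by blast
    have pi: "app (- p + q) permutes {1..n}" by (rule graph_permutes[OF d])
    have "app (- p + q) permutes {3..n}"
    proof (rule permutes_superset[OF pi])
      fix k assume "k \<in> {1..n} - {3..n}"
      then have "k = 1 \<or> k = 2" by auto
      then have "app q k = app p k" using hq gp by auto
      then show "app (- p + q) k = k" using inj by simp
    qed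
    then obtain f o' where f: "(f, o') \<in> graph 3 n" "app o' = app (- p + q)"
      using graph_exists[of _ 3 n] by force
    then have "(f, - p + q) \<in> graph 3 n" using bijection_eqI by blast
    then have "- g + h = f" using graph_unique[OF d] graph_mono[of _ 3 n 1 n] by simp
    then have "h = g + f" by (metis add.assoc add.right_inverse add_0_left)
    moreover have "f + (s 1 + r 1) - f = s 1 + r 1"
      using graph_commute[OF f(1)] by (simp add: add.assoc diff_conv_add_uminus del: add_uminus_conv_diff)
    ultimately show ?thesis
      by (simp add: add.assoc diff_conv_add_uminus minus_add del: add_uminus_conv_diff)
        (metis add.assoc add_uminus_conv_diff)
  qed
  then show ?thesis unfolding twist_def by (intro the_equality) (use gp in blast)+
qed

lemma graph_prescribed:
  assumes "distinct xs" "set xs \<subseteq> {1..n}"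
  obtains g p where "(g, p) \<in> graph 1 n" "\<And>k. k < length xs \<Longrightarrow> app p (Suc k) = xs ! k"
  using permutes_prescribed[OF assms] graph_exists[of _ 1 n] by (metis order_refl)

lemma twist_conj:
  assumes hq: "(h, q) \<in> graph 1 n" and ij: "i \<noteq> j" "i \<in> {1..n}" "j \<in> {1..n}"
  shows "twist (app q i) (app q j) = h + twist i j - h"
proof -
  obtain g p where gp: "(g, p) \<in> graph 1 n" "\<And>k. k < length [j, i] \<Longrightarrow> app p (Suc k) = [j, i] ! k"
    using graph_prescribed[of "[j, i]"] ij by auto
  have p: "app p 1 = j" "app p 2 = i" using gp(2)[of 0] gp(2)[of 1] by (auto simp: numeral_2_eq_2)
  have "twist (app q i) (app q j) = (h + g) + (s 1 + r 1) - (h + g)"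
    by (rule twist_eq[of _ "q + p"]) (use graph_add[OF hq gp(1)] p in auto)
  then show ?thesis using twist_eq[OF gp(1) p(2,1)]
    by (simp add: add.assoc diff_conv_add_uminus minus_add del: add_uminus_conv_diff)
qed

lemma twist_swap:
  assumes "1 \<le> k" "k < n" "i \<noteq> j" "i \<in> {1..n}" "j \<in> {1..n}"
  shows "twist (transpose k (Suc k) i) (transpose k (Suc k) j) = r k + twist i j + r k"
  using twist_conj[of "r k" "swap k" i j] graph_swap[of 1 k n] assms uminus_r[of k]
  by (simp add: diff_conv_add_uminus del: add_uminus_conv_diff)

text \<open>Conjugating by \<open>r k + r (Suc k)\<close> shifts the indices by one, on the twist by its definition and on \<open>s k\<close>
  by the relation \<open>rrs\<close>.\<close>

lemma twist_adjacent: "\<lbrakk>1 \<le> k; k < n\<rbrakk> \<Longrightarrow> twist (Suc k) k = s k + r k"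
proof (induction k rule: nat_induct_at_least)
  case base
  show ?case using twist_eq[of 0 0 2 1] graph_zero by (simp add: zero_prod_def numeral_2_eq_2)
next
  case (Suc k)
  have 1: "twist (Suc (Suc k)) k = r (Suc k) + twist (Suc k) k + r (Suc k)"
    using twist_swap[of "Suc k" "Suc k" k] Suc by (simp add: transpose_def)
  have "twist (Suc (Suc k)) (Suc k) = r k + twist (Suc (Suc k)) k + r k"
    using twist_swap[of k "Suc (Suc k)" k] Suc by (simp add: transpose_def)
  also have "\<dots> = (r k + r (Suc k) + s k) + (r k + (r (Suc k) + r k))"
    using 1 Suc by (simp add: add.assoc)
  also have "\<dots> = s (Suc k) + (r k + r (Suc k) + r k) + (r (Suc k) + r k)"
    using rrs[of k] Suc by (simp add: add.assoc)
  also have "\<dots> = s (Suc k) + r (Suc k)"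
    using r_braid[of k] r_involution[of k] Suc by (simp add: add.assoc)
  finally show ?case .
qed

text \<open>McCool's relations for three strands. After the permutations have been moved to the right, the first is
  the mixed relation \<open>ssr\<close> and the second is the braid relation for the \<open>s i\<close>.\<close>

lemma twist_three:
  assumes "3 \<le> n"
  defines "A \<equiv> twist 2 1" and "B \<equiv> twist 3 1" and "C \<equiv> twist 3 2"
  shows "A + B = B + A" "A + B + C = C + (A + B)"
proof -
  have A: "A = s 1 + r 1" and C: "C = s 2 + r 2"
    using twist_adjacent[of 1] twist_adjacent[of 2] assms by (simp_all add: numeral_2_eq_2 numeral_3_eq_3)
  have B: "B = r 2 + A + r 2"
    using twist_swap[of 2 2 1] assms by (simp add: transpose_def)
  have r: "r 1 + (r 1 + x) = x" "r 2 + (r 2 + x) = x" for x using assms by auto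
  have rr: "r 1 + (r 2 + (r 1 + x)) = r 2 + (r 1 + (r 2 + x))" for x
    using arg_cong[OF r_braid[of 1], of "\<lambda>y. y + x"] assms by (simp add: add.assoc numeral_2_eq_2)
  have r12: "r 1 + (r 2 + r 1) = r 2 + (r 1 + r 2)"
    using rr[of 0] by simp
  have srr: "r 1 + (r 2 + (s 1 + x)) = s 2 + (r 1 + (r 2 + x))" for x
    using arg_cong[OF rrs[of 1], of "\<lambda>y. y + x"] assms by (simp add: add.assoc numeral_2_eq_2)
  have rss: "s 1 + (s 2 + (r 1 + x)) = r 2 + (s 1 + (s 2 + x))" for x
    using arg_cong[OF ssr[of 1], of "\<lambda>y. y + x"] assms by (simp add: add.assoc numeral_2_eq_2)
  have sss: "s 1 + (s 2 + (s 1 + x)) = s 2 + (s 1 + (s 2 + x))" for x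
    using arg_cong[OF s_braid[of 1], of "\<lambda>y. y + x"] assms by (simp add: add.assoc numeral_2_eq_2)
  have rsr: "r 2 + (r 1 + (s 2 + x)) = s 1 + (r 2 + (r 1 + x))" for x
    using srr[of "r 2 + (r 1 + x)"] r by (metis (no_types))
  have AB: "A + B = s 1 + (s 2 + (r 2 + r 1))"
  proof -
    have "A + B = s 1 + (r 1 + (r 2 + (s 1 + (r 1 + r 2))))" by (simp add: A B add.assoc)
    also have "\<dots> = s 1 + (s 2 + (r 1 + (r 2 + (r 1 + r 2))))" by (simp only: srr)
    also have "r 1 + (r 2 + (r 1 + r 2)) = r 2 + r 1" using rr[of "r 2"] r(2)[of 0] r12 r by simp
    finally show ?thesis .
  qed
  have BA: "B + A = s 1 + (s 2 + (r 2 + r 1))"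
  proof -
    have "B + A = r 2 + (s 1 + (r 1 + (r 2 + (s 1 + r 1))))" by (simp add: A B add.assoc)
    also have "\<dots> = r 2 + (s 1 + (s 2 + (r 1 + (r 2 + r 1))))" by (simp only: srr)
    also have "\<dots> = s 1 + (s 2 + (r 1 + (r 1 + (r 2 + r 1))))" by (simp only: rss)
    finally show ?thesis by (simp only: r)
  qed
  show "A + B = B + A" using AB BA by simp
  have "A + B + C = s 1 + (s 2 + (r 2 + (r 1 + (s 2 + r 2))))" by (simp add: AB C add.assoc)
  also have "\<dots> = s 1 + (s 2 + (s 1 + (r 2 + (r 1 + r 2))))" by (simp only: rsr)
  also have "\<dots> = s 2 + (s 1 + (s 2 + (r 2 + (r 1 + r 2))))" by (simp only: sss)
  finally have L: "A + B + C = s 2 + (s 1 + (s 2 + (r 2 + (r 1 + r 2))))" .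
  have "C + (A + B) = s 2 + (r 2 + (s 1 + (s 2 + (r 2 + r 1))))" by (simp add: AB C add.assoc)
  also have "\<dots> = s 2 + (s 1 + (s 2 + (r 1 + (r 2 + r 1))))" by (simp only: rss)
  finally show "A + B + C = C + (A + B)" using L r12 by simp
qed

lemma conj_hom: "(g :: 'g) + x - g + (g + y - g) = g + (x + y) - g"
  by (simp add: add.assoc diff_conv_add_uminus del: add_uminus_conv_diff)

lemma twist_transport:
  assumes "distinct xs" "set xs \<subseteq> {1..n}"
  obtains g where "\<And>k l. \<lbrakk>k < length xs; l < length xs; k \<noteq> l\<rbrakk> \<Longrightarrow>
    twist (xs ! k) (xs ! l) = g + twist (Suc k) (Suc l) - g"
proof -
  obtain g p where gp: "(g, p) \<in> graph 1 n" "\<And>k. k < length xs \<Longrightarrow> app p (Suc k) = xs ! k"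
    using graph_prescribed[OF assms] by blast
  have "length xs \<le> n" using card_mono[OF _ assms(2)] distinct_card[OF assms(1)] by simp
  then have "twist (xs ! k) (xs ! l) = g + twist (Suc k) (Suc l) - g"
    if "k < length xs" "l < length xs" "k \<noteq> l" for k l
    using twist_conj[OF gp(1), of "Suc k" "Suc l"] gp(2) that by simp
  then show ?thesis using that by blast
qed

text \<open>McCool's relations for three indices: \<open>x\<^sub>i\<close> and \<open>x\<^sub>k\<close> can be conjugated by \<open>x\<^sub>j\<close> in either order, and
  conjugating both by \<open>x\<^sub>j\<close> commutes with conjugating one by the other.\<close>

lemma twist_commute_target:
  assumes "distinct [i, j, k]" "{i, j, k} \<subseteq> {1..n}"
  shows "twist i j + twist k j = twist k j + twist i j"
    and "twist i j + twist k j + twist k i = twist k i + (twist i j + twist k j)"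
proof -
  have n: "3 \<le> n" using card_mono[OF _ assms(2)] assms(1) by simp
  have l: "distinct [j, i, k]" "set [j, i, k] \<subseteq> {1..n}" using assms by auto
  from twist_transport[OF l]
  obtain g where g: "\<And>a b. \<lbrakk>a < length [j, i, k]; b < length [j, i, k]; a \<noteq> b\<rbrakk> \<Longrightarrow>
    twist ([j, i, k] ! a) ([j, i, k] ! b) = g + twist (Suc a) (Suc b) - g" by blast
  have "twist i j = g + twist 2 1 - g" "twist k j = g + twist 3 1 - g" "twist k i = g + twist 3 2 - g"
    using g[of 1 0] g[of 2 0] g[of 2 1] by (simp_all add: numeral_2_eq_2 numeral_3_eq_3)
  then show "twist i j + twist k j = twist k j + twist i j"
    "twist i j + twist k j + twist k i = twist k i + (twist i j + twist k j)"
    using twist_three[OF n] by (simp_all only: conj_hom)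
qed

lemma twist_commute_disjoint:
  assumes "distinct [i, j, k, l]" "{i, j, k, l} \<subseteq> {1..n}"
  shows "twist i j + twist k l = twist k l + twist i j"
proof -
  have n: "4 \<le> n" using card_mono[OF _ assms(2)] assms(1) by simp
  have d: "distinct [j, i, l, k]" "set [j, i, l, k] \<subseteq> {1..n}" using assms by auto
  from twist_transport[OF d]
  obtain g where g: "\<And>a b. \<lbrakk>a < length [j, i, l, k]; b < length [j, i, l, k]; a \<noteq> b\<rbrakk> \<Longrightarrow>
    twist ([j, i, l, k] ! a) ([j, i, l, k] ! b) = g + twist (Suc a) (Suc b) - g" by blast
  have *: "twist i j = g + twist 2 1 - g" "twist k l = g + twist 4 3 - g"
    using g[of 1 0] g[of 3 2] by (simp_all add: eval_nat_numeral)
  have "twist 2 1 = s 1 + r 1" "twist 4 3 = s 3 + r 3"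
    using twist_adjacent[of 1] twist_adjacent[of 3] n by (simp_all add: eval_nat_numeral)
  moreover have "s 1 + s 3 = s 3 + s 1" "r 1 + r 3 = r 3 + r 1" "s 1 + r 3 = r 3 + s 1" "s 3 + r 1 = r 1 + s 3"
    using s_commute[of 1 3] r_commute[of 1 3] sr_commute[of 1 3] sr_commute[of 3 1] n by auto
  ultimately have "twist 2 1 + twist 4 3 = twist 4 3 + twist 2 1"
    by (simp only:) (intro commute_add commute_add[symmetric]; simp)
  then show ?thesis using * by (simp only: conj_hom)
qed

end

section \<open>Tuples of lines\<close>

text \<open>A tuple records the images of the generators \<open>x\<^sub>1, \<dots>, x\<^sub>n\<close> under an endomorphism. Entries at other
  indices are carried along; the words of \<open>WB n\<close> do not change them.\<close>

type_synonym tuple = "nat \<Rightarrow> nat line"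

definition std_basis :: tuple where "std_basis k = (k, [])"

definition move :: "nat \<Rightarrow> nat \<Rightarrow> bool \<Rightarrow> tuple \<Rightarrow> tuple" where
  "move i j e Y = Y(i := lconj e (Y i) (Y j))"

text \<open>Composing an endomorphism with the automorphism of a generator of the welded braid group acts on its
  tuple of images from the right. Here \<open>\<rho>\<^sub>i\<close> exchanges \<open>x\<^sub>i\<close> and \<open>x\<^sub>i\<^sub>+\<^sub>1\<close>, while \<open>\<sigma>\<^sub>i\<close> maps \<open>x\<^sub>i\<close> to
  \<open>x\<^sub>i\<^sub>+\<^sub>1 * x\<^sub>i\<close> and \<open>x\<^sub>i\<^sub>+\<^sub>1\<close> to \<open>x\<^sub>i\<close>. The opposite choice \<open>x\<^sub>i \<mapsto> x\<^sub>i\<^sub>+\<^sub>1\<close>,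
  \<open>x\<^sub>i\<^sub>+\<^sub>1 \<mapsto> x\<^sub>i * x\<^sub>i\<^sub>+\<^sub>1\<close> would satisfy the braid relation but violate
  \<open>\<sigma>\<^sub>i \<sigma>\<^sub>i\<^sub>+\<^sub>1 \<rho>\<^sub>i = \<rho>\<^sub>i\<^sub>+\<^sub>1 \<sigma>\<^sub>i \<sigma>\<^sub>i\<^sub>+\<^sub>1\<close>.\<close>

fun letter_act :: "welded_gen \<times> bool \<Rightarrow> tuple \<Rightarrow> tuple" where
  "letter_act (Rho i, b) Y = Y \<circ> transpose i (Suc i)"
| "letter_act (Sig i, True) Y = move (Suc i) i True Y \<circ> transpose i (Suc i)"
| "letter_act (Sig i, False) Y = move (Suc i) i False (Y \<circ> transpose i (Suc i))"

definition word_act :: "welded_gen gword \<Rightarrow> tuple \<Rightarrow> tuple" where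
  "word_act w = fold letter_act w"

lemma word_act_simps [simp]: "word_act [] Y = Y" "word_act (c # w) Y = word_act w (letter_act c Y)"
  "word_act (v @ w) Y = word_act w (word_act v Y)"
  by (simp_all add: word_act_def)

lemma move_cancel: "\<lbrakk>is_line (Y i); i \<noteq> j\<rbrakk> \<Longrightarrow> move i j (\<not> e) (move i j e Y) = Y"
  by (simp add: move_def lconj_cancel)

lemma move_cancel': "\<lbrakk>is_line (Y i); i \<noteq> j\<rbrakk> \<Longrightarrow> move i j e (move i j (\<not> e) Y) = Y"
  using move_cancel[of Y i j "\<not> e"] by simp

lemma move_is_line: "(\<And>k. is_line (Y k)) \<Longrightarrow> is_line (move i j e Y k)"
  by (simp add: move_def)

lemma letter_act_is_line: "(\<And>k. is_line (Y k)) \<Longrightarrow> is_line (letter_act c Y k)"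
  by (cases "(c, Y)" rule: letter_act.cases) (simp_all add: move_is_line)

lemma word_act_is_line: "(\<And>k. is_line (Y k)) \<Longrightarrow> is_line (word_act w Y k)"
  by (induction w arbitrary: Y) (simp_all add: letter_act_is_line)

lemma std_is_line: "is_line (std_basis k)"
  by (simp add: std_basis_def)

lemma letter_act_cancel:
  assumes "\<And>k. is_line (Y k)"
  shows "letter_act (flip c) (letter_act c Y) = Y"
  using assms move_cancel[of Y _ _ True] move_cancel[of "Y \<circ> _" _ _ False]
  by (cases "(c, Y)" rule: letter_act.cases) (simp_all add: comp_assoc)

definition winv :: "'g gword \<Rightarrow> 'g gword" where
  "winv w = rev (map flip w)"

lemma winv_gwords [simp]: "winv w \<in> gwords S \<longleftrightarrow> w \<in> gwords S"
  by (auto simp: winv_def gwords_iff image_image)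

lemma word_act_winv:
  assumes "\<And>k. is_line (Y k)"
  shows "word_act (winv w) (word_act w Y) = Y"
  using assms
  by (induction w arbitrary: Y) (simp_all add: winv_def letter_act_is_line letter_act_cancel)

lemma winv_winv [simp]: "winv (winv w) = w"
  by (simp add: winv_def rev_map o_def)

lemma letter_act_sig: "letter_act (Sig i, True) Y =
    (\<lambda>k. if k = i then lconj True (Y (Suc i)) (Y i) else if k = Suc i then Y i else Y k)"
  by (auto simp: move_def transpose_def)

lemma letter_act_rho: "letter_act (Rho i, b) Y =
    (\<lambda>k. if k = i then Y (Suc i) else if k = Suc i then Y i else Y k)"
  by (auto simp: transpose_def)

text \<open>Only the braid relation for the \<open>\<sigma>\<^sub>i\<close> uses the structure of a quandle, namely self-distributivity; all
  others move entries about.\<close>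

lemma word_act_relation:
  assumes "(v, w) \<in> welded_rels n" "\<And>k. is_line (Y k)"
  shows "word_act v Y = word_act w Y"
proof -
  have "lconj True (lconj True (Y i) (Y j)) (Y k)
      = lconj True (lconj True (Y i) (Y k)) (lconj True (Y j) (Y k))" for i j k
    by (rule lconj_distrib[OF assms(2,2)])
  then show ?thesis using assms(1)
    by (auto simp: welded_rels_def fun_eq_iff letter_act_sig letter_act_rho simp del: letter_act.simps)
qed

lemma word_act_presentation:
  assumes "(v, w) \<in> presentation_rel S (welded_rels n)" "\<And>k. is_line (Y k)"
  shows "word_act v Y = word_act w Y"
  using assms
proof (induction arbitrary: Y rule: presentation_rel.induct)
  case (cong v v' w w')
  then show ?case by (simp add: word_act_is_line)
next
  case (cancel g b)
  then show ?case using letter_act_cancel[of Y "(g, b)"] by simp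
next
  case (relation l r)
  then show ?case using word_act_relation by blast
qed auto

section \<open>Bases of the free quandle\<close>

locale tuples =
  fixes n :: nat
  assumes n_pos: "1 \<le> n"
begin

abbreviation FL :: "nat line qstruct" where "FL \<equiv> line_quandle {1..n}"
abbreviation L :: "nat line set" where "L \<equiv> carrier FL"

sublocale FL: quandle FL
  using n_pos by (intro quandle_line_quandle) auto

lemma FL_qpow: "\<lbrakk>x \<in> L; y \<in> L\<rbrakk> \<Longrightarrow> qpow FL e x y = lconj e x y"
  by (rule qpow_line_quandle)

text \<open>An operation on tuples that commutes with every endomorphism \<open>\<phi>\<close> comes from composing with a fixed
  endomorphism, the one whose tuple is its value at the standard basis. The auxiliary tuple \<open>Z\<close> makes the
  condition independent of the entries outside \<open>{1..n}\<close>.\<close>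

definition natural :: "(tuple \<Rightarrow> tuple) \<Rightarrow> bool" where
  "natural T \<longleftrightarrow> (\<forall>Y \<in> {1..n} \<rightarrow> L. T Y \<in> {1..n} \<rightarrow> L \<and>
     (\<forall>\<phi>\<in>qhom FL FL. \<forall>Z. (\<forall>k\<in>{1..n}. Z k = \<phi> (Y k)) \<longrightarrow> (\<forall>k\<in>{1..n}. T Z k = \<phi> (T Y k))))"

lemma naturalD:
  assumes "natural T" "Y \<in> {1..n} \<rightarrow> L"
  shows "T Y \<in> {1..n} \<rightarrow> L"
    and "\<lbrakk>\<phi> \<in> qhom FL FL; \<And>k. k \<in> {1..n} \<Longrightarrow> Z k = \<phi> (Y k); k \<in> {1..n}\<rbrakk> \<Longrightarrow> T Z k = \<phi> (T Y k)"
  using assms unfolding natural_def by blast+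

lemma natural_id: "natural (\<lambda>Y. Y)"
  by (simp add: natural_def)

lemma natural_comp:
  assumes "natural T" "natural U"
  shows "natural (\<lambda>Y. T (U Y))"
  unfolding natural_def
proof (intro ballI conjI allI impI)
  fix Y assume Y: "Y \<in> {1..n} \<rightarrow> L"
  note U = naturalD[OF assms(2) Y]
  show "T (U Y) \<in> {1..n} \<rightarrow> L" using naturalD(1)[OF assms(1) U(1)] .
  fix \<phi> Z k assume "\<phi> \<in> qhom FL FL" "\<forall>k\<in>{1..n}. Z k = \<phi> (Y k)" "k \<in> {1..n}"
  then show "T (U Z) k = \<phi> (T (U Y) k)"
    using naturalD(2)[OF assms(1) U(1)] U(2) by simp
qed

lemma natural_move:
  assumes "i \<in> {1..n}" "j \<in> {1..n}"
  shows "natural (move i j e)"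
  unfolding natural_def
proof (intro ballI conjI allI impI)
  fix Y assume Y: "Y \<in> {1..n} \<rightarrow> L"
  then have c: "Y i \<in> L" "Y j \<in> L" using assms by auto
  show "move i j e Y \<in> {1..n} \<rightarrow> L" using Y lconj_carrier[OF c] by (simp add: move_def Pi_iff)
  fix \<phi> Z k assume h: "\<phi> \<in> qhom FL FL" "\<forall>k\<in>{1..n}. Z k = \<phi> (Y k)" "k \<in> {1..n}"
  have "\<phi> (lconj e (Y i) (Y j)) = lconj e (\<phi> (Y i)) (\<phi> (Y j))"
    using qhom_qpow[OF FL.quandle_axioms FL.quandle_axioms h(1) c, of e] FL_qpow[OF c]
      FL_qpow[OF qhom_closed[OF h(1) c(1)] qhom_closed[OF h(1) c(2)]] by simp
  then show "move i j e Z k = \<phi> (move i j e Y k)" using h assms by (simp add: move_def)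
qed

lemma natural_swap:
  assumes "1 \<le> i" "i < n"
  shows "natural (\<lambda>Y. Y \<circ> transpose i (Suc i))"
proof -
  have "transpose i (Suc i) k \<in> {1..n}" if "k \<in> {1..n}" for k
    using that assms by (auto simp: transpose_def)
  then show ?thesis unfolding natural_def by (auto simp del: atLeastAtMost_iff)
qed

lemma letter_index:
  assumes "c \<in> welded_gens n \<times> UNIV"
  obtains i b where "1 \<le> i" "i < n" "c = (Rho i, b) \<or> c = (Sig i, True) \<or> c = (Sig i, False)"
  using assms by (auto simp: welded_gens_def)

lemma natural_letter:
  assumes "c \<in> welded_gens n \<times> UNIV"
  shows "natural (letter_act c)"
proof -
  from letter_index[OF assms] obtain i b where
    i: "1 \<le> i" "i < n" "c = (Rho i, b) \<or> c = (Sig i, True) \<or> c = (Sig i, False)" by metis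
  note s = natural_swap[OF i(1,2)]
  have m: "natural (move (Suc i) i e)" for e using i by (intro natural_move) auto
  from i(3) consider "letter_act c = (\<lambda>Y. Y \<circ> transpose i (Suc i))"
    | "letter_act c = (\<lambda>Y. move (Suc i) i True Y \<circ> transpose i (Suc i))"
    | "letter_act c = (\<lambda>Y. move (Suc i) i False (Y \<circ> transpose i (Suc i)))"
    by fastforce
  then show ?thesis
    using s natural_comp[OF s m[of True]] natural_comp[OF m[of False] s] by cases simp_all
qed

lemma natural_word: "w \<in> gwords (welded_gens n) \<Longrightarrow> natural (word_act w)"
proof (induction w)
  case Nil
  then show ?case using natural_id by (simp add: word_act_def id_def)
next
  case (Cons c w)
  then have c: "natural (letter_act c)" and w: "natural (word_act w)"
    using natural_letter by (auto simp: gwords_def)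
  show ?case using natural_comp[OF w c] by (simp add: word_act_def comp_def)
qed

lemma std_carrier: "std_basis \<in> {1..n} \<rightarrow> L"
  by (rule Pi_I) (simp only: std_basis_def core_carrier)

definition endo :: "tuple \<Rightarrow> nat line \<Rightarrow> nat line" where
  "endo Y = restrict (lift FL Y) L"

lemma endo_qhom: "Y \<in> {1..n} \<rightarrow> L \<Longrightarrow> endo Y \<in> qhom FL FL"
  using FL.lift_qhom[of Y "{1..n}"] by (simp add: endo_def qhom_def lconj_carrier Pi_iff)

lemma endo_std: "k \<in> {1..n} \<Longrightarrow> endo Y (std_basis k) = Y k"
  using core_carrier[of k "{1..n}"] by (simp add: endo_def std_basis_def)

lemma endo_natural:
  assumes "natural T" "Y \<in> {1..n} \<rightarrow> L" "k \<in> {1..n}"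
  shows "endo Y (T std_basis k) = T Y k"
  using naturalD(2)[OF assms(1) std_carrier endo_qhom[OF assms(2)], of Y k] assms(3) endo_std[of _ Y]
  by simp

lemma hom_eqI:
  assumes "\<phi> \<in> qhom FL FL" "\<psi> \<in> qhom FL FL" "\<And>k. k \<in> {1..n} \<Longrightarrow> \<phi> (std_basis k) = \<psi> (std_basis k)" "x \<in> L"
  shows "\<phi> x = \<psi> x"
  using line_hom_eq[OF FL.quandle_axioms assms(1,2) _ assms(4)] assms(3) by (simp add: std_basis_def)

lemma endo_endo:
  assumes "natural T" "Y \<in> {1..n} \<rightarrow> L" "x \<in> L"
  shows "endo Y (endo (T std_basis) x) = endo (T Y) x"
proof -
  note T = naturalD(1)[OF assms(1) std_carrier] and TY = naturalD(1)[OF assms(1,2)]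
  have "(endo Y \<circ> endo (T std_basis)) (std_basis k) = endo (T Y) (std_basis k)" if "k \<in> {1..n}" for k
    using endo_std[OF that] endo_natural[OF assms(1,2) that] by simp
  from hom_eqI[OF qhom_compose[OF endo_qhom[OF assms(2)] endo_qhom[OF T]] endo_qhom[OF TY] this assms(3)]
  show ?thesis by simp
qed

lemma endo_std_id: "x \<in> L \<Longrightarrow> endo std_basis x = x"
  using hom_eqI[OF endo_qhom[OF std_carrier], of "\<lambda>x. x"] endo_std by (simp add: qhom_def)

lemma endo_cong:
  assumes "\<And>k. k \<in> {1..n} \<Longrightarrow> Y k = Z k" "Y \<in> {1..n} \<rightarrow> L"
  shows "endo Y = endo Z"
proof (rule extensionalityI[of _ L])
  have Z: "Z \<in> {1..n} \<rightarrow> L" 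
  proof (rule Pi_I)
    fix k assume k: "k \<in> {1..n}"
    then have "Y k \<in> L" using assms(2) by (rule Pi_mem[rotated])
    then show "Z k \<in> L" using assms(1)[OF k] by simp
  qed
  show "endo Y x = endo Z x" if "x \<in> L" for x
    using hom_eqI[OF endo_qhom[OF assms(2)] endo_qhom[OF Z] _ that] assms(1) endo_std by simp
qed (simp_all add: endo_def)

lemma endo_auto:
  assumes "natural T" "natural U"
    and TU: "\<And>k. k \<in> {1..n} \<Longrightarrow> T (U std_basis) k = std_basis k" and UT: "\<And>k. k \<in> {1..n} \<Longrightarrow> U (T std_basis) k = std_basis k"
  shows "endo (T std_basis) \<in> qauto FL"
proof -
  note t = naturalD(1)[OF assms(1) std_carrier] and u = naturalD(1)[OF assms(2) std_carrier]
  have id: "endo (T (U std_basis)) = endo std_basis" "endo (U (T std_basis)) = endo std_basis"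
    using endo_cong[of std_basis] TU UT std_carrier by metis+
  have "bij_betw (endo (T std_basis)) L L"
  proof (rule bij_betwI[where g = "endo (U std_basis)"])
    show "endo (T std_basis) \<in> L \<rightarrow> L" "endo (U std_basis) \<in> L \<rightarrow> L"
      using qhom_closed[OF endo_qhom[OF t]] qhom_closed[OF endo_qhom[OF u]] by auto
    show "endo (U std_basis) (endo (T std_basis) x) = x" if "x \<in> L" for x
      using endo_endo[OF assms(1) u that] id endo_std_id[OF that] by simp
    show "endo (T std_basis) (endo (U std_basis) x) = x" if "x \<in> L" for x
      using endo_endo[OF assms(2) t that] id endo_std_id[OF that] by simp
  qed
  then show ?thesis using endo_qhom[OF t] by (auto simp: qauto_def Bij_def endo_def)
qed

lemma endo_word_auto:
  assumes "w \<in> gwords (welded_gens n)"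
  shows "endo (word_act w std_basis) \<in> qauto FL"
  using assms word_act_winv[of std_basis w] word_act_winv[of std_basis "winv w"] std_is_line
  by (intro endo_auto[where U = "word_act (winv w)"] natural_word) auto

lemma endo_append:
  assumes "v \<in> gwords (welded_gens n)" "w \<in> gwords (welded_gens n)"
  shows "endo (word_act (v @ w) std_basis) = compose L (endo (word_act v std_basis)) (endo (word_act w std_basis))"
proof (rule extensionalityI[of _ L])
  fix x assume "x \<in> L"
  then show "endo (word_act (v @ w) std_basis) x
      = compose L (endo (word_act v std_basis)) (endo (word_act w std_basis)) x"
    using endo_endo[OF natural_word[OF assms(2)] naturalD(1)[OF natural_word[OF assms(1)] std_carrier]]
    by (simp add: compose_eq)
qed (simp_all add: endo_def)

text \<open>The free bases of the quandle, which stand for its automorphisms in Nielsen's theory.\<close>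

definition basis :: "tuple \<Rightarrow> bool" where
  "basis Y \<longleftrightarrow> Y \<in> {1..n} \<rightarrow> L \<and> endo Y \<in> qauto FL"

lemma basis_std: "basis std_basis"
  using endo_auto[OF natural_id natural_id] std_carrier by (simp add: basis_def)

lemma basis_in: "\<lbrakk>basis Y; k \<in> {1..n}\<rbrakk> \<Longrightarrow> Y k \<in> L"
  by (auto simp: basis_def)

lemma basis_line: "\<lbrakk>basis Y; k \<in> {1..n}\<rbrakk> \<Longrightarrow> is_line (Y k)"
  using basis_in lines_are_lines by blast

lemma basis_inj:
  assumes "basis Y" "i \<in> {1..n}" "j \<in> {1..n}" "Y i = Y j"
  shows "i = j"
proof -
  have "inj_on (endo Y) L" using assms(1) by (auto simp: basis_def qauto_def Bij_def bij_betw_def)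
  moreover have "endo Y (std_basis i) = endo Y (std_basis j)" using assms endo_std by simp
  moreover have "std_basis i \<in> L" "std_basis j \<in> L" using std_carrier assms by auto
  ultimately have "std_basis i = std_basis j" by (auto dest: inj_onD)
  then show ?thesis by (simp add: std_basis_def)
qed

lemma basis_natural:
  assumes "basis Y" "endo (T std_basis) \<in> qauto FL" "natural T"
  shows "basis (T Y)"
proof -
  have Y: "Y \<in> {1..n} \<rightarrow> L" and a: "endo Y \<in> qauto FL" using assms(1) by (auto simp: basis_def)
  note TY = naturalD(1)[OF assms(3) Y]
  have "bij_betw (endo Y \<circ> endo (T std_basis)) L L"
    using a assms(2) by (auto simp: qauto_def Bij_def intro: bij_betw_trans)
  moreover have "(endo Y \<circ> endo (T std_basis)) x = endo (T Y) x" if "x \<in> L" for x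
    using endo_endo[OF assms(3) Y that] by simp
  ultimately have "bij_betw (endo (T Y)) L L"
    using bij_betw_cong[of L "endo Y \<circ> endo (T std_basis)" "endo (T Y)" L] by blast
  then show ?thesis using TY endo_qhom[OF TY] by (auto simp: basis_def qauto_def Bij_def endo_def)
qed

lemma basis_move:
  assumes "basis Y" "i \<in> {1..n}" "j \<in> {1..n}" "i \<noteq> j"
  shows "basis (move i j e Y)"
proof (rule basis_natural[OF assms(1) endo_auto])
  show "natural (move i j e)" "natural (move i j (\<not> e))" using natural_move assms by blast+
  then show "natural (move i j e)" by simp
  show "move i j e (move i j (\<not> e) std_basis) k = std_basis k" "move i j (\<not> e) (move i j e std_basis) k = std_basis k" for k
    using move_cancel[of std_basis i j e] move_cancel'[of std_basis i j e] std_is_line assms(4) by simp_all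
qed

lemma basis_swap:
  assumes "basis Y" "1 \<le> i" "i < n"
  shows "basis (Y \<circ> transpose i (Suc i))"
proof -
  note N = natural_swap[OF assms(2,3)]
  have "endo (std_basis \<circ> transpose i (Suc i)) \<in> qauto FL"
    by (rule endo_auto[OF N N]) (simp_all add: comp_assoc)
  from basis_natural[OF assms(1) this N] show ?thesis .
qed

end

section \<open>Length reduction\<close>

context tuples
begin

text \<open>The condition of the cancellation estimate: the move shortens the tuple exactly in this case.\<close>

definition reducible :: "tuple \<Rightarrow> nat \<Rightarrow> nat \<Rightarrow> bool \<Rightarrow> bool" where
  "reducible Y i j e \<longleftrightarrow> prefix (snd (Y j) @ [(fst (Y j), \<not> e)]) (snd (Y i))"

definition size_of :: "tuple \<Rightarrow> nat" where
  "size_of Y = (\<Sum>i\<in>{1..n}. length (snd (Y i)))"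

lemma size_upd:
  assumes "i \<in> {1..n}"
  shows "size_of (Y(i := x)) + length (snd (Y i)) = size_of Y + length (snd x)"
proof -
  have "size_of (Y(i := x)) = length (snd x) + (\<Sum>k\<in>{1..n} - {i}. length (snd ((Y(i := x)) k)))"
    using assms sum.remove[of "{1..n}" i "\<lambda>k. length (snd ((Y(i := x)) k))"] by (simp add: size_of_def)
  moreover have "(\<Sum>k\<in>{1..n} - {i}. length (snd ((Y(i := x)) k))) = (\<Sum>k\<in>{1..n} - {i}. length (snd (Y k)))"
    by (intro sum.cong) auto
  moreover have "size_of Y = length (snd (Y i)) + (\<Sum>k\<in>{1..n} - {i}. length (snd (Y k)))"
    using assms sum.remove[of "{1..n}" i "\<lambda>k. length (snd (Y k))"] by (simp add: size_of_def)
  ultimately show ?thesis by simp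
qed

lemma size_move:
  assumes "basis Y" "i \<in> {1..n}" "j \<in> {1..n}" "i \<noteq> j"
  shows "reducible Y i j e \<Longrightarrow> size_of (move i j e Y) < size_of Y"
    and "\<not> reducible Y i j e \<Longrightarrow> size_of Y < size_of (move i j e Y)"
proof -
  have l: "is_line (Y i)" "is_line (Y j)" "Y i \<noteq> Y j"
    using assms basis_line basis_inj by blast+
  note u = size_upd[OF assms(2), of Y "lconj e (Y i) (Y j)"]
  show "reducible Y i j e \<Longrightarrow> size_of (move i j e Y) < size_of Y"
    using length_lconj_less[OF l(1), of "Y j" e] u by (simp add: reducible_def move_def)
  show "\<not> reducible Y i j e \<Longrightarrow> size_of Y < size_of (move i j e Y)"
    using length_lconj_greater[OF l, of e] u by (simp add: reducible_def move_def)
qed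

text \<open>Nielsen's argument. In a reduced word in the members of an irreducible basis the core letter of every
  factor survives: a cancellation between neighbouring factors that reached a core letter would make one
  of them reducible by the other.\<close>

lemma irreducible_lift:
  assumes Y: "basis Y"
    and irr: "\<And>i j e. \<lbrakk>i \<in> {1..n}; j \<in> {1..n}; i \<noteq> j\<rbrakk> \<Longrightarrow> \<not> reducible Y i j e"
    and "(j, a # w) \<in> L"
  shows "prefix (snd (Y (fst a)) @ [(fst (Y (fst a)), snd a)]) (snd (lift FL Y (j, a # w)))"
  using assms(3)
proof (induction w arbitrary: a)
  case Nil
  then have a: "fst a \<in> {1..n}" "j \<in> {1..n}" "fst a \<noteq> j"
    by (auto simp: carrier_line_quandle gwords_iff)
  have "lift FL Y (j, [a]) = lconj (snd a) (Y j) (Y (fst a))"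
    using FL_qpow[OF basis_in[OF Y a(2)] basis_in[OF Y a(1)]] by (simp add: lift_Cons)
  moreover have "Y j \<noteq> Y (fst a)" using basis_inj[OF Y a(2,1)] a(3) by blast
  ultimately show ?case
    using snd_lconj[OF basis_line[OF Y a(2)] basis_line[OF Y a(1)], of "snd a"]
      irr[of j "fst a" "snd a"] a by (auto simp: reducible_def prefix_def)
next
  case (Cons b w)
  let ?u = "lift FL Y (j, b # w)"
  have YL: "Y \<in> {1..n} \<rightarrow> L" using Y by (simp add: basis_def)
  have bw: "(j, b # w) \<in> L" using line_ConsD(1)[OF Cons.prems] .
  have a: "fst a \<in> {1..n}" and b: "fst b \<in> {1..n}" and ab: "b \<noteq> flip a"
    using Cons.prems by (auto simp: carrier_line_quandle gwords_iff)
  let ?A = "Y (fst a)" and ?B = "Y (fst b)"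
  have u: "?u \<in> L" by (rule FL.lift_closed[OF YL bw])
  have pu: "prefix (snd ?B @ [(fst ?B, snd b)]) (snd ?u)" by (rule Cons.IH[OF bw])
  have irr': "\<not> prefix (snd (Y k) @ [(fst (Y k), e)]) (snd (Y i))"
    if "i \<in> {1..n}" "k \<in> {1..n}" "i \<noteq> k" for i k e
    using irr[OF that, of "\<not> e"] by (simp add: reducible_def)
  have 1: "?u \<noteq> ?A"
  proof
    assume "?u = ?A"
    then have "prefix (snd ?B @ [(fst ?B, snd b)]) (snd ?A)" using pu by simp
    then show False using irr'[OF a b, of "snd b"] by (cases "fst a = fst b") (auto simp: prefix_def)
  qed
  have 2: "\<not> prefix (snd ?A @ [(fst ?A, \<not> snd a)]) (snd ?u)"
  proof
    assume pa: "prefix (snd ?A @ [(fst ?A, \<not> snd a)]) (snd ?u)"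
    show False
    proof (cases "fst a = fst b")
      case True
      then have "(fst ?A, \<not> snd a) = (fst ?B, snd b)" using pa pu by (auto simp: prefix_def)
      then show False using ab True by (simp add: flip_def prod_eq_iff)
    next
      case False
      consider "length (snd ?A) < length (snd ?B)" | "length (snd ?B) < length (snd ?A)"
        | "length (snd ?A) = length (snd ?B)" by linarith
      then show False
      proof cases
        case 1
        then have "prefix (snd ?A @ [(fst ?A, \<not> snd a)]) (snd ?B)"
          using pa pu prefix_length_prefix[OF pa, of "snd ?B"] by (auto dest: append_prefixD)
        then show False using irr'[OF b a] False by metis
      next
        case 2
        then have "prefix (snd ?B @ [(fst ?B, snd b)]) (snd ?A)"
          using pa pu prefix_length_prefix[OF pu, of "snd ?A"] by (auto dest: append_prefixD)
        then show False using irr'[OF a b] False by metis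
      next
        case 3
        then have "?A = ?B" using pa pu by (auto simp: prefix_def prod_eq_iff)
        then show False using basis_inj[OF Y a b] False by blast
      qed
    qed
  qed
  have "lift FL Y (j, a # b # w) = lconj (snd a) ?u ?A"
    using FL_qpow[OF u basis_in[OF Y a]] by (simp add: lift_Cons)
  then show ?case
    using snd_lconj[OF lines_are_lines[OF u] basis_line[OF Y a] 1 2] by (simp add: prefix_def)
qed

text \<open>Every generator is a reduced word in the members of the basis. By the preceding lemma a nontrivial word
  has a nonempty tail, so the generator itself belongs to the basis.\<close>

theorem irreducible_basis:
  assumes Y: "basis Y"
    and irr: "\<And>i j e. \<lbrakk>i \<in> {1..n}; j \<in> {1..n}; i \<noteq> j\<rbrakk> \<Longrightarrow> \<not> reducible Y i j e"
  shows "\<exists>\<pi>. \<pi> permutes {1..n} \<and> (\<forall>k\<in>{1..n}. Y k = std_basis (\<pi> k))"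
proof -
  have ex: "\<exists>j\<in>{1..n}. Y j = std_basis k" if k: "k \<in> {1..n}" for k
  proof -
    have "std_basis k \<in> L" using std_carrier k by auto
    moreover have "bij_betw (endo Y) L L" using Y by (auto simp: basis_def qauto_def Bij_def)
    ultimately obtain z where z: "z \<in> L" "endo Y z = std_basis k" by (metis bij_betw_def imageE)
    obtain j w where jw: "z = (j, w)" by (cases z)
    have e: "lift FL Y (j, w) = std_basis k" using z jw by (simp add: endo_def)
    show ?thesis
    proof (cases w)
      case Nil
      then show ?thesis using e z jw by (auto simp: carrier_line_quandle)
    next
      case (Cons a u)
      then have "snd (std_basis k) \<noteq> []" using irreducible_lift[OF Y irr, of j a u] z jw e by auto
      then show ?thesis by (simp add: std_basis_def)
    qed
  qed
  then obtain g where g: "\<And>k. k \<in> {1..n} \<Longrightarrow> g k \<in> {1..n} \<and> Y (g k) = std_basis k" by metis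
  have "inj_on g {1..n}" using g by (intro inj_onI) (metis fst_conv std_basis_def)
  then have gb: "bij_betw g {1..n} {1..n}"
    using endo_inj_surj[of "{1..n}" g] g by (simp add: bij_betw_def image_subset_iff)
  define \<pi> where "\<pi> k = (if k \<in> {1..n} then inv_into {1..n} g k else k)" for k
  have "bij_betw \<pi> {1..n} {1..n} \<longleftrightarrow> bij_betw (inv_into {1..n} g) {1..n} {1..n}"
    by (rule bij_betw_cong) (simp add: \<pi>_def)
  then have "bij_betw \<pi> {1..n} {1..n}" using bij_betw_inv_into[OF gb] by blast
  then have "\<pi> permutes {1..n}"
    by (rule bij_imp_permutes) (auto simp: \<pi>_def)
  moreover have "Y k = std_basis (\<pi> k)" if "k \<in> {1..n}" for k
    using g[of "inv_into {1..n} g k"] bij_betw_inv_into_right[OF gb that]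
      bij_betw_inv_into[OF gb] that by (auto simp: \<pi>_def dest: bij_betwE)
  ultimately show ?thesis by blast
qed

end

section \<open>Peak reduction\<close>

lemma terminal_exists:
  fixes m :: "'a \<Rightarrow> nat"
  shows "\<exists>c. (\<lambda>u v. E u v \<and> m v < m u)\<^sup>*\<^sup>* u c \<and> (\<nexists>d. E c d \<and> m d < m c)"
proof (induction "m u" arbitrary: u rule: less_induct)
  case less
  show ?case
  proof (cases "\<exists>v. E u v \<and> m v < m u")
    case True
    then obtain v where v: "E u v \<and> m v < m u" by blast
    obtain c where c: "(\<lambda>u v. E u v \<and> m v < m u)\<^sup>*\<^sup>* v c" "\<nexists>d. E c d \<and> m d < m c"
      using less v by blast
    then show ?thesis using converse_rtranclp_into_rtranclp[of "\<lambda>u v. E u v \<and> m v < m u", OF v] by blast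
  qed blast
qed

text \<open>Newman's lemma in the form of Winkler and Buchberger, for a symmetric relation whose steps all change the
  measure. Along a path below \<open>y\<close> the terminal descendant is unique by induction, and it does not change
  from one vertex to the next because one of the two descends to the other.\<close>

lemma peak_reduction:
  fixes E :: "'a \<Rightarrow> 'a \<Rightarrow> bool" and m :: "'a \<Rightarrow> nat"
  assumes sym: "\<And>u v. E u v \<Longrightarrow> E v u" and level: "\<And>u v. E u v \<Longrightarrow> m u \<noteq> m v"
    and peak: "\<And>y a b. \<lbrakk>E y a; E y b; m a < m y; m b < m y\<rbrakk>
      \<Longrightarrow> (\<lambda>u v. E u v \<and> m u < m y \<and> m v < m y)\<^sup>*\<^sup>* a b"
  defines "D \<equiv> \<lambda>u v. E u v \<and> m v < m u"
  assumes "D\<^sup>*\<^sup>* y a" "D\<^sup>*\<^sup>* y b" "\<nexists>c. D a c" "\<nexists>c. D b c"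
  shows "a = b"
proof -
  have nf: "\<exists>c. D\<^sup>*\<^sup>* u c \<and> (\<nexists>d. D c d)" for u
    unfolding D_def by (rule terminal_exists)
  show ?thesis
    using assms(5-8)
  proof (induction "m y" arbitrary: y a b rule: less_induct)
    case less
    show ?case
    proof (cases "y = a \<or> y = b")
      case True
      then show ?thesis using less.prems by (metis converse_rtranclpE)
    next
      case False
      then obtain a1 b1 where a1: "D y a1" "D\<^sup>*\<^sup>* a1 a" and b1: "D y b1" "D\<^sup>*\<^sup>* b1 b"
        using less.prems(1,2) by (metis converse_rtranclpE)
      have "(\<lambda>u v. E u v \<and> m u < m y \<and> m v < m y)\<^sup>*\<^sup>* a1 b1"
        using peak a1(1) b1(1) by (simp add: D_def)
      then have "\<forall>c. D\<^sup>*\<^sup>* b1 c \<and> (\<nexists>d. D c d) \<longrightarrow> c = a"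
      proof (induction rule: rtranclp_induct)
        case base
        have "m a1 < m y" using a1(1) by (simp add: D_def)
        then show ?case using less.hyps[OF _ _ a1(2) _ less.prems(3)] by blast
      next
        case (step u v)
        show ?case
        proof (cases "m v < m u")
          case True
          then have "D u v" using step(2) by (simp add: D_def)
          then show ?thesis using step.IH by (meson converse_rtranclp_into_rtranclp)
        next
          case False
          then have Dvu: "D v u" using step(2) level[of u v] sym[of u v] by (auto simp: D_def)
          obtain c0 where c0: "D\<^sup>*\<^sup>* u c0" "\<nexists>d. D c0 d" using nf by blast
          then have "c0 = a" using step.IH by blast
          then have "D\<^sup>*\<^sup>* v a" using Dvu c0(1) by (meson converse_rtranclp_into_rtranclp)
          then show ?thesis using less.hyps[of v] step(2) less.prems(3) by blast
        qed
      qed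
      then show ?thesis using b1(2) less.prems(4) by blast
    qed
  qed
qed

text \<open>If \<open>x\<close> is shortened by \<open>y\<close> and \<open>y\<close> by \<open>z\<close>, the tail of \<open>z\<close> is an initial part of the tail of \<open>y\<close>, which is
  an initial part of the tail of \<open>x\<close>. Two core letters then drop out of the tail of \<open>x\<close>. The estimate of the
  length holds even if further letters cancel, which is why the hexagon below stays short without any
  assumption on its individual edges.\<close>

lemma nested_reduction:
  assumes "is_line x" "is_line y" "is_line z"
    and xy: "prefix (snd y @ [(fst y, \<not> d)]) (snd x)"
    and yz: "prefix (snd z @ [(fst z, \<not> e)]) (snd y)"
  shows "prefix (snd z @ [(fst z, \<not> e)]) (snd x)"
    and "length (snd (lconj e (lconj d x y) z)) < length (snd x)"
proof -
  obtain q where q: "snd y = snd z @ (fst z, \<not> e) # q" using yz by (auto simp: prefix_def)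
  obtain k where k: "snd x = snd y @ (fst y, \<not> d) # k" using xy by (auto simp: prefix_def)
  show "prefix (snd z @ [(fst z, \<not> e)]) (snd x)" using q k by (auto simp: prefix_def)
  have redx: "reduced (fst x) (snd z @ (fst z, \<not> e) # q @ (fst y, \<not> d) # k)"
    using assms(1) k q by (simp add: is_line_def)
  have redy: "reduced (fst y) (snd z @ (fst z, \<not> e) # q)"
    using assms(2) q by (simp add: is_line_def)
  have x: "lconj e x z = pushes (snd z) (fst x, q @ (fst y, \<not> d) # k)"
    using unpush_append[OF redx] k q by (cases x) (simp add: lconj_def)
  have y: "lconj e y z = pushes (snd z) (fst y, q)"
    using unpush_append[OF redy] q by (cases y) (simp add: lconj_def)
  have rx: "reduced (fst x) (q @ (fst y, \<not> d) # k)" using reduced_append[OF redx] reduced_tl by fastforce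
  have ry: "reduced (fst y) q" using reduced_append[OF redy] reduced_tl by fastforce
  have "lconj d (fst x, q @ (fst y, \<not> d) # k) (fst y, q) = pushes q (fst x, k)"
    using unpush_append[OF rx] by (simp add: lconj_def)
  then have "lconj e (lconj d x y) z = pushes (snd z) (pushes q (fst x, k))"
    using lconj_distrib[OF assms(1,2), of e d z] x y lconj_pushes[of _ _ d "snd z"] rx ry by simp
  then show "length (snd (lconj e (lconj d x y) z)) < length (snd x)"
    using length_pushes_le[of "snd z @ q" "(fst x, k)"] k q by simp
qed

text \<open>Moves on bases are accompanied by the corresponding elements of a group with welded braid relations. The
  measure of a state is the total length of its basis, and every move changes it.\<close>

locale peaks = welded_relations n r s + tuples n for n and r :: "nat \<Rightarrow> 'g::group_add" and s
begin

text \<open>The element that corresponds to a move in the direction given by the sign.\<close>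

definition signed :: "bool \<Rightarrow> 'g \<Rightarrow> 'g" where
  "signed e g = (if e then g else - g)"

lemma signed_commute: "x + y = y + x \<Longrightarrow> signed e x + signed d y = signed d y + signed e (x :: 'g)"
proof -
  assume h: "x + y = y + x"
  have inv: "- u + v = v + - u" if "u + v = v + u" for u v :: 'g
  proof -
    have "- u + v = - u + (v + u) + - u" by (simp add: add.assoc del: add_uminus_conv_diff)
    also have "\<dots> = - u + (u + v) + - u" using that by simp
    finally show ?thesis by (simp add: add.assoc[symmetric] del: add_uminus_conv_diff)
  qed
  show ?thesis
    using h inv[OF h] inv[OF h[symmetric]] inv[OF inv[OF h, symmetric]] by (simp add: signed_def)
qed

text \<open>A state consists of a tuple and the group element collected on the way to it.\<close>

definition step :: "nat \<Rightarrow> nat \<Rightarrow> bool \<Rightarrow> tuple \<times> 'g \<Rightarrow> tuple \<times> 'g" where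
  "step i j e x = (move i j e (fst x), snd x + signed e (twist i j))"

definition edge :: "tuple \<times> 'g \<Rightarrow> tuple \<times> 'g \<Rightarrow> bool" where
  "edge x y \<longleftrightarrow> basis (fst x) \<and> (\<exists>i\<in>{1..n}. \<exists>j\<in>{1..n}. \<exists>e. i \<noteq> j \<and> y = step i j e x)"

abbreviation len :: "tuple \<times> 'g \<Rightarrow> nat" where
  "len x \<equiv> size_of (fst x)"

lemma step_cancel:
  assumes "basis (fst x)" "i \<in> {1..n}" "i \<noteq> j"
  shows "step i j (\<not> e) (step i j e x) = x"
  using move_cancel[of "fst x" i j e] basis_line[OF assms(1,2)] assms(3)
  by (cases x) (auto simp: step_def signed_def add.assoc)

lemma edge_step: "\<lbrakk>basis (fst x); i \<in> {1..n}; j \<in> {1..n}; i \<noteq> j\<rbrakk> \<Longrightarrow> edge x (step i j e x)"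
  unfolding edge_def by blast

lemma basis_step: "\<lbrakk>basis (fst x); i \<in> {1..n}; j \<in> {1..n}; i \<noteq> j\<rbrakk> \<Longrightarrow> basis (fst (step i j e x))"
  by (simp add: step_def basis_move)

lemma edge_sym: "edge x y \<Longrightarrow> edge y x"
  unfolding edge_def using basis_step step_cancel by metis

lemma edge_level: "edge x y \<Longrightarrow> len x \<noteq> len y"
proof -
  assume "edge x y"
  then obtain i j e where "basis (fst x)" "i \<in> {1..n}" "j \<in> {1..n}" "i \<noteq> j" "y = step i j e x"
    unfolding edge_def by blast
  then show ?thesis using size_move[of "fst x" i j e] by (fastforce simp: step_def)
qed

text \<open>The relation that peak reduction demands between the two neighbours of a peak of measure \<open>M\<close>. The edges
  of the path may go up or down as long as the vertices stay low.\<close>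

definition low :: "nat \<Rightarrow> tuple \<times> 'g \<Rightarrow> tuple \<times> 'g \<Rightarrow> bool" where
  "low M = (\<lambda>u v. edge u v \<and> len u < M \<and> len v < M)\<^sup>*\<^sup>*"

lemma low_edge: "\<lbrakk>edge u v; len u < M; len v < M\<rbrakk> \<Longrightarrow> low M u v"
  unfolding low_def by blast

lemma low_sym: "low M u v \<Longrightarrow> low M v u"
  unfolding low_def by (rule sympD[OF symp_rtranclp]) (auto intro!: sympI edge_sym)

lemma low_trans: "low M u v \<Longrightarrow> low M v w \<Longrightarrow> low M u w"
  unfolding low_def by (rule rtranclp_trans)

text \<open>Reductions at different places that do not interfere commute, by McCool's relations with a common
  conjugating element or with four different indices.\<close>

lemma square:
  assumes x: "basis (fst x)" and "i \<in> {1..n}" "j \<in> {1..n}" "k \<in> {1..n}" "l \<in> {1..n}"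
    and ne: "i \<noteq> j" "k \<noteq> l" "i \<noteq> k" "l \<noteq> i" "j \<noteq> k"
    and red: "reducible (fst x) i j e" "reducible (fst x) k l d"
  shows "low (len x) (step i j e x) (step k l d x)"
proof -
  obtain Y g where Y: "x = (Y, g)" by (cases x)
  have b: "basis Y" using x Y by simp
  have "twist i j + twist k l = twist k l + twist i j"
  proof (cases "j = l")
    case True
    then show ?thesis using twist_commute_target(1)[of i j k] assms by simp
  next
    case False
    then show ?thesis using twist_commute_disjoint[of i j k l] assms by simp
  qed
  then have c: "signed e (twist i j) + signed d (twist k l) = signed d (twist k l) + signed e (twist i j)"
    by (rule signed_commute)
  have z: "step k l d (step i j e x) = step i j e (step k l d x)"
    using ne c by (auto simp: step_def move_def Y add.assoc)
  have li: "len (step i j e x) < len x" and lk: "len (step k l d x) < len x"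
    using size_move(1)[OF b, of i j e] size_move(1)[OF b, of k l d] assms Y by (simp_all add: step_def)
  have "reducible (move i j e Y) k l d"
    using red(2) ne Y by (simp add: reducible_def move_def)
  then have lz: "len (step k l d (step i j e x)) < len x"
    using size_move(1)[OF basis_move[OF b], of i j k l e d] li assms Y by (simp add: step_def)
  have "low (len x) (step i j e x) (step k l d (step i j e x))"
    using assms li lz by (intro low_edge edge_step basis_step) auto
  moreover have "low (len x) (step k l d x) (step i j e (step k l d x))"
    using assms lk lz z by (intro low_edge edge_step basis_step) auto
  ultimately show ?thesis using z low_trans low_sym by metis
qed

text \<open>Three nested reductions of the same state. Conjugating both \<open>i\<close> and \<open>l\<close> by \<open>j\<close> commutes with conjugating \<open>i\<close>
  by \<open>l\<close>; the two ways around give a hexagon with the vertices \<open>?A\<close>, \<open>?U\<close>, \<open>?Z\<close>, \<open>?V\<close>, \<open>?C\<close> and the peak, and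
  \<open>?B\<close> is attached to \<open>?U\<close>. All vertices other than the peak are short by the preceding lemma on lines.\<close>

lemma hexagon:
  assumes x: "basis (fst x)" and i: "i \<in> {1..n}" and l: "l \<in> {1..n}" and j: "j \<in> {1..n}"
    and ne: "i \<noteq> l" "i \<noteq> j" "l \<noteq> j"
    and red: "reducible (fst x) i l d" "reducible (fst x) l j e"
  shows "low (len x) (step i j e x) (step l j e x)" "low (len x) (step i j e x) (step i l d x)"
    "low (len x) (step l j e x) (step i l d x)"
proof -
  obtain Y g where Y: "x = (Y, g)" by (cases x)
  have b: "basis Y" using x Y by simp
  note ln = basis_line[OF b i] basis_line[OF b l] basis_line[OF b j]
  note nest = nested_reduction[OF ln red[unfolded reducible_def Y fst_conv]]
  have redij: "reducible Y i j e" using nest(1) by (simp add: reducible_def)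
  let ?A = "step i j e x" and ?B = "step l j e x" and ?C = "step i l d x"
  let ?U = "step l j e ?A" and ?V = "step i j e ?C"
  let ?Z = "step l j e ?V"
  have c1: "signed e (twist i j) + signed e (twist l j) = signed e (twist l j) + signed e (twist i j)"
    using twist_commute_target(1)[of i j l] i l j ne by (intro signed_commute) auto
  have "signed e (twist i j + twist l j) + signed d (twist i l)
      = signed d (twist i l) + signed e (twist i j + twist l j)"
    using twist_commute_target[of l j i] i l j ne by (intro signed_commute) auto
  moreover have "signed e (twist i j + twist l j) = signed e (twist i j) + signed e (twist l j)"
    using twist_commute_target(1)[of i j l] i l j ne by (auto simp: signed_def minus_add)
  ultimately have c2: "signed e (twist i j) + (signed e (twist l j) + signed d (twist i l))
      = signed d (twist i l) + (signed e (twist i j) + signed e (twist l j))"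
    by (simp add: add.assoc)
  have U: "?U = step i j e ?B"
    using ne c1 by (auto simp: step_def move_def Y add.assoc)
  have Z: "?Z = step i l d ?U"
    using ne c2 lconj_distrib[OF ln(1,2), of e d "Y j"]
    by (auto simp: step_def move_def Y add.assoc fun_eq_iff)
  have A: "len ?A < len x" and B: "len ?B < len x" and C: "len ?C < len x"
    using size_move(1)[OF b] redij red i j l ne Y by (simp_all add: step_def)
  have rl: "length (snd (lconj e (Y l) (Y j))) < length (snd (Y l))"
    using length_lconj_less[OF ln(2)] red(2) Y by (simp add: reducible_def)
  have ri: "length (snd (lconj e (Y i) (Y j))) < length (snd (Y i))"
    using length_lconj_less[OF ln(1)] redij by (simp add: reducible_def)
  have UY: "fst ?U = Y(i := lconj e (Y i) (Y j), l := lconj e (Y l) (Y j))"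
    using ne by (simp add: step_def move_def Y)
  have ZY: "fst ?Z = Y(i := lconj e (lconj d (Y i) (Y l)) (Y j), l := lconj e (Y l) (Y j))"
    and VY: "fst ?V = Y(i := lconj e (lconj d (Y i) (Y l)) (Y j))"
    using ne by (simp_all add: step_def move_def Y)
  have two: "size_of (Y(i := p, l := q)) < size_of Y"
    if "length (snd p) < length (snd (Y i))" "length (snd q) < length (snd (Y l))" for p q
    using size_upd[OF i, of Y p] size_upd[OF l, of "Y(i := p)" q] that ne by simp
  have LU: "len ?U < len x" and LZ: "len ?Z < len x"
    using two[OF ri rl] two[OF nest(2) rl] UY ZY Y by simp_all
  have LV: "len ?V < len x"
    using size_upd[OF i, of Y "lconj e (lconj d (Y i) (Y l)) (Y j)"] nest(2) VY Y by simp
  have e: "basis (fst y) \<Longrightarrow> len y < len x \<Longrightarrow> len (step p q f y) < len x \<Longrightarrow> low (len x) y (step p q f y)"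
    if "p \<in> {1..n}" "q \<in> {1..n}" "p \<noteq> q" for p q f y
    using that by (intro low_edge edge_step)
  have bA: "basis (fst ?A)" and bB: "basis (fst ?B)" and bC: "basis (fst ?C)" 
    and bU: "basis (fst ?U)" and bV: "basis (fst ?V)"
    using x i j l ne by (simp_all add: basis_step del: atLeastAtMost_iff)
  have AU: "low (len x) ?A ?U" using e[OF l j ne(3) bA A LU] .
  have BU: "low (len x) ?B ?U" using e[OF i j ne(2) bB B] LU U by simp
  have UZ: "low (len x) ?U ?Z" using e[OF i l ne(1) bU LU] LZ Z by simp
  have VZ: "low (len x) ?V ?Z" using e[OF l j ne(3) bV LV LZ] .
  have CV: "low (len x) ?C ?V" using e[OF i j ne(2) bC C LV] .
  have UC: "low (len x) ?U ?C" using low_trans[OF UZ low_sym[OF low_trans[OF CV VZ]]] .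
  show "low (len x) ?A ?B" using low_trans[OF AU low_sym[OF BU]] .
  show "low (len x) ?A ?C" using low_trans[OF AU UC] .
  show "low (len x) ?B ?C" using low_trans[OF BU UC] .
qed

text \<open>If both moves change the same entry, the two tails are initial parts of the tail of that entry, so one is
  an initial part of the other and the reductions are nested. Two entries cannot shorten each other, since
  each would be longer than the other.\<close>

lemma peak:
  assumes x: "basis (fst x)" and i: "i \<in> {1..n}" and j: "j \<in> {1..n}" and ij: "i \<noteq> j"
    and k: "k \<in> {1..n}" and l: "l \<in> {1..n}" and kl: "k \<noteq> l"
    and red: "reducible (fst x) i j e" "reducible (fst x) k l d"
  shows "low (len x) (step i j e x) (step k l d x)"
proof -
  define Y where "Y = fst x"
  have Y: "basis Y" using x by (simp add: Y_def)
  have less: "length (snd (Y b)) < length (snd (Y a))" if "reducible Y a b f" for a b f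
    using that by (auto simp: reducible_def prefix_def)
  note r = red[folded Y_def]
  consider "i = k" "j = l" | "i = k" "j \<noteq> l" | "i \<noteq> k" "j = k" | "i \<noteq> k" "l = i"
    | "i \<noteq> k" "j \<noteq> k" "l \<noteq> i" by blast
  then show ?thesis
  proof cases
    case 1
    then have "e = d" using r by (auto simp: reducible_def prefix_def)
    then show ?thesis using 1 by (simp add: low_def)
  next
    case 2
    let ?p = "snd (Y j) @ [(fst (Y j), \<not> e)]" and ?q = "snd (Y l) @ [(fst (Y l), \<not> d)]"
    have pq: "prefix ?p (snd (Y i))" "prefix ?q (snd (Y i))" using r 2 by (simp_all add: reducible_def)
    consider "length (snd (Y j)) < length (snd (Y l))" | "length (snd (Y l)) < length (snd (Y j))"
      | "length (snd (Y j)) = length (snd (Y l))" by linarith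
    then show ?thesis
    proof cases
      case 1
      then have "reducible Y l j e"
        using prefix_length_prefix[OF pq(1), of "snd (Y l)"] pq(2)
        by (auto simp: reducible_def dest: append_prefixD)
      then show ?thesis using hexagon(2)[OF x i l j] 2 ij kl r by (simp add: Y_def)
    next
      case shorter: 2
      then have "reducible Y j l d"
        using prefix_length_prefix[OF pq(2), of "snd (Y j)"] pq(1)
        by (auto simp: reducible_def dest: append_prefixD)
      then show ?thesis using low_sym[OF hexagon(2)[OF x i j l]] 2 ij kl r by (simp add: Y_def)
    next
      case 3
      then have "Y j = Y l" using pq by (auto simp: prefix_def prod_eq_iff)
      then show ?thesis using basis_inj[OF Y j l] 2 by blast
    qed
  next
    case 3
    then have "l \<noteq> i" using less[OF r(1)] less[OF r(2)] by auto
    then show ?thesis using low_sym[OF hexagon(3)[OF x i j l]] 3 ij kl red by simp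
  next
    case 4
    then have "k \<noteq> j" using less[OF r(1)] less[OF r(2)] by auto
    then show ?thesis using hexagon(3)[OF x k i j] 4 ij kl red by simp
  next
    case 5
    then show ?thesis using square[OF x i j k l ij kl] red by simp
  qed
qed

end

section \<open>Words and bases\<close>

context peaks
begin

definition descent :: "tuple \<times> 'g \<Rightarrow> tuple \<times> 'g \<Rightarrow> bool" where
  "descent = (\<lambda>x y. edge x y \<and> len y < len x)"

lemma descent_iff: "descent x y \<longleftrightarrow> edge x y \<and> len y < len x"
  by (simp add: descent_def)

text \<open>The state descends to a permutation of the standard basis, and the group element collected there is the
  one that belongs to the permutation. For the standard basis itself this says that the element is zero.\<close>

definition normalizes :: "tuple \<times> 'g \<Rightarrow> bool" where
  "normalizes x \<longleftrightarrow> basis (fst x) \<and> (\<exists>h p. (h, p) \<in> graph 1 n \<and> descent\<^sup>*\<^sup>* x (std_basis \<circ> app p, h))"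

lemma len_permuted: "len (std_basis \<circ> \<pi>, h) = 0"
  by (simp add: size_of_def std_basis_def)

lemma terminal_unique:
  assumes "descent\<^sup>*\<^sup>* x a" "descent\<^sup>*\<^sup>* x b" "\<nexists>c. descent a c" "\<nexists>c. descent b c"
  shows "a = b"
proof (rule peak_reduction[where E = edge and m = len, OF edge_sym edge_level _
      assms[unfolded descent_def]])
  fix y a b assume E: "edge y a" "edge y b" "len a < len y" "len b < len y"
  obtain i j e where a: "i \<in> {1..n}" "j \<in> {1..n}" "i \<noteq> j" "a = step i j e y" and y: "basis (fst y)"
    using E(1) unfolding edge_def by blast
  obtain k l d where b: "k \<in> {1..n}" "l \<in> {1..n}" "k \<noteq> l" "b = step k l d y"
    using E(2) unfolding edge_def by blast
  have "reducible (fst y) i j e"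
    using size_move(2)[OF y a(1-3), of e] E(3) a(4) by (force simp: step_def)
  moreover have "reducible (fst y) k l d"
    using size_move(2)[OF y b(1-3), of d] E(4) b(4) by (force simp: step_def)
  ultimately show "(\<lambda>u v. edge u v \<and> len u < len y \<and> len v < len y)\<^sup>*\<^sup>* a b"
    using peak[OF y a(1-3) b(1-3)] a(4) b(4) by (simp add: low_def)
qed

text \<open>A step upwards is undone by a descent. After a step downwards, the terminal state is the same by
  uniqueness.\<close>

lemma normalizes_edge:
  assumes "normalizes x" "edge x y"
  shows "normalizes y"
proof -
  obtain h p where hp: "(h, p) \<in> graph 1 n" "descent\<^sup>*\<^sup>* x (std_basis \<circ> app p, h)"
    using assms(1) unfolding normalizes_def by blast
  have y: "basis (fst y)" using edge_sym[OF assms(2)] unfolding edge_def by blast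
  have "descent\<^sup>*\<^sup>* y (std_basis \<circ> app p, h)"
  proof (cases "len x < len y")
    case True
    then have "descent y x" using edge_sym[OF assms(2)] by (simp add: descent_iff)
    then show ?thesis using converse_rtranclp_into_rtranclp[of descent y x] hp(2) by blast
  next
    case False
    then have D: "descent x y" using edge_level[OF assms(2)] assms(2) by (auto simp: descent_iff)
    obtain c where c: "descent\<^sup>*\<^sup>* y c" "\<nexists>d. descent c d"
      using terminal_exists[of edge len y] unfolding descent_def by blast
    have "descent\<^sup>*\<^sup>* x c" using converse_rtranclp_into_rtranclp[of descent x y] D c(1) by blast
    moreover have "\<nexists>d. descent (std_basis \<circ> app p, h) d" using len_permuted by (simp add: descent_iff)
    ultimately have "c = (std_basis \<circ> app p, h)" using terminal_unique[OF _ hp(2) c(2)] by blast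
    then show ?thesis using c(1) by simp
  qed
  then show ?thesis using y hp(1) unfolding normalizes_def by blast
qed

lemma size_swap:
  assumes "1 \<le> k" "k < n"
  shows "size_of (Y \<circ> transpose k (Suc k)) = size_of Y"
  unfolding size_of_def comp_def
  by (rule sum.permute[unfolded comp_def, symmetric]) (use assms in \<open>auto intro: permutes_swap_id\<close>)

text \<open>Permuting the entries relabels every move, and conjugation by \<open>r k\<close> relabels the twists accordingly.\<close>

lemma descent_swap:
  assumes k: "1 \<le> k" "k < n" and D: "descent x y"
  defines "t \<equiv> \<lambda>x :: tuple \<times> 'g. (fst x \<circ> transpose k (Suc k), snd x + r k)"
  shows "descent (t x) (t y)"
proof -
  let ?\<tau> = "transpose k (Suc k)"
  obtain i j e where y: "basis (fst x)" "i \<in> {1..n}" "j \<in> {1..n}" "i \<noteq> j" "y = step i j e x"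
    using D unfolding descent_iff edge_def by blast
  have ij: "?\<tau> i \<in> {1..n}" "?\<tau> j \<in> {1..n}" "?\<tau> i \<noteq> ?\<tau> j"
    using y k by (auto simp: transpose_def)
  have tw: "twist (?\<tau> i) (?\<tau> j) = r k + twist i j + r k"
    by (rule twist_swap[OF k y(4,2,3)])
  have rk: "r k + (r k + z) = z" for z using k by simp
  have "signed e (twist i j) + r k = r k + signed e (twist (?\<tau> i) (?\<tau> j))"
    unfolding tw signed_def by (simp add: add.assoc minus_add uminus_r[OF k] rk del: add_uminus_conv_diff)
  moreover have "move i j e (fst x) \<circ> ?\<tau> = move (?\<tau> i) (?\<tau> j) e (fst x \<circ> ?\<tau>)"
    by (auto simp: move_def fun_eq_iff)
  ultimately have "t y = step (?\<tau> i) (?\<tau> j) e (t x)"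
    by (simp add: t_def step_def y(5) add.assoc)
  then have "edge (t x) (t y)"
    using edge_step[of "t x" "?\<tau> i" "?\<tau> j" e] ij basis_swap[OF y(1) k] by (simp add: t_def)
  then show ?thesis using D size_swap[OF k] by (simp add: t_def descent_iff)
qed

lemma normalizes_swap:
  assumes k: "1 \<le> k" "k < n" and x: "normalizes (Y, g)"
  shows "normalizes (Y \<circ> transpose k (Suc k), g + r k)"
proof -
  define t where "t x = (fst x \<circ> transpose k (Suc k), snd x + r k)" for x :: "tuple \<times> 'g"
  obtain h p where hp: "(h, p) \<in> graph 1 n" "descent\<^sup>*\<^sup>* (Y, g) (std_basis \<circ> app p, h)"
    using x unfolding normalizes_def by blast
  have swap: "descent (t x) (t y)" if "descent x y" for x y
    unfolding t_def by (rule descent_swap[OF k that])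
  have "descent\<^sup>*\<^sup>* (t x) (t y)" if "descent\<^sup>*\<^sup>* x y" for x y
    using that
  proof (induction rule: rtranclp_induct)
    case base
    show ?case by (rule rtranclp.rtrancl_refl)
  next
    case (step y z)
    show ?case by (rule rtranclp.rtrancl_into_rtrancl[OF step.IH swap[OF step(2)]])
  qed
  from this[OF hp(2)] have "descent\<^sup>*\<^sup>* (t (Y, g)) (t (std_basis \<circ> app p, h))" .
  moreover have "(h + r k, p + swap k) \<in> graph 1 n"
    using graph_add[OF hp(1)] graph_swap[of 1 k n] k by simp
  moreover have "t (std_basis \<circ> app p, h) = (std_basis \<circ> app (p + swap k), h + r k)"
    by (simp add: t_def comp_assoc)
  moreover have "t (Y, g) = (Y \<circ> transpose k (Suc k), g + r k)"
    by (simp add: t_def)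
  moreover have "basis (Y \<circ> transpose k (Suc k))"
    using x basis_swap[OF _ k] by (simp add: normalizes_def)
  ultimately show ?thesis
    unfolding normalizes_def fst_conv by metis
qed

definition letter_val :: "welded_gen \<times> bool \<Rightarrow> 'g" where
  "letter_val c = signed (snd c) (case fst c of Sig i \<Rightarrow> s i | Rho i \<Rightarrow> r i)"

definition word_val :: "welded_gen gword \<Rightarrow> 'g" where
  "word_val w = sum_list (map letter_val w)"

lemma word_val_simps [simp]: "word_val [] = 0" "word_val (c # w) = letter_val c + word_val w"
  "word_val (v @ w) = word_val v + word_val w"
  by (simp_all add: word_val_def)

lemma normalizes_letter:
  assumes "normalizes (Y, g)" "c \<in> welded_gens n \<times> UNIV"
  shows "normalizes (letter_act c Y, g + letter_val c)"
proof -
  from letter_index[OF assms(2)] obtain i b where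
    i: "1 \<le> i" "i < n" "c = (Rho i, b) \<or> c = (Sig i, True) \<or> c = (Sig i, False)" by metis
  have tw: "twist (Suc i) i = s i + r i" using twist_adjacent[OF i(1,2)] .
  have rr: "r i + r i = 0" "- r i = r i" using r_involution[OF i(1,2)] uminus_r[OF i(1,2)] by auto
  have e: "normalizes (move (Suc i) i e Z, h + signed e (twist (Suc i) i))" if "normalizes (Z, h)" for Z h e
    using normalizes_edge[OF that edge_step[of "(Z, h)" "Suc i" i e]] that i
    by (simp add: normalizes_def step_def)
  from i(3) show ?thesis
  proof (elim disjE)
    assume c: "c = (Rho i, b)"
    then have "letter_val c = r i" using rr by (simp add: letter_val_def signed_def)
    then show ?thesis using normalizes_swap[OF i(1,2) assms(1)] c by simp
  next
    assume c: "c = (Sig i, True)"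
    have "s i + r i + r i = s i" using rr by (simp add: add.assoc)
    then show ?thesis using normalizes_swap[OF i(1,2) e[OF assms(1), of True]] c tw
      by (simp add: letter_val_def signed_def add.assoc)
  next
    assume c: "c = (Sig i, False)"
    have "r i + - (s i + r i) = - s i" using rr by (simp add: minus_add add.assoc[symmetric] del: add_uminus_conv_diff)
    then show ?thesis using e[OF normalizes_swap[OF i(1,2) assms(1)], of False] c tw
      by (simp add: letter_val_def signed_def add.assoc del: add_uminus_conv_diff)
  qed
qed

lemma normalizes_word:
  assumes "normalizes (Y, g)" "w \<in> gwords (welded_gens n)"
  shows "normalizes (word_act w Y, g + word_val w)"
  using assms
proof (induction w arbitrary: Y g)
  case (Cons c w)
  then have "normalizes (letter_act c Y, g + letter_val c)" "w \<in> gwords (welded_gens n)"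
    using normalizes_letter by (auto simp: gwords_def)
  then show ?case using Cons.IH by (fastforce simp: add.assoc)
qed simp

text \<open>The property of normalizing is preserved along the word. At its end the standard basis is terminal, so no
  descent takes place and the collected element belongs to the identity permutation.\<close>

theorem word_val_trivial:
  assumes w: "w \<in> gwords (welded_gens n)" and triv: "word_act w std_basis = std_basis"
  shows "word_val w = 0"
proof -
  have zero: "(0, 0) \<in> graph 1 n" using graph_zero by (simp add: zero_prod_def)
  have "descent\<^sup>*\<^sup>* (std_basis, 0) (std_basis \<circ> app 0, 0)" by simp
  then have "normalizes (std_basis, 0)" using basis_std zero unfolding normalizes_def by fastforce
  from normalizes_word[OF this w] obtain h p where
    hp: "(h, p) \<in> graph 1 n" "descent\<^sup>*\<^sup>* (std_basis, word_val w) (std_basis \<circ> app p, h)"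
    using triv by (auto simp: normalizes_def)
  have "\<nexists>y. descent (std_basis, word_val w) y" using len_permuted[of id] by (simp add: descent_iff)
  then have eq: "std_basis \<circ> app p = std_basis" "word_val w = h"
    using hp(2) by (metis (no_types, lifting) converse_rtranclpE prod.inject)+
  have "app p k = k" for k using fun_cong[OF eq(1), of k] by (simp add: std_basis_def)
  then have "p = 0" by (intro bijection_eqI) (simp add: fun_eq_iff)
  then show ?thesis using graph_unique_zero[of h 1 n] hp(1) eq(2) by simp
qed

lemma graph_word:
  assumes "(g, p) \<in> graph 1 n"
  shows "\<exists>w\<in>gwords (welded_gens n). \<forall>Y. word_act w Y = Y \<circ> app p"
proof -
  have "\<exists>w\<in>gwords (welded_gens n). \<forall>Y. word_act w Y = Y \<circ> app (snd x)" if "x \<in> graph 1 n" for x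
    using that
  proof (induction rule: graph_induct[where P = "\<lambda>_ p. \<exists>w\<in>gwords (welded_gens n). \<forall>Y. word_act w Y = Y \<circ> app p"])
    case zero
    then show ?case by (intro bexI[of _ "[]"]) (auto simp: gwords_def)
  next
    case (step g p i)
    then obtain w where w: "w \<in> gwords (welded_gens n)" "\<forall>Y. word_act w Y = Y \<circ> app p" by blast
    have "w @ [rho i] \<in> gwords (welded_gens n)" using w step by (auto simp: gwords_def welded_gens_def)
    moreover have "\<forall>Y. word_act (w @ [rho i]) Y = Y \<circ> app (p + swap i)"
      using w(2) by (simp add: comp_assoc)
    ultimately show ?case by blast
  qed
  from this[OF assms] show ?thesis by simp
qed

text \<open>Carry the indices \<open>i\<close> and \<open>j\<close> to 2 and 1, apply \<open>\<sigma>\<^sub>1 \<rho>\<^sub>1\<close> or its inverse, and return.\<close>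

lemma move_word:
  assumes ij: "i \<in> {1..n}" "j \<in> {1..n}" "i \<noteq> j"
  shows "\<exists>w\<in>gwords (welded_gens n). \<forall>Y. word_act w Y = move i j e Y"
proof -
  have n2: "1 < n" using ij by auto
  obtain g p where gp: "(g, p) \<in> graph 1 n" "\<And>k. k < length [j, i] \<Longrightarrow> app p (Suc k) = [j, i] ! k"
    using graph_prescribed[of "[j, i]"] ij by auto
  have p: "app p 1 = j" "app p 2 = i" using gp(2)[of 0] gp(2)[of 1] by (auto simp: numeral_2_eq_2)
  obtain v where v: "v \<in> gwords (welded_gens n)" "\<forall>Y. word_act v Y = Y \<circ> app p"
    using graph_word[OF gp(1)] by blast
  obtain v' where v': "v' \<in> gwords (welded_gens n)" "\<forall>Y. word_act v' Y = Y \<circ> app (- p)"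
    using graph_word[OF graph_uminus[OF gp(1)]] by auto
  define c where "c = (if e then [sig 1, rho 1] else [rho 1, (Sig 1, False)])"
  have c: "c \<in> gwords (welded_gens n)" using n2 by (auto simp: c_def gwords_def welded_gens_def)
  have "word_act c Y = move 2 1 e Y" for Y
    by (simp add: c_def comp_assoc numeral_2_eq_2)
  moreover have "move 2 1 e (Y \<circ> app p) \<circ> app (- p) = move i j e Y" for Y
  proof
    fix k
    have 1: "app p (app (- p) k) = k" "app (- p) (app p 2) = 2"
      using bij_app[of p] by (simp_all add: bij_is_surj surj_f_inv_f bij_is_inj)
    then have inv: "app p (app (- p) k) = k" "app (- p) k = 2 \<longleftrightarrow> k = i"
      using p(2) by metis+
    show "(move 2 1 e (Y \<circ> app p) \<circ> app (- p)) k = move i j e Y k"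
      using inv p by (auto simp: move_def simp del: app_uminus)
  qed
  ultimately have "\<forall>Y. word_act (v @ c @ v') Y = move i j e Y" using v v' by simp
  then show ?thesis using v v' c by (intro bexI[of _ "v @ c @ v'"]) auto
qed

text \<open>Reduce the basis by moves until it is a permutation of the generators.\<close>

theorem basis_word:
  assumes "basis Y"
  shows "\<exists>w\<in>gwords (welded_gens n). \<forall>k\<in>{1..n}. word_act w std_basis k = Y k"
  using assms
proof (induction "size_of Y" arbitrary: Y rule: less_induct)
  case less
  show ?case
  proof (cases "\<exists>i\<in>{1..n}. \<exists>j\<in>{1..n}. \<exists>e. i \<noteq> j \<and> reducible Y i j e")
    case True
    then obtain i j e where ij: "i \<in> {1..n}" "j \<in> {1..n}" "i \<noteq> j" "reducible Y i j e" by blast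
    let ?Z = "move i j e Y"
    have Z: "basis ?Z" using basis_move less.prems ij by blast
    obtain v where v: "v \<in> gwords (welded_gens n)" "\<And>k. k \<in> {1..n} \<Longrightarrow> word_act v std_basis k = ?Z k"
      using less.hyps[OF size_move(1)[OF less.prems ij] Z] by blast
    obtain w where w: "w \<in> gwords (welded_gens n)" "\<And>Y. word_act w Y = move i j (\<not> e) Y"
      using move_word[OF ij(1-3)] by blast
    have "word_act (v @ w) std_basis k = Y k" if "k \<in> {1..n}" for k
    proof -
      have "word_act (v @ w) std_basis k = move i j (\<not> e) (word_act v std_basis) k" using w(2) by simp
      also have "\<dots> = move i j (\<not> e) ?Z k" using v(2) ij that by (simp add: move_def)
      also have "\<dots> = Y k" using move_cancel basis_line[OF less.prems ij(1)] ij(3) by simp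
      finally show ?thesis .
    qed
    then show ?thesis using v(1) w(1) by (intro bexI[of _ "v @ w"]) auto
  next
    case False
    then obtain \<pi> where \<pi>: "\<pi> permutes {1..n}" "\<And>k. k \<in> {1..n} \<Longrightarrow> Y k = std_basis (\<pi> k)"
      using irreducible_basis[OF less.prems] by blast
    obtain g p where "(g, p) \<in> graph 1 n" "app p = \<pi>" using graph_exists[OF \<pi>(1)] by auto
    then obtain w where "w \<in> gwords (welded_gens n)" "\<forall>Y. word_act w Y = Y \<circ> \<pi>"
      using graph_word by metis
    then show ?thesis using \<pi>(2) by (intro bexI[of _ w]) auto
  qed
qed

end

section \<open>Faithful permutation representations of presented groups\<close>

text \<open>Cayley's representation, extended by the identity outside the carrier.\<close>

definition left_mult :: "('a, 'b) monoid_scheme \<Rightarrow> 'a \<Rightarrow> 'a bijection" where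
  "left_mult G x = Abs_bijection (\<lambda>y. if y \<in> carrier G then x \<otimes>\<^bsub>G\<^esub> y else y)"

context group
begin

lemma app_left_mult:
  assumes "x \<in> carrier G"
  shows "app (left_mult G x) = (\<lambda>y. if y \<in> carrier G then x \<otimes> y else y)"
proof -
  have "bij (\<lambda>y. if y \<in> carrier G then x \<otimes> y else y)"
    by (rule bijI'; use assms in \<open>auto split: if_splits\<close>)
      (metis assms inv_closed inv_solve_left m_closed)
  then show ?thesis by (simp add: left_mult_def Abs_bijection_inverse)
qed

lemma left_mult_mult:
  "\<lbrakk>x \<in> carrier G; y \<in> carrier G\<rbrakk> \<Longrightarrow> left_mult G (x \<otimes> y) = left_mult G x + left_mult G y"
  by (rule bijection_eqI) (auto simp: app_left_mult fun_eq_iff m_assoc)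

lemma left_mult_inj:
  assumes "x \<in> carrier G" "y \<in> carrier G" "left_mult G x = left_mult G y"
  shows "x = y"
  using fun_cong[OF arg_cong[OF assms(3), of app], of \<one>] assms(1,2) by (simp add: app_left_mult)

end

definition word_rep :: "'g set \<Rightarrow> ('g gword \<times> 'g gword) set \<Rightarrow> 'g gword \<Rightarrow> 'g gword set bijection" where
  "word_rep S R w = left_mult (presented_group S R) (presentation_rel S R `` {w})"

lemma word_rep_append:
  assumes "v \<in> gwords S" "w \<in> gwords S"
  shows "word_rep S R (v @ w) = word_rep S R v + word_rep S R w"
proof -
  interpret group "presented_group S R" by (rule group_presented_group)
  have "presentation_rel S R `` {u} \<in> carrier (presented_group S R)" if "u \<in> gwords S" for u
    using that by (simp add: presented_group_def quotientI)
  then show ?thesis using assms left_mult_mult presented_group_mult[OF assms, of R]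
    by (metis word_rep_def)
qed

lemma word_rep_eq_iff:
  assumes "v \<in> gwords S" "w \<in> gwords S"
  shows "word_rep S R v = word_rep S R w \<longleftrightarrow> (v, w) \<in> presentation_rel S R"
proof -
  interpret group "presented_group S R" by (rule group_presented_group)
  have "presentation_rel S R `` {u} \<in> carrier (presented_group S R)" if "u \<in> gwords S" for u
    using that by (simp add: presented_group_def quotientI)
  then have "word_rep S R v = word_rep S R w
      \<longleftrightarrow> presentation_rel S R `` {v} = presentation_rel S R `` {w}"
    using left_mult_inj assms unfolding word_rep_def by metis
  then show ?thesis using eq_equiv_class_iff[OF equiv_presentation_rel assms] by simp
qed

lemma word_rep_Nil: "word_rep S R [] = 0"
proof -
  have "word_rep S R [] + word_rep S R [] = word_rep S R []"
    using word_rep_append[of "[]" S "[]" R] by (simp add: gwords_def)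
  then show ?thesis by (metis add.right_neutral add_left_cancel)
qed

abbreviation WBrep :: "nat \<Rightarrow> welded_gen gword \<Rightarrow> welded_gen gword set bijection" where
  "WBrep n \<equiv> word_rep (welded_gens n) (welded_rels n)"

lemma WBrep_relation:
  assumes "(v, w) \<in> welded_rels n" "v \<in> gwords (welded_gens n)" "w \<in> gwords (welded_gens n)"
  shows "WBrep n v = WBrep n w"
  using word_rep_eq_iff[OF assms(2,3)] presentation_rel.relation[OF assms] by blast

lemma WBrep_Cons:
  "c # w \<in> gwords (welded_gens n) \<Longrightarrow> WBrep n (c # w) = WBrep n [c] + WBrep n w"
  using word_rep_append[of "[c]" "welded_gens n" w "welded_rels n"] by (simp add: gwords_def)

lemma welded_letters:
  "\<lbrakk>1 \<le> i; i < n\<rbrakk> \<Longrightarrow> Sig i \<in> welded_gens n" "\<lbrakk>1 \<le> i; i < n\<rbrakk> \<Longrightarrow> Rho i \<in> welded_gens n"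
  by (auto simp: welded_gens_def)

lemma peaks_WB:
  assumes "1 \<le> n"
  shows "peaks n (\<lambda>i. WBrep n [rho i]) (\<lambda>i. WBrep n [sig i])"
proof -
  let ?r = "\<lambda>i. WBrep n [rho i]" and ?s = "\<lambda>i. WBrep n [sig i]"
  have gw: "w \<in> gwords (welded_gens n) \<longleftrightarrow> fst ` set w \<subseteq> welded_gens n" for w by (rule gwords_iff)
  note C = WBrep_Cons[of _ _ n, unfolded gw] and W = welded_letters[of _ n]
  have two: "WBrep n [a, b] = WBrep n [a] + WBrep n [b]"
    if "{fst a, fst b} \<subseteq> welded_gens n" for a b
    using C[of a "[b]"] that by simp
  have three: "WBrep n [a, b, c] = WBrep n [a] + WBrep n [b] + WBrep n [c]"
    if "{fst a, fst b, fst c} \<subseteq> welded_gens n" for a b c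
    using C[of a "[b, c]"] two[of b c] that by (simp add: add.assoc)
  show ?thesis
  proof
    fix i assume i: "1 \<le> i" "i < n"
    have "([rho i, rho i], []) \<in> welded_rels n" using i by (auto simp: welded_rels_def)
    from WBrep_relation[OF this] show "?r i + ?r i = 0"
      using two[of "rho i" "rho i"] W[OF i] word_rep_Nil by (simp add: gw)
  next
    fix i j assume i: "1 \<le> i" "i + 2 \<le> j" "j < n"
    have "([rho i, rho j], [rho j, rho i]) \<in> welded_rels n"
      "([sig i, sig j], [sig j, sig i]) \<in> welded_rels n"
      using i by (auto simp: welded_rels_def)
    from this[THEN WBrep_relation] show "?r i + ?r j = ?r j + ?r i" "?s i + ?s j = ?s j + ?s i"
      using two W[of i] W[of j] i by (simp_all add: gw)
  next
    fix i j assume i: "1 \<le> i" "1 \<le> j" "i < n" "j < n" "i + 2 \<le> j \<or> j + 2 \<le> i"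
    have "([sig i, rho j], [rho j, sig i]) \<in> welded_rels n"
      using i by (auto simp: welded_rels_def)
    from WBrep_relation[OF this] show "?s i + ?r j = ?r j + ?s i"
      using two W[of i] W[of j] i by (simp_all add: gw)
  next
    fix i assume i: "1 \<le> i" "Suc i < n"
    have "([sig i, sig (i+1), sig i], [sig (i+1), sig i, sig (i+1)]) \<in> welded_rels n"
      "([rho i, rho (i+1), rho i], [rho (i+1), rho i, rho (i+1)]) \<in> welded_rels n"
      "([rho i, rho (i+1), sig i], [sig (i+1), rho i, rho (i+1)]) \<in> welded_rels n"
      "([sig i, sig (i+1), rho i], [rho (i+1), sig i, sig (i+1)]) \<in> welded_rels n"
      using i by (auto simp: welded_rels_def)
    from this[THEN WBrep_relation]
    show "?r i + ?r (Suc i) + ?r i = ?r (Suc i) + ?r i + ?r (Suc i)"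
      "?s i + ?s (Suc i) + ?s i = ?s (Suc i) + ?s i + ?s (Suc i)"
      "?r i + ?r (Suc i) + ?s i = ?s (Suc i) + ?r i + ?r (Suc i)"
      "?s i + ?s (Suc i) + ?r i = ?r (Suc i) + ?s i + ?s (Suc i)"
      using three W[of i] W[of "Suc i"] i by (simp_all add: gw)
  qed (rule assms)
qed

section \<open>The welded braid group as automorphism group\<close>

text \<open>The words act by automorphisms that respect the relations. Every automorphism arises because every basis
  is reached by a word, and a word with trivial action is trivial in the group by peak reduction, applied to
  the regular representation of \<open>WB n\<close> itself.\<close>

theorem WB_iso_line_quandle:
  assumes "1 \<le> n"
  shows "WB n \<cong> AutQuandle (line_quandle {1..n})"
proof -
  let ?S = "welded_gens n" and ?R = "welded_rels n"
  interpret peaks n "\<lambda>i. WBrep n [rho i]" "\<lambda>i. WBrep n [sig i]" by (rule peaks_WB[OF assms])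
  let ?c = "\<lambda>w. presentation_rel ?S ?R `` {w}" and ?aut = "\<lambda>w. endo (word_act w std_basis)"
  have car: "carrier (WB n) = ?c ` gwords ?S"
    by (auto simp: WB_def presented_group_def quotient_def)
  have letter: "letter_val (g, b) = WBrep n [(g, b)]" if "g \<in> ?S" for g b
  proof -
    have pos: "letter_val (g, b) = signed b (WBrep n [(g, True)])"
      by (simp add: letter_val_def split: welded_gen.split)
    have "WBrep n ([(g, True)] @ [(g, False)]) = WBrep n []"
      using presentation_rel.cancel[OF that, of True ?R] that
      by (subst word_rep_eq_iff) (simp_all add: gwords_iff)
    then have "WBrep n [(g, True)] + WBrep n [(g, False)] = 0"
      using word_rep_append[of "[(g, True)]" ?S "[(g, False)]" ?R] that
      by (simp add: gwords_iff word_rep_Nil)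
    then have "- WBrep n [(g, True)] = WBrep n [(g, False)]" by (rule minus_unique)
    then show ?thesis using pos by (cases b) (simp_all add: signed_def)
  qed
  have val: "word_val w = WBrep n w" if "w \<in> gwords ?S" for w
    using that
  proof (induction w)
    case (Cons a w)
    then have "fst a \<in> ?S" "w \<in> gwords ?S" by (auto simp: gwords_iff)
    then show ?case using WBrep_Cons[OF Cons.prems] letter[of "fst a" "snd a"] Cons.IH by simp
  qed (simp add: word_rep_Nil)
  have sound: "?aut v = ?aut w" if "(v, w) \<in> presentation_rel ?S ?R" for v w
    using word_act_presentation[OF that] std_is_line by metis
  have faithful: "(v, w) \<in> presentation_rel ?S ?R"
    if vw: "v \<in> gwords ?S" "w \<in> gwords ?S" and eq: "?aut v = ?aut w" for v w
  proof -
    have inside: "word_act v std_basis k = word_act w std_basis k" if "k \<in> {1..n}" for k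
      using endo_std[OF that] eq by metis
    have outside: "word_act u std_basis k = std_basis k" if "u \<in> gwords ?S" "k \<notin> {1..n}" for u k
    proof -
      have "letter_act c Y k = Y k" if "c \<in> ?S \<times> UNIV" for c Y
        using that \<open>k \<notin> {1..n}\<close> by (cases "(c, Y)" rule: letter_act.cases)
          (auto simp: welded_gens_def move_def transpose_def)
      then have "word_act u Y k = Y k" for Y
        using \<open>u \<in> gwords ?S\<close> by (induction u arbitrary: Y) (auto simp: gwords_def)
      then show ?thesis .
    qed
    have "word_act v std_basis = word_act w std_basis"
    proof
      fix k show "word_act v std_basis k = word_act w std_basis k"
        using inside[of k] outside[OF vw(1), of k] outside[OF vw(2), of k] by (cases "k \<in> {1..n}") simp_all
    qed
    then have "word_act (v @ winv w) std_basis = std_basis" using word_act_winv[of std_basis w] std_is_line by simp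
    then have "WBrep n (v @ winv w) = 0"
      using word_val_trivial[of "v @ winv w"] val[of "v @ winv w"] vw by simp
    moreover have "WBrep n (w @ winv w) = 0"
      using word_val_trivial[of "w @ winv w"] val[of "w @ winv w"] vw(2) word_act_winv[of std_basis w] std_is_line
      by simp
    ultimately have "WBrep n v = WBrep n w"
      using word_rep_append[of _ ?S "winv w" ?R] vw by (metis add_right_cancel winv_gwords)
    then show ?thesis using word_rep_eq_iff[OF vw] by blast
  qed
  define f where "f A = ?aut (SOME w. w \<in> gwords ?S \<and> A = ?c w)" for A
  have f: "f (?c w) = ?aut w" if w: "w \<in> gwords ?S" for w
  proof -
    let ?u = "SOME u. u \<in> gwords ?S \<and> ?c w = ?c u"
    have "?u \<in> gwords ?S \<and> ?c w = ?c ?u" by (rule someI[of _ w]) (use w in simp)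
    then have "(w, ?u) \<in> presentation_rel ?S ?R"
      using eq_equiv_class_iff[OF equiv_presentation_rel w] by blast
    from sound[OF this] show ?thesis by (simp add: f_def)
  qed
  have "inj_on f (carrier (WB n))"
  proof (rule inj_onI)
    fix A B assume AB: "A \<in> carrier (WB n)" "B \<in> carrier (WB n)" "f A = f B"
    then obtain v w where vw: "v \<in> gwords ?S" "w \<in> gwords ?S" "A = ?c v" "B = ?c w"
      unfolding car by blast
    then have "(v, w) \<in> presentation_rel ?S ?R" using faithful[OF vw(1,2)] f AB(3) by simp
    then show "A = B" using equiv_class_eq[OF equiv_presentation_rel] vw(3,4) by blast
  qed
  moreover have "f ` carrier (WB n) = qauto FL"
  proof
    show "f ` carrier (WB n) \<subseteq> qauto FL" unfolding car using f endo_word_auto by auto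
    show "qauto FL \<subseteq> f ` carrier (WB n)"
    proof
      fix \<phi> assume \<phi>: "\<phi> \<in> qauto FL"
      then have hom: "\<phi> \<in> qhom FL FL" and ext: "\<phi> \<in> extensional L" by (auto simp: qauto_def Bij_def)
      define Y where "Y = \<phi> \<circ> std_basis"
      have Y: "Y \<in> {1..n} \<rightarrow> L" using std_carrier qhom_closed[OF hom] by (fastforce simp: Y_def)
      have "endo Y = \<phi>"
      proof (rule extensionalityI[of _ L])
        show "endo Y x = \<phi> x" if "x \<in> L" for x
          using hom_eqI[OF endo_qhom[OF Y] hom _ that] endo_std by (simp add: Y_def)
      qed (use ext in \<open>simp_all add: endo_def\<close>)
      then have "basis Y" using Y \<phi> by (simp add: basis_def)
      then obtain w where w: "w \<in> gwords ?S" "\<And>k. k \<in> {1..n} \<Longrightarrow> word_act w std_basis k = Y k"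
        using basis_word by blast
      have "?aut w = \<phi>"
        using endo_cong[of Y "word_act w std_basis"] w(2) Y \<open>endo Y = \<phi>\<close> by simp
      then show "\<phi> \<in> f ` carrier (WB n)" using f[OF w(1)] w(1) car by (metis imageI)
    qed
  qed
  moreover have "f (A \<otimes>\<^bsub>WB n\<^esub> B) = compose L (f A) (f B)"
    if AB: "A \<in> carrier (WB n)" "B \<in> carrier (WB n)" for A B
  proof -
    obtain v w where vw: "v \<in> gwords ?S" "w \<in> gwords ?S" "A = ?c v" "B = ?c w" using AB car by auto
    then show ?thesis
      using presented_group_mult[OF vw(1,2), of ?R] f endo_append[OF vw(1,2)] f[of "v @ w"]
      by (simp add: WB_def)
  qed
  moreover have "\<phi> \<in> Bij L" if "\<phi> \<in> qauto FL" for \<phi> using that by (simp add: qauto_def)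
  ultimately have "f \<in> iso (WB n) (AutQuandle FL)"
    by (auto simp: iso_def hom_def bij_betw_def AutQuandle_def BijGroup_def)
  then show ?thesis by (rule is_isoI)
qed

section \<open>The isomorphisms\<close>

theorem corollary5p5:
  fixes n :: nat
  assumes "n \<ge> 1"
  shows "AutQuandleRing (FQ n) \<cong> AutQuandle (FQ n) \<and> AutQuandle (FQ n) \<cong> WB n"
proof
  have S: "{1..n} \<noteq> {}" using assms by simp
  note F = quandle_free_quandle[OF S] and L = quandle_line_quandle[OF S]
  obtain h where h: "h \<in> qhom (FQ n) (line_quandle {1..n})"
    "bij_betw h (carrier (FQ n)) (carrier (line_quandle {1..n}))"
    using free_quandle_line_iso[OF S] .
  have "unique_products (FQ n)"
    using unique_products_transfer[OF unique_products_line_quandle h(1)] h(2) quandle.op_closed[OF F]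
    by (auto simp: bij_betw_def)
  then show "AutQuandleRing (FQ n) \<cong> AutQuandle (FQ n)" by (rule AutQuandleRing_iso[OF F])
  have "AutQuandle (FQ n) \<cong> AutQuandle (line_quandle {1..n})"
    by (rule AutQuandle_cong[OF F L h])
  moreover have "AutQuandle (line_quandle {1..n}) \<cong> WB n"
    by (rule group.iso_sym[OF group_WB WB_iso_line_quandle[OF assms]])
  ultimately show "AutQuandle (FQ n) \<cong> WB n" by (rule iso_trans)
qed

end
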